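(* For $0<\epsilon<1$ let $E_\epsilon=\{z\in\mathbb{C} : |\mathrm{Im}\, z|\le\epsilon\}\cup\{\infty\}\subset\mathbb{P}^1(\mathbb{C})$. Then the $\delta$-Robin constant of $E_\epsilon$ satisfies \[ V_\delta(E_\epsilon)\geq \frac{7\zeta(3)}{2\pi^2} - c_1 \epsilon - c_2 \epsilon^{1/8}, \] where $c_1=0.678\ldots$ and $c_2=2.505\ldots$ are the absolute constants defined in the context. In particular, for every Borel probability measure $\mu$ supported on $E_\epsilon$, \[ I(\mu)=\iint_{E_\epsilon\times E_\epsilon} -\log\delta(x,y)\,d\mu(x)\,d\mu(y) \geq \frac{7\zeta(3)}{2\pi^2} - c_1 \epsilon - c_2 \epsilon^{1/8}. \]
   Context: For $x=(x_0:x_1)$, $y=(y_0:y_1)\in\mathbb{P}^1(\mathbb{C})$, $\delta(x,y)=\frac{|x_0y_1-y_0x_1|}{\max\{|x_0|,|x_1|\}\max\{|y_0|,|y_1|\}}$. The $\delta$-Robin constant of a closed set $E\subset\mathbb{P}^1(\mathbb{C})$ is $V_\delta(E)=\inf_\nu I(\nu)$ over Borel probability measures $\nu$ supported on $E$, where $I(\nu)=\iint -\log\delta(x,y)\,d\nu(x)\,d\nu(y)$. $\zeta(3)=\sum_{n\ge1}n^{-3}$. Let $\mu_{\mathbb{R}}$ be the probability measure on $\mathbb{R}$ with density $\frac{1}{\pi^2 z}\log\left|\frac{z+1}{z-1}\right|$; then $c_1=\frac12\left\|\log\left(1+\frac{1}{(1-z)^2}\right)\right\|_{L^1(\mu_{\mathbb{R}})}$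 and $c_2=\left\|\log\left(1+\frac{1}{(1-z)^2}\right)\right\|_{L^2(\mu_{\mathbb{R}})}$. *)

theory Defs
  imports "HOL-Probability.Probability"
begin

definition p1_rel :: "complex \<times> complex \<Rightarrow> complex \<times> complex \<Rightarrow> bool" where
  "p1_rel x y \<longleftrightarrow> x \<noteq> 0 \<and> y \<noteq> 0 \<and> (\<exists>c. c \<noteq> 0 \<and> fst y = c * fst x \<and> snd y = c * snd x)"

lemma part_equivp_p1_rel: "part_equivp p1_rel"
proof (rule part_equivpI)
  show "\<exists>x. p1_rel x x"
    by (intro exI[of _ "(1, 0)"]) (auto simp: p1_rel_def zero_prod_def intro: exI[of _ 1])
  show "symp p1_rel"
  proof (rule sympI)
    fix x y assume "p1_rel x y"
    then obtain c where "x \<noteq> 0" "y \<noteq> 0" "c \<noteq> 0" "fst y = c * fst x" "snd y = c * snd x"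
      by (auto simp: p1_rel_def)
    then show "p1_rel y x"
      unfolding p1_rel_def by (intro conjI exI[of _ "inverse c"]) auto
  qed
  show "transp p1_rel"
  proof (rule transpI)
    fix x y z assume "p1_rel x y" "p1_rel y z"
    then obtain c d where "x \<noteq> 0" "z \<noteq> 0" "c \<noteq> 0" "fst y = c * fst x" "snd y = c * snd x"
      "d \<noteq> 0" "fst z = d * fst y" "snd z = d * snd y"
      by (auto simp: p1_rel_def)
    then show "p1_rel x z"
      unfolding p1_rel_def by (intro conjI exI[of _ "d * c"]) auto
  qed
qed

quotient_type cp1 = "complex \<times> complex" / partial: p1_rel
  by (rule part_equivp_p1_rel)

text \<open>
  The quotient topology from \<open>\<complex>\<^sup>2 - {0}\<close>; as \<open>\<complex>\<^sup>2 - {0}\<close> is open, openness of the preimage can be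
  tested in \<open>\<complex>\<^sup>2\<close>.
\<close>

instantiation cp1 :: topological_space
begin

definition open_cp1 :: "cp1 set \<Rightarrow> bool" where
  "open_cp1 U \<longleftrightarrow> open {x. x \<noteq> 0 \<and> abs_cp1 x \<in> U}"

instance
proof
  have "{x :: complex \<times> complex. x \<noteq> 0 \<and> abs_cp1 x \<in> UNIV} = - {0}" by auto
  then show "open (UNIV :: cp1 set)" unfolding open_cp1_def by (simp add: open_Compl)
next
  fix S T :: "cp1 set" assume "open S" "open T"
  moreover have "{x. x \<noteq> 0 \<and> abs_cp1 x \<in> S \<inter> T} =
      {x. x \<noteq> 0 \<and> abs_cp1 x \<in> S} \<inter> {x. x \<noteq> 0 \<and> abs_cp1 x \<in> T}" by auto
  ultimately show "open (S \<inter> T)" unfolding open_cp1_def by (simp add: open_Int)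
next
  fix K :: "cp1 set set" assume "\<forall>S\<in>K. open S"
  moreover have "{x. x \<noteq> 0 \<and> abs_cp1 x \<in> \<Union>K} = (\<Union>S\<in>K. {x. x \<noteq> 0 \<and> abs_cp1 x \<in> S})" by auto
  ultimately show "open (\<Union>K)" unfolding open_cp1_def by auto
qed

end

lift_definition cp1_of_complex :: "complex \<Rightarrow> cp1" is "\<lambda>z. (z, 1)"
  by (auto simp: p1_rel_def zero_prod_def intro: exI[of _ 1])

lift_definition cp1_infinity :: cp1 is "(1, 0)"
  by (auto simp: p1_rel_def zero_prod_def intro: exI[of _ 1])

lift_definition delta :: "cp1 \<Rightarrow> cp1 \<Rightarrow> real" is
  "\<lambda>x y. cmod (fst x * snd y - fst y * snd x) /
      (max (cmod (fst x)) (cmod (snd x)) * max (cmod (fst y)) (cmod (snd y)))"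
proof -
  fix x x' y y' assume "p1_rel x x'" "p1_rel y y'"
  then obtain c d where c: "c \<noteq> 0" "fst x' = c * fst x" "snd x' = c * snd x"
    and d: "d \<noteq> 0" "fst y' = d * fst y" "snd y' = d * snd y"
    by (auto simp: p1_rel_def)
  have mx: "max (cmod (e * a)) (cmod (e * b)) = cmod e * max (cmod a) (cmod b)" for e a b
    by (simp add: norm_mult max_mult_distrib_left)
  have "fst x' * snd y' - fst y' * snd x' = c * d * (fst x * snd y - fst y * snd x)"
    using c d by (simp add: algebra_simps)
  then have num: "cmod (fst x' * snd y' - fst y' * snd x') =
      (cmod c * cmod d) * cmod (fst x * snd y - fst y * snd x)"
    by (simp add: norm_mult)
  have den: "max (cmod (fst x')) (cmod (snd x')) * max (cmod (fst y')) (cmod (snd y')) =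
      (cmod c * cmod d) * (max (cmod (fst x)) (cmod (snd x)) * max (cmod (fst y)) (cmod (snd y)))"
    unfolding c(2,3) d(2,3) mx by (simp only: ac_simps)
  have "cmod c * cmod d \<noteq> 0" using c d by simp
  then show "cmod (fst x * snd y - fst y * snd x) /
      (max (cmod (fst x)) (cmod (snd x)) * max (cmod (fst y)) (cmod (snd y))) =
      cmod (fst x' * snd y' - fst y' * snd x') /
      (max (cmod (fst x')) (cmod (snd x')) * max (cmod (fst y')) (cmod (snd y')))"
    unfolding num den by (rule mult_divide_mult_cancel_left[symmetric])
qed

text \<open>The kernel is \<open>\<infinity>\<close> on the diagonal (whereas \<open>ln 0 = 0\<close> in the library).\<close>

definition neg_log_delta :: "cp1 \<Rightarrow> cp1 \<Rightarrow> ereal" where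
  "neg_log_delta x y = (if delta x y = 0 then \<infinity> else ereal (- ln (delta x y)))"

text \<open>
  \<^const>\<open>e2ennreal\<close> truncates negative values to \<open>0\<close>, so the energy is the integral of the positive
  part of the kernel minus the integral of its negative part. Since \<open>\<delta> \<le> 2\<close>, the latter is finite
  for probability measures.
\<close>

definition energy :: "cp1 measure \<Rightarrow> ereal" where
  "energy \<nu> =
     enn2ereal (\<integral>\<^sup>+ y. (\<integral>\<^sup>+ x. e2ennreal (neg_log_delta x y) \<partial>\<nu>) \<partial>\<nu>) -
     enn2ereal (\<integral>\<^sup>+ y. (\<integral>\<^sup>+ x. e2ennreal (- neg_log_delta x y) \<partial>\<nu>) \<partial>\<nu>)"

definition borel_prob_on :: "cp1 set \<Rightarrow> cp1 measure set" where
  "borel_prob_on E = {\<nu>. prob_space \<nu> \<and> sets \<nu> = sets borel \<and> (AE x in \<nu>. x \<in> E)}"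

definition robin_constant :: "cp1 set \<Rightarrow> ereal" where
  "robin_constant E = (INF \<nu>\<in>borel_prob_on E. energy \<nu>)"

definition strip :: "real \<Rightarrow> cp1 set" where
  "strip \<epsilon> = cp1_of_complex ` {z. \<bar>Im z\<bar> \<le> \<epsilon>} \<union> {cp1_infinity}"

definition mu_R :: "real measure" where
  "mu_R = density lborel (\<lambda>z. ennreal (1 / (pi\<^sup>2 * z) * ln \<bar>(z + 1) / (z - 1)\<bar>))"

definition L1_norm :: "'a measure \<Rightarrow> ('a \<Rightarrow> real) \<Rightarrow> real" where
  "L1_norm M f = (\<integral>z. \<bar>f z\<bar> \<partial>M)"

definition L2_norm :: "'a measure \<Rightarrow> ('a \<Rightarrow> real) \<Rightarrow> real" where
  "L2_norm M f = sqrt (\<integral>z. \<bar>f z\<bar>\<^sup>2 \<partial>M)"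

definition c1 :: real where
  "c1 = 1 / 2 * L1_norm mu_R (\<lambda>z. ln (1 + 1 / (1 - z)\<^sup>2))"

definition c2 :: real where
  "c2 = L2_norm mu_R (\<lambda>z. ln (1 + 1 / (1 - z)\<^sup>2))"

definition zeta3 :: real where
  "zeta3 = (\<Sum>n. 1 / real (Suc n) ^ 3)"

lemma abs_cp1_eq_iff:
  assumes "x \<noteq> 0" "y \<noteq> 0"
  shows "abs_cp1 x = abs_cp1 y \<longleftrightarrow> p1_rel x y"
proof -
  have "p1_rel x x" "p1_rel y y" using assms by (auto simp: p1_rel_def intro: exI[of _ 1])
  then show ?thesis using Quotient_rel[OF Quotient_cp1] by blast
qed

lemma abs_cp1_in_strip_iff:
  assumes "x \<noteq> 0"
  shows "abs_cp1 x \<in> strip \<epsilon> \<longleftrightarrow> \<bar>Im (fst x * cnj (snd x))\<bar> \<le> \<epsilon> * (cmod (snd x))\<^sup>2"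
proof (cases "snd x = 0")
  case True
  then have "fst x \<noteq> 0" using assms by (auto simp: prod_eq_iff)
  then have "p1_rel x (1, 0)"
    unfolding p1_rel_def using assms True
    by (intro conjI exI[of _ "inverse (fst x)"]) (auto simp: zero_prod_def)
  then have "abs_cp1 x = cp1_infinity"
    using assms by (simp add: cp1_infinity_def abs_cp1_eq_iff zero_prod_def)
  then show ?thesis using True by (simp add: strip_def)
next
  case False
  let ?z = "fst x / snd x"
  have fin: "abs_cp1 x = cp1_of_complex z \<longleftrightarrow> z = ?z" for z
  proof -
    have "abs_cp1 x = cp1_of_complex z \<longleftrightarrow> p1_rel x (z, 1)"
      using assms by (simp add: cp1_of_complex.abs_eq abs_cp1_eq_iff zero_prod_def)
    also have "\<dots> \<longleftrightarrow> (\<exists>c. c \<noteq> 0 \<and> z = c * fst x \<and> 1 = c * snd x)"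
      using assms by (auto simp: p1_rel_def zero_prod_def)
    also have "\<dots> \<longleftrightarrow> z = ?z"
    proof
      assume "\<exists>c. c \<noteq> 0 \<and> z = c * fst x \<and> 1 = c * snd x"
      then obtain c where "z = c * fst x" "1 = c * snd x" by blast
      moreover from this have "c = 1 / snd x" using False by (simp add: field_simps)
      ultimately show "z = ?z" by simp
    next
      assume "z = ?z"
      then show "\<exists>c. c \<noteq> 0 \<and> z = c * fst x \<and> 1 = c * snd x"
        using False by (intro exI[of _ "1 / snd x"]) simp
    qed
    finally show ?thesis .
  qed
  have "abs_cp1 x \<noteq> cp1_infinity"
    using assms False by (auto simp: cp1_infinity_def abs_cp1_eq_iff zero_prod_def p1_rel_def)
  then have "abs_cp1 x \<in> strip \<epsilon> \<longleftrightarrow> \<bar>Im ?z\<bar> \<le> \<epsilon>"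
    using fin by (auto simp: strip_def image_iff)
  also have "?z = fst x * cnj (snd x) / of_real ((cmod (snd x))\<^sup>2)"
    using complex_div_cnj[of "fst x" "snd x"] by simp
  also have "Im \<dots> = Im (fst x * cnj (snd x)) / (cmod (snd x))\<^sup>2"
    by (rule Im_divide_of_real)
  finally show ?thesis
    using False by (simp add: pos_divide_le_eq)
qed

lemma closed_strip: "closed (strip \<epsilon>)"
proof -
  have "{x. x \<noteq> 0 \<and> abs_cp1 x \<in> - strip \<epsilon>} =
      {x. \<epsilon> * (cmod (snd x))\<^sup>2 < \<bar>Im (fst x * cnj (snd x))\<bar>}"
    (is "?A = ?B")
  proof (intro set_eqI)
    fix x :: "complex \<times> complex"
    show "x \<in> ?A \<longleftrightarrow> x \<in> ?B"
      by (cases "x = 0") (auto simp: abs_cp1_in_strip_iff not_le)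
  qed
  moreover have "open ?B"
    by (intro open_Collect_less continuous_intros)
  ultimately show ?thesis
    unfolding closed_def open_cp1_def by simp
qed

end

theory Submission
  imports Defs "HOL-Real_Asymp.Real_Asymp"
begin

text \<open>
  Write \<open>-log \<delta>(x, y) = -log sin \<angle>(x, y) + g(x) + g(y)\<close> with \<open>\<angle>\<close> the Fubini-Study angle and \<open>g\<close>
  bounded. As \<open>-log sin\<^sup>2 = \<Sum>\<^sub>n cos\<^sup>2\<^sup>n / n\<close> and \<open>cos\<^sup>2\<close> is a positive semidefinite kernel, the energy is
  positive semidefinite on differences of probability measures, so that
  \<open>I(\<nu>) \<ge> 2 \<integral> p d\<nu> - I(\<mu>)\<close> for the potential \<open>p\<close> of the push-forward \<open>\<mu>\<close> of \<open>mu_R\<close>.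

  The measure \<open>mu_R\<close> is the balayage of the uniform measure of the unit circle onto the real line, that is,
  a mixture of Cauchy distributions. Integrating logarithms against Cauchy distributions gives
  \<open>p = I(\<mu>) = 7 \<zeta>(3) / (2 \<pi>\<^sup>2)\<close> on the real line and, with Jordan's inequality for the sine,
  \<open>p \<ge> I(\<mu>) - ((1 + \<epsilon>) log (1 + \<epsilon>) - \<epsilon> log \<epsilon>)\<close> on the strip. This is stronger than the claimed
  bound because \<open>c1 \<ge> 0.678\<close> and \<open>c2 \<ge> 2.505\<close>.

  For the values of \<open>c1\<close> and \<open>c2\<close>, the symmetries \<open>z \<mapsto> -z\<close> and \<open>z \<mapsto> 1 / z\<close> of \<open>mu_R\<close> and the
  substitution \<open>z = (1 - v) / (1 + v)\<close>, \<open>v = e\<^sup>-\<^sup>l\<close>, lead to integrals over \<open>l > 0\<close> of polynomials in \<open>l\<close> and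
  in logarithms of quadratic polynomials in \<open>v\<close>. The logarithms are approximated by polynomials in \<open>v\<^sup>2\<close>,
  for which the integrals are rational combinations of \<open>1, \<Sum>\<^sub>j (2 j + 1)\<^sup>-\<^sup>2, \<Sum>\<^sub>j (2 j + 1)\<^sup>-\<^sup>3, \<Sum>\<^sub>j (2 j + 1)\<^sup>-\<^sup>4\<close>.
\<close>

subsection \<open>Logarithmic integrals of Cauchy distributions\<close>

text \<open>The kernel -log delta is infinite on the diagonal and changes sign, so I(nu) may be
  infinite and the energy of nu - mu cannot simply be expanded. Replacing cos^2 by r cos^2 with r <
  1 gives a bounded kernel below -log delta: all mutual energies become real numbers, positive
  semidefiniteness is proved on partial sums with a uniform error, and the limit r -> 1 is taken
  only in the potential of mu.

  The loss on the strip comes from one estimate. The circle point at angle theta has distance |sin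
  theta| from the real line, and moving from s to s + i T lowers the potential by at most the mean
  of ln (1 + T / |sin theta|) over theta. Bounding the sine below by a linear function of the angle
  makes this mean elementary.

  The inequality itself needs \<open>c1\<close> and \<open>c2\<close> only from below; the upper
  bounds fix the stated digits. No numerical bound on pi enters these values: the normalisation 2 /
  pi^2 is the reciprocal of four times the sum of the inverse odd squares, a number that also occurs
  in the numerators.\<close>

lemma has_bochner_integral_FTC_real_line:
  fixes f F :: "real \<Rightarrow> real"
  assumes F: "\<And>x. (F has_real_derivative f x) (at x)"
    and f: "\<And>x. isCont f x" and nonneg: "\<And>x. 0 \<le> f x"
    and lim: "(F \<longlongrightarrow> A) at_bot" "(F \<longlongrightarrow> B) at_top"
  shows "has_bochner_integral lborel f (B - A)"
proof -
  have A: "((F \<circ> real_of_ereal) \<longlongrightarrow> A) (at_right (-\<infinity>))"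
    using lim(1) by (simp add: ereal_tendsto_simps1)
  have B: "((F \<circ> real_of_ereal) \<longlongrightarrow> B) (at_left \<infinity>)"
    using lim(2) by (simp add: ereal_tendsto_simps1)
  have "set_integrable lborel (einterval (-\<infinity>) \<infinity>) f" "(LBINT x=-\<infinity>..\<infinity>. f x) = B - A"
    using interval_integral_FTC_nonneg[of "-\<infinity>" \<infinity> F f A B] F f nonneg A B by auto
  then show ?thesis
    by (simp add: has_bochner_integral_iff interval_lebesgue_integral_def set_integrable_def
        set_lebesgue_integral_def einterval_def)
qed

definition cauchy_density :: "real \<Rightarrow> real \<Rightarrow> real \<Rightarrow> real" where
  "cauchy_density a b x = b / (pi * ((x - a)\<^sup>2 + b\<^sup>2))"

lemma cauchy_density_nonneg: "0 \<le> b \<Longrightarrow> 0 \<le> cauchy_density a b x"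
  by (simp add: cauchy_density_def)

lemma borel_measurable_cauchy_density [measurable]:
  assumes [measurable]: "f \<in> borel_measurable M" "g \<in> borel_measurable M" "h \<in> borel_measurable M"
  shows "(\<lambda>x. cauchy_density (f x) (g x) (h x)) \<in> borel_measurable M"
  unfolding cauchy_density_def by measurable

lemma has_bochner_integral_cauchy_density:
  assumes b: "0 < b"
  shows "has_bochner_integral lborel (cauchy_density a b) 1"
proof -
  have pos: "(x - a)\<^sup>2 + b\<^sup>2 > 0" for x
    using b by (simp add: add_nonneg_pos)
  have "has_bochner_integral lborel (cauchy_density a b) (1/2 - (-1/2))"
  proof (rule has_bochner_integral_FTC_real_line[where F = "\<lambda>x. arctan ((x - a) / b) / pi"])
    show "((\<lambda>x. arctan ((x - a) / b) / pi) has_real_derivative cauchy_density a b x) (at x)" for x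
    proof -
      have "((\<lambda>x. arctan ((x - a) / b)) has_real_derivative b / ((x - a)\<^sup>2 + b\<^sup>2)) (at x)"
        using b pos[of x] by (auto intro!: derivative_eq_intros simp: field_simps power2_eq_square)
      from DERIV_cdivide[OF this, of pi] show ?thesis
        by (simp add: cauchy_density_def mult.commute)
    qed
    show "isCont (cauchy_density a b) x" for x
      unfolding cauchy_density_def using pos[of x] by (intro continuous_intros) (use b in auto)
    show "((\<lambda>x. arctan ((x - a) / b) / pi) \<longlongrightarrow> -1/2) at_bot"
      using b by real_asymp
    show "((\<lambda>x. arctan ((x - a) / b) / pi) \<longlongrightarrow> 1/2) at_top"
      using b by real_asymp
  qed (use b in \<open>simp add: cauchy_density_nonneg\<close>)
  then show ?thesis by simp
qed

text \<open>Poisson kernels form a convolution semigroup in the height; here this is checked by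
  partial fractions. \<open>N\<close> is the resultant of the two quadratics, so the condition
  \<open>ne\<close> excludes common roots. The logarithmic term has opposite coefficients on the two
  quadratics and dies at both ends, so only the arctangents contribute.\<close>

lemma poisson_semigroup_aux:
  fixes s b u :: real
  assumes b: "0 < b" and u: "0 < u" and ne: "s \<noteq> 0 \<or> b \<noteq> u"
  shows "has_bochner_integral lborel (\<lambda>x. b / (x\<^sup>2 + b\<^sup>2) * (u / ((x - s)\<^sup>2 + u\<^sup>2)))
           (pi * (b + u) / (s\<^sup>2 + (b + u)\<^sup>2))"
proof -
  define N where "N = (s\<^sup>2 + (b + u)\<^sup>2) * (s\<^sup>2 + (b - u)\<^sup>2)"
  have N1: "s\<^sup>2 + (b + u)\<^sup>2 > 0" using b u by (simp add: add_nonneg_pos)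
  have N2: "s\<^sup>2 + (b - u)\<^sup>2 > 0"
    using ne by (auto intro: add_nonneg_pos add_pos_nonneg)
  have N: "N > 0" using N1 N2 by (simp add: N_def)
  define \<alpha> \<beta> \<gamma> where "\<alpha> = s * b * u / N" and "\<beta> = u * (s\<^sup>2 + u\<^sup>2 - b\<^sup>2) / N"
    and "\<gamma> = b * (s\<^sup>2 + b\<^sup>2 - u\<^sup>2) / N"
  define F where "F x = \<alpha> * ln ((x\<^sup>2 + b\<^sup>2) / ((x - s)\<^sup>2 + u\<^sup>2)) + \<beta> * arctan (x / b)
      + \<gamma> * arctan ((x - s) / u)" for x
  have p1: "x\<^sup>2 + b\<^sup>2 > 0" for x :: real using b by (simp add: add_nonneg_pos)
  have p2: "(x - s)\<^sup>2 + u\<^sup>2 > 0" for x using u by (simp add: add_nonneg_pos)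
  have der: "(F has_real_derivative b / (x\<^sup>2 + b\<^sup>2) * (u / ((x - s)\<^sup>2 + u\<^sup>2))) (at x)" for x
  proof -
    have d1: "((\<lambda>x. ln ((x\<^sup>2 + b\<^sup>2) / ((x - s)\<^sup>2 + u\<^sup>2))) has_real_derivative
        2 * x / (x\<^sup>2 + b\<^sup>2) - 2 * (x - s) / ((x - s)\<^sup>2 + u\<^sup>2)) (at x)"
    proof -
      have "((\<lambda>x. ln (x\<^sup>2 + b\<^sup>2) - ln ((x - s)\<^sup>2 + u\<^sup>2)) has_real_derivative
        2 * x / (x\<^sup>2 + b\<^sup>2) - 2 * (x - s) / ((x - s)\<^sup>2 + u\<^sup>2)) (at x)"
        using p1[of x] p2[of x] by (auto intro!: derivative_eq_intros)
      moreover have "(\<lambda>x. ln (x\<^sup>2 + b\<^sup>2) - ln ((x - s)\<^sup>2 + u\<^sup>2)) =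
           (\<lambda>x. ln ((x\<^sup>2 + b\<^sup>2) / ((x - s)\<^sup>2 + u\<^sup>2)))"
        using b u by (auto simp: ln_div)
      ultimately show ?thesis by simp
    qed
    have d2: "((\<lambda>x. arctan (x / b)) has_real_derivative b / (x\<^sup>2 + b\<^sup>2)) (at x)"
      using b p1[of x] by (auto intro!: derivative_eq_intros simp: field_simps power2_eq_square)
    have d3: "((\<lambda>x. arctan ((x - s) / u)) has_real_derivative u / ((x - s)\<^sup>2 + u\<^sup>2)) (at x)"
      using u p2[of x] by (auto intro!: derivative_eq_intros simp: field_simps power2_eq_square)
    define P Q where "P = x\<^sup>2 + b\<^sup>2" and "Q = (x - s)\<^sup>2 + u\<^sup>2"
    have PQ: "P > 0" "Q > 0" using p1 p2 by (auto simp: P_def Q_def)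
    have key: "(2 * (s * b * u) * x + u * (s\<^sup>2 + u\<^sup>2 - b\<^sup>2) * b) * Q
         + (b * (s\<^sup>2 + b\<^sup>2 - u\<^sup>2) * u - 2 * (s * b * u) * (x - s)) * P = b * u * N"
      unfolding P_def Q_def N_def by algebra
    have "\<alpha> * (2 * x / P - 2 * (x - s) / Q) + \<beta> * (b / P) + \<gamma> * (u / Q) =
       ((2 * (s * b * u) * x + u * (s\<^sup>2 + u\<^sup>2 - b\<^sup>2) * b) * Q
         + (b * (s\<^sup>2 + b\<^sup>2 - u\<^sup>2) * u - 2 * (s * b * u) * (x - s)) * P) / (N * P * Q)"
      using PQ N unfolding \<alpha>_def \<beta>_def \<gamma>_def by (simp add: field_simps)
    also have "\<dots> = b / P * (u / Q)"
      unfolding key using PQ N by simp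
    finally have eq: "\<alpha> * (2 * x / P - 2 * (x - s) / Q) + \<beta> * (b / P) + \<gamma> * (u / Q) = b / P * (u / Q)" .
    have "(F has_real_derivative \<alpha> * (2 * x / P - 2 * (x - s) / Q) + \<beta> * (b / P) + \<gamma> * (u / Q)) (at x)"
      unfolding F_def P_def Q_def by (intro DERIV_add DERIV_cmult d1 d2 d3)
    then show ?thesis unfolding eq by (simp add: P_def Q_def)
  qed
  have l1: "((\<lambda>x. ln ((x\<^sup>2 + b\<^sup>2) / ((x - s)\<^sup>2 + u\<^sup>2))) \<longlongrightarrow> 0) at_top" 
    by real_asymp
  have l2: "((\<lambda>x. ln ((x\<^sup>2 + b\<^sup>2) / ((x - s)\<^sup>2 + u\<^sup>2))) \<longlongrightarrow> 0) at_bot"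
    by real_asymp
  have a1: "((\<lambda>x. arctan (x / b)) \<longlongrightarrow> pi/2) at_top" "((\<lambda>x. arctan (x / b)) \<longlongrightarrow> -(pi/2)) at_bot"
    "((\<lambda>x. arctan ((x - s) / u)) \<longlongrightarrow> pi/2) at_top" "((\<lambda>x. arctan ((x - s) / u)) \<longlongrightarrow> -(pi/2)) at_bot"
    using b u by real_asymp+
  have L1: "(F \<longlongrightarrow> \<alpha> * 0 + \<beta> * (pi/2) + \<gamma> * (pi/2)) at_top"
    unfolding F_def by (intro tendsto_intros l1 a1)
  have L2: "(F \<longlongrightarrow> \<alpha> * 0 + \<beta> * (-(pi/2)) + \<gamma> * (-(pi/2))) at_bot"
    unfolding F_def by (intro tendsto_intros l2 a1)
  have "has_bochner_integral lborel (\<lambda>x. b / (x\<^sup>2 + b\<^sup>2) * (u / ((x - s)\<^sup>2 + u\<^sup>2)))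
     ((\<alpha> * 0 + \<beta> * (pi/2) + \<gamma> * (pi/2)) - (\<alpha> * 0 + \<beta> * (-(pi/2)) + \<gamma> * (-(pi/2))))"
  proof (rule has_bochner_integral_FTC_real_line[OF der _ _ L2 L1])
    show "isCont (\<lambda>x. b / (x\<^sup>2 + b\<^sup>2) * (u / ((x - s)\<^sup>2 + u\<^sup>2))) x" for x
      using p1[of x] p2[of x] by (intro continuous_intros) auto
    show "0 \<le> b / (x\<^sup>2 + b\<^sup>2) * (u / ((x - s)\<^sup>2 + u\<^sup>2))" for x
      using b u p1[of x] p2[of x] by simp
  qed
  also have "(\<alpha> * 0 + \<beta> * (pi/2) + \<gamma> * (pi/2)) - (\<alpha> * 0 + \<beta> * (-(pi/2)) + \<gamma> * (-(pi/2))) =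
     pi * (\<beta> + \<gamma>)" by (simp add: algebra_simps)
  also have "\<beta> + \<gamma> = (b + u) * (s\<^sup>2 + (b - u)\<^sup>2) / N"
    unfolding \<beta>_def \<gamma>_def add_divide_distrib[symmetric]
    by (rule arg_cong[where f = "\<lambda>t. t / N"]) algebra
  also have "\<dots> = (b + u) / (s\<^sup>2 + (b + u)\<^sup>2)"
    unfolding N_def using N2 ne by auto
  finally show ?thesis by simp
qed

lemma poisson_semigroup:
  fixes s a b u :: real
  assumes "0 < b" "0 < u" "s \<noteq> a \<or> b \<noteq> u"
  shows "has_bochner_integral lborel (\<lambda>x. cauchy_density a b x * (u / ((x - s)\<^sup>2 + u\<^sup>2)))
           ((b + u) / ((s - a)\<^sup>2 + (b + u)\<^sup>2))"
proof -
  have "has_bochner_integral lborel (\<lambda>x. b / (x\<^sup>2 + b\<^sup>2) * (u / ((x - (s - a))\<^sup>2 + u\<^sup>2)))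
           (pi * (b + u) / ((s - a)\<^sup>2 + (b + u)\<^sup>2))"
    using assms by (intro poisson_semigroup_aux) auto
  from has_bochner_integral_mult_right[OF this, of "1 / pi"]
  have "has_bochner_integral lborel (\<lambda>x. 1 / pi * (b / (x\<^sup>2 + b\<^sup>2) * (u / ((x - (s - a))\<^sup>2 + u\<^sup>2))))
           ((b + u) / ((s - a)\<^sup>2 + (b + u)\<^sup>2))" by simp
  then have "has_bochner_integral lborel
     (\<lambda>x. 1 / pi * (b / ((- a + 1 * x)\<^sup>2 + b\<^sup>2) * (u / (((- a + 1 * x) - (s - a))\<^sup>2 + u\<^sup>2))))
           (((b + u) / ((s - a)\<^sup>2 + (b + u)\<^sup>2)) /\<^sub>R \<bar>1\<bar>)"
    by (subst lborel_has_bochner_integral_real_affine_iff[of 1 _ _ "-a", symmetric]) simp_all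
  then show ?thesis
    by (simp add: cauchy_density_def algebra_simps)
qed

text \<open>The logarithm is the integral of 2 / u - 2 u / ((x - s)^2 + u^2) over u >= T. This
  integrand is non-negative, so Tonelli applies without any integrability check, and the inner
  integral over x is given by the semigroup law, except at the single height u = b.\<close>

lemma nn_integral_cauchy_density_ln_plus:
  fixes a b s T :: real
  assumes b: "0 < b" and T: "0 < T"
  shows "(\<integral>\<^sup>+x. ennreal (cauchy_density a b x * ln (1 + (x - s)\<^sup>2 / T\<^sup>2)) \<partial>lborel) =
     ennreal (ln (((s - a)\<^sup>2 + (b + T)\<^sup>2) / T\<^sup>2))"
proof -
  let ?g = "\<lambda>d u::real. 2 / u - 2 * u / (d + u\<^sup>2)"
  have g_nonneg: "0 \<le> ?g d u" if "0 < u" "0 \<le> d" for d u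
    using that by (simp add: field_simps power2_eq_square add_nonneg_pos)
  have inner_u: "(\<integral>\<^sup>+u. ennreal (?g ((x - s)\<^sup>2) u) * indicator {T..} u \<partial>lborel) =
      ennreal (ln (1 + (x - s)\<^sup>2 / T\<^sup>2))" for x
  proof -
    define d where "d = (x - s)\<^sup>2"
    have d: "0 \<le> d" by (simp add: d_def)
    have "(\<integral>\<^sup>+u. ennreal (?g d u) * indicator {T..} u \<partial>lborel) =
        ennreal (0 - (2 * ln T - ln (d + T\<^sup>2)))"
    proof (rule nn_integral_FTC_atLeast[where F = "\<lambda>u. 2 * ln u - ln (d + u\<^sup>2)"])
      show "((\<lambda>u. 2 * ln u - ln (d + u\<^sup>2)) has_real_derivative ?g d u) (at u)" if "T \<le> u" for u
      proof -
        have "0 < u" "0 < d + u\<^sup>2" using that T d by (auto simp: add_nonneg_pos)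
        then show ?thesis by (auto intro!: derivative_eq_intros)
      qed
      show "((\<lambda>u. 2 * ln u - ln (d + u\<^sup>2)) \<longlongrightarrow> 0) at_top"
        by real_asymp
    qed (use g_nonneg T d in auto)
    also have "0 - (2 * ln T - ln (d + T\<^sup>2)) = ln (1 + d / T\<^sup>2)"
    proof -
      have "1 + d / T\<^sup>2 = (d + T\<^sup>2) / T\<^sup>2" using T by (simp add: field_simps)
      moreover have "d + T\<^sup>2 > 0" using T d by (simp add: add_nonneg_pos)
      ultimately show ?thesis using T by (simp add: ln_div ln_realpow)
    qed
    finally show ?thesis by (simp add: d_def)
  qed
  have inner_x: "(\<integral>\<^sup>+x. ennreal (cauchy_density a b x * ?g ((x - s)\<^sup>2) u) \<partial>lborel) =
      ennreal (2 / u - 2 * (b + u) / ((s - a)\<^sup>2 + (b + u)\<^sup>2))" if u: "T \<le> u" "u \<noteq> b" for u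
  proof -
    have "0 < u" using u T by simp
    have "has_bochner_integral lborel (\<lambda>x. cauchy_density a b x * (2 / u)
        - 2 * (cauchy_density a b x * (u / ((x - s)\<^sup>2 + u\<^sup>2))))
        (1 * (2 / u) - 2 * ((b + u) / ((s - a)\<^sup>2 + (b + u)\<^sup>2)))"
      using b \<open>0 < u\<close> u(2)
      by (intro has_bochner_integral_diff has_bochner_integral_mult_left has_bochner_integral_mult_right
          has_bochner_integral_cauchy_density poisson_semigroup) auto
    then have "has_bochner_integral lborel (\<lambda>x. cauchy_density a b x * ?g ((x - s)\<^sup>2) u)
        (2 / u - 2 * (b + u) / ((s - a)\<^sup>2 + (b + u)\<^sup>2))"
      by (simp add: algebra_simps)
    then show ?thesis
      using b \<open>0 < u\<close> g_nonneg
      by (subst nn_integral_eq_integral) (auto simp: has_bochner_integral_iff cauchy_density_nonneg)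
  qed
  have "(\<integral>\<^sup>+x. ennreal (cauchy_density a b x * ln (1 + (x - s)\<^sup>2 / T\<^sup>2)) \<partial>lborel) =
      (\<integral>\<^sup>+x. (\<integral>\<^sup>+u. ennreal (cauchy_density a b x) *
        (ennreal (?g ((x - s)\<^sup>2) u) * indicator {T..} u) \<partial>lborel) \<partial>lborel)"
    using b T
    by (intro nn_integral_cong, subst nn_integral_cmult)
       (simp_all add: inner_u ennreal_mult' cauchy_density_nonneg)
  also have "\<dots> = (\<integral>\<^sup>+u. (\<integral>\<^sup>+x. ennreal (cauchy_density a b x) *
        (ennreal (?g ((x - s)\<^sup>2) u) * indicator {T..} u) \<partial>lborel) \<partial>lborel)"
    by (rule lborel_pair.Fubini') measurable
  also have "\<dots> = (\<integral>\<^sup>+u. ennreal (2 / u - 2 * (b + u) / ((s - a)\<^sup>2 + (b + u)\<^sup>2)) * indicator {T..} u \<partial>lborel)"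
  proof (rule nn_integral_cong_AE)
    have "AE u in lborel. u \<noteq> b" by (rule AE_lborel_singleton)
    then show "AE u in lborel. (\<integral>\<^sup>+x. ennreal (cauchy_density a b x) *
        (ennreal (?g ((x - s)\<^sup>2) u) * indicator {T..} u) \<partial>lborel) =
         ennreal (2 / u - 2 * (b + u) / ((s - a)\<^sup>2 + (b + u)\<^sup>2)) * indicator {T..} u"
    proof (eventually_elim)
      case (elim u)
      show ?case
      proof (cases "T \<le> u")
        case True
        then show ?thesis using inner_x[OF True elim] b
          by (simp add: ennreal_mult' cauchy_density_nonneg)
      qed simp
    qed
  qed
  also have "\<dots> = ennreal (0 - (2 * ln T - ln ((s - a)\<^sup>2 + (b + T)\<^sup>2)))"
  proof (rule nn_integral_FTC_atLeast[where F = "\<lambda>u. 2 * ln u - ln ((s - a)\<^sup>2 + (b + u)\<^sup>2)"])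
    show "((\<lambda>u. 2 * ln u - ln ((s - a)\<^sup>2 + (b + u)\<^sup>2)) has_real_derivative
        2 / u - 2 * (b + u) / ((s - a)\<^sup>2 + (b + u)\<^sup>2)) (at u)" if "T \<le> u" for u
    proof -
      have "0 < u" "0 < (s - a)\<^sup>2 + (b + u)\<^sup>2" using that T b by (auto simp: add_nonneg_pos)
      then show ?thesis by (auto intro!: derivative_eq_intros)
    qed
    show "0 \<le> 2 / u - 2 * (b + u) / ((s - a)\<^sup>2 + (b + u)\<^sup>2)" if "T \<le> u" for u
    proof -
      have p: "0 < u" "0 < (s - a)\<^sup>2 + (b + u)\<^sup>2" using that T b by (auto simp: add_nonneg_pos)
      have "(b + u) * u \<le> (s - a)\<^sup>2 + (b + u)\<^sup>2"
        using p b by (intro add_increasing) (simp_all add: power2_eq_square mult_left_mono)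
      then have "(b + u) / ((s - a)\<^sup>2 + (b + u)\<^sup>2) \<le> 1 / u"
        by (subst frac_le_eq) (use p in \<open>auto simp: divide_le_0_iff\<close>)
      then have "2 * ((b + u) / ((s - a)\<^sup>2 + (b + u)\<^sup>2)) \<le> 2 * (1 / u)"
        by (rule mult_left_mono) simp
      then show ?thesis by simp
    qed
    show "((\<lambda>u. 2 * ln u - ln ((s - a)\<^sup>2 + (b + u)\<^sup>2)) \<longlongrightarrow> 0) at_top"
      by real_asymp
  qed simp
  also have "0 - (2 * ln T - ln ((s - a)\<^sup>2 + (b + T)\<^sup>2)) = ln (((s - a)\<^sup>2 + (b + T)\<^sup>2) / T\<^sup>2)"
  proof -
    have "(s - a)\<^sup>2 + (b + T)\<^sup>2 > 0" using T b by (simp add: add_nonneg_pos)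
    then show ?thesis using T b by (auto simp: ln_div ln_realpow)
  qed
  finally show ?thesis .
qed

text \<open>Same method with ln (1 + T^2 / d) as the integral of 2 u / (d + u^2) over 0 <= u <= T.
  The singularity at x = s is a null set.\<close>

lemma nn_integral_cauchy_density_ln_recip:
  fixes a b s T :: real
  assumes b: "0 < b" and T: "0 \<le> T"
  shows "(\<integral>\<^sup>+x. ennreal (cauchy_density a b x * ln (1 + T\<^sup>2 / (x - s)\<^sup>2)) \<partial>lborel) =
     ennreal (ln (((s - a)\<^sup>2 + (b + T)\<^sup>2) / ((s - a)\<^sup>2 + b\<^sup>2)))"
proof -
  let ?g = "\<lambda>d u::real. 2 * u / (d + u\<^sup>2)"
  have inner_u: "(\<integral>\<^sup>+u. ennreal (?g ((x - s)\<^sup>2) u) * indicator {0..T} u \<partial>lborel) =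
      ennreal (ln (1 + T\<^sup>2 / (x - s)\<^sup>2))" if x: "x \<noteq> s" for x
  proof -
    define d where "d = (x - s)\<^sup>2"
    have d: "0 < d" using x by (simp add: d_def)
    have "(\<integral>\<^sup>+u. ennreal (?g d u) * indicator {0..T} u \<partial>lborel) =
        ennreal (ln (d + T\<^sup>2) - ln (d + 0\<^sup>2))"
    proof (rule nn_integral_FTC_Icc[where F = "\<lambda>u. ln (d + u\<^sup>2)"])
      show "((\<lambda>u. ln (d + u\<^sup>2)) has_real_derivative ?g d u) (at u)" if "u \<in> {0..T}" for u
      proof -
        have "0 < d + u\<^sup>2" using d by (auto simp: add_pos_nonneg)
        then show ?thesis by (auto intro!: derivative_eq_intros)
      qed
    qed (use d T in auto)
    also have "ln (d + T\<^sup>2) - ln (d + 0\<^sup>2) = ln (1 + T\<^sup>2 / d)"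
    proof -
      have "1 + T\<^sup>2 / d = (d + T\<^sup>2) / d" using d by (simp add: field_simps)
      moreover have "d + T\<^sup>2 > 0" using d by (simp add: add_pos_nonneg)
      ultimately show ?thesis using d by (simp add: ln_div)
    qed
    finally show ?thesis by (simp add: d_def)
  qed
  have inner_x: "(\<integral>\<^sup>+x. ennreal (cauchy_density a b x * ?g ((x - s)\<^sup>2) u) \<partial>lborel) =
      ennreal (2 * (b + u) / ((s - a)\<^sup>2 + (b + u)\<^sup>2))" if u: "0 < u" "u \<noteq> b" for u
  proof -
    have "has_bochner_integral lborel (\<lambda>x. 2 * (cauchy_density a b x * (u / ((x - s)\<^sup>2 + u\<^sup>2))))
        (2 * ((b + u) / ((s - a)\<^sup>2 + (b + u)\<^sup>2)))"
      using b u by (intro has_bochner_integral_mult_right poisson_semigroup) auto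
    then have "has_bochner_integral lborel (\<lambda>x. cauchy_density a b x * ?g ((x - s)\<^sup>2) u)
        (2 * (b + u) / ((s - a)\<^sup>2 + (b + u)\<^sup>2))"
      by (simp add: algebra_simps)
    then show ?thesis
      using b u
      by (subst nn_integral_eq_integral) (auto simp: has_bochner_integral_iff cauchy_density_nonneg)
  qed
  have "(\<integral>\<^sup>+x. ennreal (cauchy_density a b x * ln (1 + T\<^sup>2 / (x - s)\<^sup>2)) \<partial>lborel) =
      (\<integral>\<^sup>+x. (\<integral>\<^sup>+u. ennreal (cauchy_density a b x) *
        (ennreal (?g ((x - s)\<^sup>2) u) * indicator {0..T} u) \<partial>lborel) \<partial>lborel)"
  proof (rule nn_integral_cong_AE)
    have "AE x in lborel. x \<noteq> s" by (rule AE_lborel_singleton)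
    then show "AE x in lborel. ennreal (cauchy_density a b x * ln (1 + T\<^sup>2 / (x - s)\<^sup>2)) =
       (\<integral>\<^sup>+u. ennreal (cauchy_density a b x) *
        (ennreal (?g ((x - s)\<^sup>2) u) * indicator {0..T} u) \<partial>lborel)"
    proof eventually_elim
      case (elim x)
      show ?case using b T
        by (subst nn_integral_cmult) (simp_all add: inner_u[OF elim] ennreal_mult' cauchy_density_nonneg)
    qed
  qed
  also have "\<dots> = (\<integral>\<^sup>+u. (\<integral>\<^sup>+x. ennreal (cauchy_density a b x) *
        (ennreal (?g ((x - s)\<^sup>2) u) * indicator {0..T} u) \<partial>lborel) \<partial>lborel)"
    by (rule lborel_pair.Fubini') measurable
  also have "\<dots> = (\<integral>\<^sup>+u. ennreal (2 * (b + u) / ((s - a)\<^sup>2 + (b + u)\<^sup>2)) * indicator {0..T} u \<partial>lborel)"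
  proof (rule nn_integral_cong_AE)
    have "AE u in lborel. u \<noteq> b" "AE u in lborel. u \<noteq> 0" by (rule AE_lborel_singleton)+
    then show "AE u in lborel. (\<integral>\<^sup>+x. ennreal (cauchy_density a b x) *
        (ennreal (?g ((x - s)\<^sup>2) u) * indicator {0..T} u) \<partial>lborel) =
         ennreal (2 * (b + u) / ((s - a)\<^sup>2 + (b + u)\<^sup>2)) * indicator {0..T} u"
    proof (eventually_elim)
      case (elim u)
      show ?case
      proof (cases "u \<in> {0..T}")
        case True
        then show ?thesis using inner_x[of u] elim b
          by (simp flip: ennreal_mult' add: cauchy_density_nonneg)
      qed simp
    qed
  qed
  also have "\<dots> = ennreal (ln ((s - a)\<^sup>2 + (b + T)\<^sup>2) - ln ((s - a)\<^sup>2 + (b + 0)\<^sup>2))"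
  proof (rule nn_integral_FTC_Icc[where F = "\<lambda>u. ln ((s - a)\<^sup>2 + (b + u)\<^sup>2)"])
    show "((\<lambda>u. ln ((s - a)\<^sup>2 + (b + u)\<^sup>2)) has_real_derivative
        2 * (b + u) / ((s - a)\<^sup>2 + (b + u)\<^sup>2)) (at u)" if "u \<in> {0..T}" for u
    proof -
      have "0 < (s - a)\<^sup>2 + (b + u)\<^sup>2" using that b by (auto simp: add_nonneg_pos)
      then show ?thesis by (auto intro!: derivative_eq_intros)
    qed
  qed (use b T in auto)
  also have "ln ((s - a)\<^sup>2 + (b + T)\<^sup>2) - ln ((s - a)\<^sup>2 + (b + 0)\<^sup>2) =
     ln (((s - a)\<^sup>2 + (b + T)\<^sup>2) / ((s - a)\<^sup>2 + b\<^sup>2))"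
  proof -
    have "(s - a)\<^sup>2 + (b + T)\<^sup>2 > 0" "(s - a)\<^sup>2 + b\<^sup>2 > 0" using T b by (simp_all add: add_nonneg_pos)
    then show ?thesis using T b by (auto simp: ln_div)
  qed
  finally show ?thesis .
qed

text \<open>Poisson's formula: ln |z - (s - i t)|^2 is harmonic in the upper half plane, and its
  value at a + i b is the mean of its boundary values against the Cauchy distribution of centre a
  and scale b.\<close>

lemma has_bochner_integral_cauchy_density_ln:
  fixes a b s t :: real
  assumes b: "0 < b" and t: "0 \<le> t"
  shows "has_bochner_integral lborel (\<lambda>x. cauchy_density a b x * ln ((x - s)\<^sup>2 + t\<^sup>2))
           (ln ((s - a)\<^sup>2 + (b + t)\<^sup>2))"
proof -
  have c0: "0 \<le> cauchy_density a b x" for x using b by (simp add: cauchy_density_nonneg)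
  have pos: "(s - a)\<^sup>2 + (b + u)\<^sup>2 > 0" if "u \<ge> 0" for u using that b by (simp add: add_nonneg_pos)
  have plus: "has_bochner_integral lborel (\<lambda>x. cauchy_density a b x * ln (1 + (x - s)\<^sup>2 / u\<^sup>2))
      (ln (((s - a)\<^sup>2 + (b + u)\<^sup>2) / u\<^sup>2))" if u: "0 < u" for u
  proof (rule has_bochner_integral_nn_integral)
    have "(b + u)\<^sup>2 \<ge> u\<^sup>2" using b u by (intro power_mono) auto
    then have "((s - a)\<^sup>2 + (b + u)\<^sup>2) / u\<^sup>2 \<ge> 1" using u by (simp add: add_increasing)
    then show "0 \<le> ln (((s - a)\<^sup>2 + (b + u)\<^sup>2) / u\<^sup>2)" by (rule ln_ge_zero)
    show "AE x in lborel. 0 \<le> cauchy_density a b x * ln (1 + (x - s)\<^sup>2 / u\<^sup>2)"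
      using c0 by (intro always_eventually allI mult_nonneg_nonneg ln_ge_zero) auto
    show "(\<integral>\<^sup>+x. ennreal (cauchy_density a b x * ln (1 + (x - s)\<^sup>2 / u\<^sup>2)) \<partial>lborel) =
       ennreal (ln (((s - a)\<^sup>2 + (b + u)\<^sup>2) / u\<^sup>2))"
      using b u by (rule nn_integral_cauchy_density_ln_plus)
  qed measurable
  show ?thesis
  proof (cases "t = 0")
    case False
    with t have t: "0 < t" by simp
    have "has_bochner_integral lborel (\<lambda>x. cauchy_density a b x * ln (1 + (x - s)\<^sup>2 / t\<^sup>2)
        + cauchy_density a b x * ln (t\<^sup>2)) (ln (((s - a)\<^sup>2 + (b + t)\<^sup>2) / t\<^sup>2) + 1 * ln (t\<^sup>2))"
      using b t by (intro has_bochner_integral_add plus has_bochner_integral_mult_left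
          has_bochner_integral_cauchy_density) auto
    also have "ln (((s - a)\<^sup>2 + (b + t)\<^sup>2) / t\<^sup>2) + 1 * ln (t\<^sup>2) = ln ((s - a)\<^sup>2 + (b + t)\<^sup>2)"
      using t ln_divide_pos[OF pos[of t], of "t\<^sup>2"] by simp
    also have "(\<lambda>x. cauchy_density a b x * ln (1 + (x - s)\<^sup>2 / t\<^sup>2)
        + cauchy_density a b x * ln (t\<^sup>2)) = (\<lambda>x. cauchy_density a b x * ln ((x - s)\<^sup>2 + t\<^sup>2))"
    proof
      fix x
      have "1 + (x - s)\<^sup>2 / t\<^sup>2 > 0" by (simp add: add_pos_nonneg)
      then have "ln (1 + (x - s)\<^sup>2 / t\<^sup>2) + ln (t\<^sup>2) = ln ((1 + (x - s)\<^sup>2 / t\<^sup>2) * t\<^sup>2)"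
        using t by (subst ln_mult) auto
      also have "(1 + (x - s)\<^sup>2 / t\<^sup>2) * t\<^sup>2 = (x - s)\<^sup>2 + t\<^sup>2" using t by (simp add: field_simps)
      finally show "cauchy_density a b x * ln (1 + (x - s)\<^sup>2 / t\<^sup>2)
        + cauchy_density a b x * ln (t\<^sup>2) = cauchy_density a b x * ln ((x - s)\<^sup>2 + t\<^sup>2)"
        by (simp flip: distrib_left)
    qed
    finally show ?thesis .
  next
    case True
    \<comment> \<open>For t = 0 the logarithm is unbounded in both directions, so it is written as
      ln (1 + (x - s)^2) - ln (1 + 1 / (x - s)^2), a difference of two non-negative integrable
      functions.\<close>
    have recip: "has_bochner_integral lborel (\<lambda>x. cauchy_density a b x * ln (1 + 1\<^sup>2 / (x - s)\<^sup>2))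
      (ln (((s - a)\<^sup>2 + (b + 1)\<^sup>2) / ((s - a)\<^sup>2 + b\<^sup>2)))"
    proof (rule has_bochner_integral_nn_integral)
      have "(b + 1)\<^sup>2 \<ge> b\<^sup>2" using b by (intro power_mono) auto
      then have "((s - a)\<^sup>2 + (b + 1)\<^sup>2) / ((s - a)\<^sup>2 + b\<^sup>2) \<ge> 1" using pos[of 0] by simp
      then show "0 \<le> ln (((s - a)\<^sup>2 + (b + 1)\<^sup>2) / ((s - a)\<^sup>2 + b\<^sup>2))" by (rule ln_ge_zero)
      show "AE x in lborel. 0 \<le> cauchy_density a b x * ln (1 + 1\<^sup>2 / (x - s)\<^sup>2)"
        using c0 by (intro always_eventually allI mult_nonneg_nonneg ln_ge_zero) auto
      show "(\<integral>\<^sup>+x. ennreal (cauchy_density a b x * ln (1 + 1\<^sup>2 / (x - s)\<^sup>2)) \<partial>lborel) =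
         ennreal (ln (((s - a)\<^sup>2 + (b + 1)\<^sup>2) / ((s - a)\<^sup>2 + b\<^sup>2)))"
        using b by (intro nn_integral_cauchy_density_ln_recip) auto
    qed measurable
    have "has_bochner_integral lborel (\<lambda>x. cauchy_density a b x * ln (1 + (x - s)\<^sup>2 / 1\<^sup>2)
        - cauchy_density a b x * ln (1 + 1\<^sup>2 / (x - s)\<^sup>2)) (ln (((s - a)\<^sup>2 + (b + 1)\<^sup>2) / 1\<^sup>2)
        - ln (((s - a)\<^sup>2 + (b + 1)\<^sup>2) / ((s - a)\<^sup>2 + b\<^sup>2)))"
      by (intro has_bochner_integral_diff plus recip) simp
    also have "(ln (((s - a)\<^sup>2 + (b + 1)\<^sup>2) / 1\<^sup>2)
        - ln (((s - a)\<^sup>2 + (b + 1)\<^sup>2) / ((s - a)\<^sup>2 + b\<^sup>2))) = ln ((s - a)\<^sup>2 + (b + t)\<^sup>2)"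
      using pos[of 0] pos[of 1] True b by (auto simp: ln_div)
    finally have *: "has_bochner_integral lborel (\<lambda>x. cauchy_density a b x * ln (1 + (x - s)\<^sup>2 / 1\<^sup>2)
        - cauchy_density a b x * ln (1 + 1\<^sup>2 / (x - s)\<^sup>2)) (ln ((s - a)\<^sup>2 + (b + t)\<^sup>2))" .
    have "AE x in lborel. x \<noteq> s" by (rule AE_lborel_singleton)
    then have AE: "AE x in lborel. cauchy_density a b x * ln (1 + (x - s)\<^sup>2 / 1\<^sup>2)
        - cauchy_density a b x * ln (1 + 1\<^sup>2 / (x - s)\<^sup>2) = cauchy_density a b x * ln ((x - s)\<^sup>2 + t\<^sup>2)"
    proof eventually_elim
      case (elim x)
      then have d: "(x - s)\<^sup>2 > 0" by simp
      have "1 + 1\<^sup>2 / (x - s)\<^sup>2 = (1 + (x - s)\<^sup>2) / (x - s)\<^sup>2" using d by (simp add: field_simps)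
      also have "ln \<dots> = ln (1 + (x - s)\<^sup>2) - ln ((x - s)\<^sup>2)"
        by (rule ln_divide_pos) (use d in \<open>auto intro: add_pos_pos\<close>)
      finally show ?case using True by (simp add: right_diff_distrib)
    qed
    show ?thesis
      using * AE by (subst (asm) has_bochner_integral_cong_AE) auto
  qed
qed

subsection \<open>Potential and mean of the measure on the real line\<close>

text \<open>Cosine and absolute sine of the angle theta = 2 arctan y. The absolute value reflects
  the lower half circle, so that a single family of Cauchy distributions serves both halves.\<close>

abbreviation (input) circ_re :: "real \<Rightarrow> real" where "circ_re y \<equiv> (1 - y\<^sup>2) / (1 + y\<^sup>2)"
abbreviation (input) circ_im :: "real \<Rightarrow> real" where "circ_im y \<equiv> 2 * \<bar>y\<bar> / (1 + y\<^sup>2)"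

definition mu_R_density :: "real \<Rightarrow> real" where
  "mu_R_density z = 1 / (pi\<^sup>2 * z) * ln \<bar>(z + 1) / (z - 1)\<bar>"

lemma mu_R_density_measurable [measurable]: "mu_R_density \<in> borel_measurable borel"
  unfolding mu_R_density_def by measurable

lemma mu_R_eq: "mu_R = density lborel (\<lambda>z. ennreal (mu_R_density z))"
  by (simp add: mu_R_def mu_R_density_def)

lemma space_mu_R [simp]: "space mu_R = UNIV" and sets_mu_R [simp, measurable_cong]: "sets mu_R = sets borel"
  by (simp_all add: mu_R_eq)

lemma nn_integral_even:
  fixes f :: "real \<Rightarrow> ennreal"
  assumes [measurable]: "f \<in> borel_measurable borel" and even: "\<And>x. f (- x) = f x"
  shows "(\<integral>\<^sup>+x. f x \<partial>lborel) = 2 * (\<integral>\<^sup>+x. f x * indicator {0..} x \<partial>lborel)"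
proof -
  have "(\<integral>\<^sup>+x. f x \<partial>lborel) = (\<integral>\<^sup>+x. f x * indicator {0..} x + f x * indicator {..<0} x \<partial>lborel)"
    by (intro nn_integral_cong) (auto split: split_indicator)
  also have "\<dots> = (\<integral>\<^sup>+x. f x * indicator {0..} x \<partial>lborel) + (\<integral>\<^sup>+x. f x * indicator {..<0} x \<partial>lborel)"
    by (rule nn_integral_add) auto
  also have "(\<integral>\<^sup>+x. f x * indicator {..<0} x \<partial>lborel) = (\<integral>\<^sup>+x. f (0 + -1 * x) * indicator {..<0} (0 + -1 * x) \<partial>lborel)"
    by (subst nn_integral_real_affine[where c = "-1" and t = 0]) auto
  also have "\<dots> = (\<integral>\<^sup>+x. f x * indicator {0..} x \<partial>lborel)"
  proof (rule nn_integral_cong_AE)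
    have "AE x::real in lborel. x \<noteq> 0" by (rule AE_lborel_singleton)
    then show "AE x in lborel. f (0 + -1 * x) * indicator {..<0} (0 + -1 * x) = f x * indicator {0..} x"
      by eventually_elim (auto simp: even split: split_indicator)
  qed
  finally show ?thesis by (simp add: mult_2)
qed

text \<open>The squared distance |x - e^(i theta)|^2 equals (1 - x)^2 cos^2 (theta / 2) + (1 + x)^2
  sin^2 (theta / 2).\<close>

lemma circ_dist:
  "(x - circ_re y)\<^sup>2 + (circ_im y)\<^sup>2 = ((1 - x)\<^sup>2 + y\<^sup>2 * (1 + x)\<^sup>2) / (1 + y\<^sup>2)"
proof -
  have p: "1 + y\<^sup>2 > 0" by (simp add: add_pos_nonneg)
  have "(x - circ_re y)\<^sup>2 + (circ_im y)\<^sup>2 = ((x * (1 + y\<^sup>2) - (1 - y\<^sup>2))\<^sup>2 + (2 * \<bar>y\<bar>)\<^sup>2) / (1 + y\<^sup>2)\<^sup>2"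
  proof -
    have "x - circ_re y = (x * (1 + y\<^sup>2) - (1 - y\<^sup>2)) / (1 + y\<^sup>2)"
      using p by (simp add: diff_divide_distrib)
    then show ?thesis by (simp only: power_divide add_divide_distrib)
  qed
  also have "(x * (1 + y\<^sup>2) - (1 - y\<^sup>2))\<^sup>2 + (2 * \<bar>y\<bar>)\<^sup>2 = ((1 - x)\<^sup>2 + y\<^sup>2 * (1 + x)\<^sup>2) * (1 + y\<^sup>2)"
    unfolding power_mult_distrib power2_abs by algebra
  finally show ?thesis using p by (simp add: power2_eq_square)
qed

text \<open>The harmonic measure of the upper half plane at \<open>e\<^bsup>i\<theta>\<^esup>\<close> is the Cauchy distribution, so this
  says that the measure is the sweep of the uniform distribution of the unit circle onto the real line;
  here \<open>y = tan (\<theta> / 2)\<close>.\<close>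

lemma mu_R_density_mixture:
  assumes x: "x \<noteq> 0" "x \<noteq> 1" "x \<noteq> -1"
  shows "(\<integral>\<^sup>+y. ennreal (cauchy_density 0 1 y * cauchy_density (circ_re y) (circ_im y) x) \<partial>lborel) =
     ennreal (mu_R_density x)"
proof -
  define p r where "p = (1 - x)\<^sup>2" and "r = (1 + x)\<^sup>2"
  have pr: "p > 0" "r > 0" using x by (auto simp: p_def r_def)
  have pr4: "r - p = 4 * x" by (simp add: p_def r_def power2_eq_square algebra_simps)
  let ?h = "\<lambda>y. 2 * \<bar>y\<bar> / (pi\<^sup>2 * ((1 + y\<^sup>2) * (p + y\<^sup>2 * r)))"
  have eq: "cauchy_density 0 1 y * cauchy_density (circ_re y) (circ_im y) x = ?h y" for y
  proof -
    define w where "w = 1 + y\<^sup>2"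
    have w: "w > 0" by (simp add: w_def add_pos_nonneg)
    have w1: "(y - 0)\<^sup>2 + 1\<^sup>2 = w" by (simp add: w_def)
    show ?thesis
      unfolding cauchy_density_def circ_dist
      unfolding w1 p_def[symmetric] r_def[symmetric] w_def[symmetric]
      using w by (simp add: power2_eq_square)
  qed
  define F where "F y = (ln (p + y\<^sup>2 * r) - ln (1 + y\<^sup>2)) / (pi\<^sup>2 * (r - p))" for y
  have "(\<integral>\<^sup>+y. ennreal (?h y) \<partial>lborel) = 2 * (\<integral>\<^sup>+y. ennreal (?h y) * indicator {0..} y \<partial>lborel)"
    by (rule nn_integral_even) auto
  also have "(\<integral>\<^sup>+y. ennreal (?h y) * indicator {0..} y \<partial>lborel) = ennreal (ln r / (pi\<^sup>2 * (r - p)) - F 0)"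
  proof (rule nn_integral_FTC_atLeast)
    show "(F has_real_derivative ?h y) (at y)" if y: "0 \<le> y" for y
    proof -
      have q: "1 + y\<^sup>2 > 0" "p + y\<^sup>2 * r > 0" using pr by (simp_all add: add_pos_nonneg)
      have "((\<lambda>y. ln (p + y\<^sup>2 * r) - ln (1 + y\<^sup>2)) has_real_derivative
          2 * y * r / (p + y\<^sup>2 * r) - 2 * y / (1 + y\<^sup>2)) (at y)"
        using q by (auto intro!: derivative_eq_intros simp: mult_ac)
      from DERIV_cdivide[OF this, of "pi\<^sup>2 * (r - p)"]
      have "(F has_real_derivative (2 * y * r / (p + y\<^sup>2 * r) - 2 * y / (1 + y\<^sup>2)) / (pi\<^sup>2 * (r - p))) (at y)"
        by (simp add: F_def[abs_def])
      also have "2 * y * r / (p + y\<^sup>2 * r) - 2 * y / (1 + y\<^sup>2) = 2 * y * (r - p) / ((1 + y\<^sup>2) * (p + y\<^sup>2 * r))"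
        using q by (simp add: diff_frac_eq) (simp add: algebra_simps)
      also have "\<dots> / (pi\<^sup>2 * (r - p)) = ?h y"
        using y x pr4 by (simp add: mult_ac)
      finally show ?thesis .
    qed
    show "(F \<longlongrightarrow> ln r / (pi\<^sup>2 * (r - p))) at_top"
    proof -
      have "((\<lambda>y. ln (p + y\<^sup>2 * r) - ln (1 + y\<^sup>2)) \<longlongrightarrow> ln r) at_top"
        using pr by real_asymp
      then show ?thesis unfolding F_def by (intro tendsto_divide tendsto_const) (use pr4 x in auto)
    qed
    show "0 \<le> ?h y" for y using pr by (simp add: add_nonneg_nonneg)
  qed auto
  also have "ln r / (pi\<^sup>2 * (r - p)) - F 0 = (ln r - ln p) / (4 * pi\<^sup>2 * x)"
    unfolding F_def pr4 by (simp add: diff_divide_distrib mult_ac)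
  also have "ln r - ln p = 2 * ln \<bar>(x + 1) / (x - 1)\<bar>"
  proof -
    have "ln r = 2 * ln \<bar>1 + x\<bar>" "ln p = 2 * ln \<bar>1 - x\<bar>"
      using ln_realpow[of "\<bar>1 + x\<bar>" 2] ln_realpow[of "\<bar>1 - x\<bar>" 2] x by (simp_all add: r_def p_def)
    moreover have "ln \<bar>(x + 1) / (x - 1)\<bar> = ln \<bar>1 + x\<bar> - ln \<bar>1 - x\<bar>"
      using x by (simp add: abs_divide ln_div abs_minus_commute add.commute)
    ultimately show ?thesis by simp
  qed
  also have "2 * ennreal (2 * ln \<bar>(x + 1) / (x - 1)\<bar> / (4 * pi\<^sup>2 * x)) = ennreal (mu_R_density x)"
  proof -
    have "2 * ennreal (2 * ln \<bar>(x + 1) / (x - 1)\<bar> / (4 * pi\<^sup>2 * x)) =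
        ennreal (2 * (2 * ln \<bar>(x + 1) / (x - 1)\<bar> / (4 * pi\<^sup>2 * x)))"
      by (subst ennreal_mult') simp_all
    also have "2 * (2 * ln \<bar>(x + 1) / (x - 1)\<bar> / (4 * pi\<^sup>2 * x)) = mu_R_density x"
      by (simp add: mu_R_density_def)
    finally show ?thesis .
  qed
  finally show ?thesis by (simp add: eq)
qed

lemma nn_integral_mu_R:
  assumes [measurable]: "g \<in> borel_measurable borel"
  shows "(\<integral>\<^sup>+x. g x \<partial>mu_R) = (\<integral>\<^sup>+y. ennreal (cauchy_density 0 1 y) *
     (\<integral>\<^sup>+x. ennreal (cauchy_density (circ_re y) (circ_im y) x) * g x \<partial>lborel) \<partial>lborel)"
proof -
  have "(\<integral>\<^sup>+x. g x \<partial>mu_R) = (\<integral>\<^sup>+x. ennreal (mu_R_density x) * g x \<partial>lborel)"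
    unfolding mu_R_eq by (rule nn_integral_density) auto
  also have "\<dots> = (\<integral>\<^sup>+x. (\<integral>\<^sup>+y. ennreal (cauchy_density 0 1 y) *
     (ennreal (cauchy_density (circ_re y) (circ_im y) x) * g x) \<partial>lborel) \<partial>lborel)"
  proof (rule nn_integral_cong_AE)
    have "AE x::real in lborel. x \<noteq> 0" "AE x::real in lborel. x \<noteq> 1" "AE x::real in lborel. x \<noteq> -1"
      by (rule AE_lborel_singleton)+
    then show "AE x in lborel. ennreal (mu_R_density x) * g x = (\<integral>\<^sup>+y. ennreal (cauchy_density 0 1 y) *
     (ennreal (cauchy_density (circ_re y) (circ_im y) x) * g x) \<partial>lborel)"
    proof eventually_elim
      case (elim x)
      show ?case
        unfolding mu_R_density_mixture[OF elim, symmetric]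
        by (subst nn_integral_multc[symmetric]) (simp_all add: ennreal_mult' cauchy_density_nonneg mult.assoc)
    qed
  qed
  also have "\<dots> = (\<integral>\<^sup>+y. (\<integral>\<^sup>+x. ennreal (cauchy_density 0 1 y) *
     (ennreal (cauchy_density (circ_re y) (circ_im y) x) * g x) \<partial>lborel) \<partial>lborel)"
    by (rule lborel_pair.Fubini') measurable
  also have "\<dots> = (\<integral>\<^sup>+y. ennreal (cauchy_density 0 1 y) *
     (\<integral>\<^sup>+x. ennreal (cauchy_density (circ_re y) (circ_im y) x) * g x \<partial>lborel) \<partial>lborel)"
    by (intro nn_integral_cong nn_integral_cmult) measurable
  finally show ?thesis .
qed

text \<open>Reduces integrals against \<open>mu_R\<close> to the formulas for a single Cauchy
  distribution. The parameter y = 0 is the circle point 1, where the scale vanishes and the Cauchy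
  distribution degenerates; it is a null set.\<close>

lemma nn_integral_mu_R_eqI:
  assumes g: "g \<in> borel_measurable borel" "\<And>x. 0 \<le> g x"
    and h: "\<And>y. y \<noteq> 0 \<Longrightarrow> (\<integral>\<^sup>+x. ennreal (cauchy_density (circ_re y) (circ_im y) x * g x) \<partial>lborel) = ennreal (h y)"
  shows "(\<integral>\<^sup>+x. ennreal (g x) \<partial>mu_R) = (\<integral>\<^sup>+y. ennreal (cauchy_density 0 1 y * h y) \<partial>lborel)"
proof -
  note [measurable] = g(1)
  have "(\<integral>\<^sup>+x. ennreal (g x) \<partial>mu_R) = (\<integral>\<^sup>+y. ennreal (cauchy_density 0 1 y) *
     (\<integral>\<^sup>+x. ennreal (cauchy_density (circ_re y) (circ_im y) x) * ennreal (g x) \<partial>lborel) \<partial>lborel)"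
    by (rule nn_integral_mu_R) simp
  also have "\<dots> = (\<integral>\<^sup>+y. ennreal (cauchy_density 0 1 y * h y) \<partial>lborel)"
  proof (rule nn_integral_cong_AE)
    have "AE y::real in lborel. y \<noteq> 0" by (rule AE_lborel_singleton)
    then show "AE y in lborel. ennreal (cauchy_density 0 1 y) *
     (\<integral>\<^sup>+x. ennreal (cauchy_density (circ_re y) (circ_im y) x) * ennreal (g x) \<partial>lborel) =
       ennreal (cauchy_density 0 1 y * h y)"
    proof eventually_elim
      case (elim y)
      have "ennreal (cauchy_density (circ_re y) (circ_im y) x) * ennreal (g x) =
         ennreal (cauchy_density (circ_re y) (circ_im y) x * g x)" for x
        by (simp add: ennreal_mult' cauchy_density_nonneg)
      then show ?case using h[OF elim] by (simp add: ennreal_mult' cauchy_density_nonneg)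
    qed
  qed
  finally show ?thesis .
qed

lemma circ_im_pos: "y \<noteq> 0 \<Longrightarrow> 0 < circ_im y"
  by (auto intro!: divide_pos_pos add_pos_nonneg)

lemma prob_space_mu_R: "prob_space mu_R"
proof
  have one: "(\<integral>\<^sup>+x. ennreal (cauchy_density a b x) \<partial>lborel) = 1" if "0 < b" for a b
    using has_bochner_integral_cauchy_density[OF that, of a] that
    by (subst nn_integral_eq_integral) (auto simp: has_bochner_integral_iff cauchy_density_nonneg)
  have "emeasure mu_R (space mu_R) = (\<integral>\<^sup>+x. ennreal 1 \<partial>mu_R)" by simp
  also have "\<dots> = (\<integral>\<^sup>+y. ennreal (cauchy_density 0 1 y * 1) \<partial>lborel)"
    by (rule nn_integral_mu_R_eqI) (use one circ_im_pos in auto)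
  also have "\<dots> = 1" by (simp add: one)
  finally show "emeasure mu_R (space mu_R) = 1" .
qed

text \<open>Jensen's formula: the mean of ln |s - e^(i theta)|^2 over the unit circle. In the
  variable y the argument is ((1 - s)^2 + y^2 (1 + s)^2) / (1 + y^2); pulling out (1 + s)^2 leaves
  y^2 + t^2, to which Poisson's formula applies. The case s = -1 is separate because that factor
  vanishes. The result follows from |1 + s| + |1 - s| = 2 max (1, |s|).\<close>

lemma ln_circ_integral:
  "has_bochner_integral lborel
     (\<lambda>y. cauchy_density 0 1 y * ln ((s - circ_re y)\<^sup>2 + (circ_im y)\<^sup>2)) (2 * ln (max 1 \<bar>s\<bar>))"
proof -
  have l2: "has_bochner_integral lborel (\<lambda>y. cauchy_density 0 1 y * ln (1 + y\<^sup>2)) (2 * ln 2)"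
    using has_bochner_integral_cauchy_density_ln[of 1 1 0 0] ln_realpow[of 2 2]
    by (simp add: add.commute)
  have pos: "1 + y\<^sup>2 > 0" for y :: real by (simp add: add_pos_nonneg)
  have eq: "ln ((s - circ_re y)\<^sup>2 + (circ_im y)\<^sup>2) = ln ((1 - s)\<^sup>2 + y\<^sup>2 * (1 + s)\<^sup>2) - ln (1 + y\<^sup>2)" if "y \<noteq> 0" for y
    unfolding circ_dist
  proof (rule ln_divide_pos)
    show "0 < (1 - s)\<^sup>2 + y\<^sup>2 * (1 + s)\<^sup>2"
      using that by (cases "s = 1") (auto intro: add_pos_nonneg)
  qed (rule pos)
  have "has_bochner_integral lborel (\<lambda>y. cauchy_density 0 1 y * ln ((1 - s)\<^sup>2 + y\<^sup>2 * (1 + s)\<^sup>2))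
     (2 * ln (\<bar>1 + s\<bar> + \<bar>1 - s\<bar>))"
  proof (cases "s = -1")
    case True
    have "has_bochner_integral lborel (\<lambda>y. cauchy_density 0 1 y * ln 4) (1 * ln 4)"
      by (intro has_bochner_integral_mult_left has_bochner_integral_cauchy_density) simp
    moreover have "ln (4::real) = 2 * ln 2" using ln_realpow[of 2 2] by simp
    ultimately show ?thesis using True by simp
  next
    case False
    define t where "t = \<bar>1 - s\<bar> / \<bar>1 + s\<bar>"
    have s1: "(1 + s)\<^sup>2 > 0" "\<bar>1 + s\<bar> > 0" using False by auto
    have t: "t \<ge> 0" by (simp add: t_def)
    have ts: "t\<^sup>2 * (1 + s)\<^sup>2 = (1 - s)\<^sup>2"
      using s1 by (simp add: t_def power_divide)
    have "has_bochner_integral lborel (\<lambda>y. cauchy_density 0 1 y * ln ((y - 0)\<^sup>2 + t\<^sup>2)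
       + cauchy_density 0 1 y * ln ((1 + s)\<^sup>2)) (ln ((0 - 0)\<^sup>2 + (1 + t)\<^sup>2) + 1 * ln ((1 + s)\<^sup>2))"
      using t by (intro has_bochner_integral_add has_bochner_integral_cauchy_density_ln
          has_bochner_integral_mult_left has_bochner_integral_cauchy_density) auto
    also have "ln ((0 - 0)\<^sup>2 + (1 + t)\<^sup>2) + 1 * ln ((1 + s)\<^sup>2) = ln (((1 + t) * \<bar>1 + s\<bar>)\<^sup>2)"
      unfolding power_mult_distrib using t s1 by (subst ln_mult_pos) auto
    also have "(1 + t) * \<bar>1 + s\<bar> = \<bar>1 + s\<bar> + \<bar>1 - s\<bar>"
      using s1 by (simp add: t_def distrib_right)
    also have "ln ((\<bar>1 + s\<bar> + \<bar>1 - s\<bar>)\<^sup>2) = 2 * ln (\<bar>1 + s\<bar> + \<bar>1 - s\<bar>)"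
      using s1 by (subst ln_realpow) auto
    finally have *: "has_bochner_integral lborel (\<lambda>y. cauchy_density 0 1 y * ln ((y - 0)\<^sup>2 + t\<^sup>2)
       + cauchy_density 0 1 y * ln ((1 + s)\<^sup>2)) (2 * ln (\<bar>1 + s\<bar> + \<bar>1 - s\<bar>))" .
    have "AE y::real in lborel. y \<noteq> 0" by (rule AE_lborel_singleton)
    then have "AE y in lborel. cauchy_density 0 1 y * ln ((y - 0)\<^sup>2 + t\<^sup>2)
       + cauchy_density 0 1 y * ln ((1 + s)\<^sup>2) = cauchy_density 0 1 y * ln ((1 - s)\<^sup>2 + y\<^sup>2 * (1 + s)\<^sup>2)"
    proof eventually_elim
      case (elim y)
      have "ln ((y - 0)\<^sup>2 + t\<^sup>2) + ln ((1 + s)\<^sup>2) = ln (((y - 0)\<^sup>2 + t\<^sup>2) * (1 + s)\<^sup>2)"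
        by (rule ln_mult_pos[symmetric]) (use elim s1 in \<open>auto intro: add_pos_nonneg\<close>)
      also have "((y - 0)\<^sup>2 + t\<^sup>2) * (1 + s)\<^sup>2 = (1 - s)\<^sup>2 + y\<^sup>2 * (1 + s)\<^sup>2"
        by (simp add: distrib_right ts)
      finally show ?case by (simp flip: distrib_left)
    qed
    with * show ?thesis by (subst (asm) has_bochner_integral_cong_AE) auto
  qed
  from has_bochner_integral_diff[OF this l2]
  have *: "has_bochner_integral lborel (\<lambda>y. cauchy_density 0 1 y * ln ((1 - s)\<^sup>2 + y\<^sup>2 * (1 + s)\<^sup>2)
      - cauchy_density 0 1 y * ln (1 + y\<^sup>2)) (2 * ln (\<bar>1 + s\<bar> + \<bar>1 - s\<bar>) - 2 * ln 2)" .
  also have "2 * ln (\<bar>1 + s\<bar> + \<bar>1 - s\<bar>) - 2 * ln 2 = 2 * ln (max 1 \<bar>s\<bar>)"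
  proof -
    have "\<bar>1 + s\<bar> + \<bar>1 - s\<bar> = max 1 \<bar>s\<bar> * 2" by (auto simp: max_def abs_if)
    then show ?thesis by (simp add: ln_mult_pos)
  qed
  finally have **: "has_bochner_integral lborel (\<lambda>y. cauchy_density 0 1 y * ln ((1 - s)\<^sup>2 + y\<^sup>2 * (1 + s)\<^sup>2)
      - cauchy_density 0 1 y * ln (1 + y\<^sup>2)) (2 * ln (max 1 \<bar>s\<bar>))" .
  have "AE y::real in lborel. y \<noteq> 0" by (rule AE_lborel_singleton)
  then have "AE y in lborel. cauchy_density 0 1 y * ln ((1 - s)\<^sup>2 + y\<^sup>2 * (1 + s)\<^sup>2)
      - cauchy_density 0 1 y * ln (1 + y\<^sup>2) = cauchy_density 0 1 y * ln ((s - circ_re y)\<^sup>2 + (circ_im y)\<^sup>2)"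
  proof eventually_elim
    case (elim y)
    show ?case unfolding eq[OF elim] by (rule right_diff_distrib[symmetric])
  qed
  with ** show ?thesis by (subst (asm) has_bochner_integral_cong_AE) auto
qed

lemma circ_bounds: "\<bar>circ_re y\<bar> \<le> 1" "circ_im y \<le> 1" "0 \<le> circ_im y" "(circ_re y)\<^sup>2 + (circ_im y)\<^sup>2 = 1"
proof -
  have p: "1 + y\<^sup>2 > 0" by (simp add: add_pos_nonneg)
  show eq: "(circ_re y)\<^sup>2 + (circ_im y)\<^sup>2 = 1" using circ_dist[of 0 y] p by simp
  have "(circ_re y)\<^sup>2 \<le> 1" using eq zero_le_power2[of "circ_im y"] by linarith
  then show "\<bar>circ_re y\<bar> \<le> 1" by (simp add: abs_square_le_1)
  have "(circ_im y)\<^sup>2 \<le> 1" using eq zero_le_power2[of "circ_re y"] by linarith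
  then show "circ_im y \<le> 1" by (simp add: abs_square_le_1 abs_le_iff)
  show "0 \<le> circ_im y" using p by simp
qed

text \<open>With y = tan (theta / 2) this is theta / 2 <= (pi / 4) sin theta on [0, pi / 2]. The
  difference \<open>g\<close> vanishes at y = 0 and y = 1, and its derivative changes sign at most
  once, from plus to minus, so \<open>g\<close> is compared with whichever end point lies on the
  proper side.\<close>

lemma jordan_arctan:
  assumes "0 \<le> y" "y \<le> 1"
  shows "arctan y \<le> pi / 4 * (2 * y / (1 + y\<^sup>2))"
proof -
  define g where "g y = pi / 4 * (2 * y / (1 + y\<^sup>2)) - arctan y" for y
  define g' where "g' y = (pi / 2 * (1 - y\<^sup>2) - (1 + y\<^sup>2)) / (1 + y\<^sup>2)\<^sup>2" for y :: real
  have der: "(g has_real_derivative g' y) (at y)" for y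
  proof -
    define w where "w = 1 + y\<^sup>2"
    have w: "w > 0" by (simp add: w_def add_pos_nonneg)
    have "((\<lambda>y. 2 * y / (1 + y\<^sup>2)) has_real_derivative (2 * w - 2 * y * (2 * y)) / (w * w)) (at y)"
      unfolding w_def using w[unfolded w_def] by (auto intro!: derivative_eq_intros)
    from DERIV_diff[OF DERIV_cmult[OF this, of "pi / 4"] DERIV_arctan[of y]]
    have "(g has_real_derivative pi / 4 * ((2 * w - 2 * y * (2 * y)) / (w * w)) - 1 / w) (at y)"
      unfolding g_def w_def by (simp add: inverse_eq_divide)
    also have "pi / 4 * ((2 * w - 2 * y * (2 * y)) / (w * w)) - 1 / w = (pi / 4 * (2 * w - 2 * y * (2 * y)) - w) / w\<^sup>2"
      using w by (simp add: field_simps power2_eq_square)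
    also have "\<dots> = g' y" by (simp add: g'_def w_def power2_eq_square algebra_simps)
    finally show ?thesis .
  qed
  have sgn: "0 \<le> g' z \<longleftrightarrow> z\<^sup>2 * (pi / 2 + 1) \<le> pi / 2 - 1" for z
  proof -
    have "0 < 1 + z\<^sup>2" by (simp add: add_pos_nonneg)
    then have "0 < (1 + z\<^sup>2)\<^sup>2" by simp
    then have "0 \<le> g' z \<longleftrightarrow> 0 \<le> pi / 2 * (1 - z\<^sup>2) - (1 + z\<^sup>2)"
      unfolding g'_def by (simp add: zero_le_divide_iff)
    then show ?thesis by (auto simp: algebra_simps)
  qed
  have "g y \<ge> 0"
  proof (cases "0 \<le> g' y")
    case True
    have "g 0 \<le> g y"
    proof (rule DERIV_nonneg_imp_nondecreasing[OF assms(1)])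
      fix x assume x: "0 \<le> x" "x \<le> y"
      then have "x\<^sup>2 * (pi / 2 + 1) \<le> y\<^sup>2 * (pi / 2 + 1)"
        by (intro mult_right_mono power_mono) auto
      then have "0 \<le> g' x" using True sgn[of x] sgn[of y] by linarith
      then show "\<exists>d. (g has_real_derivative d) (at x) \<and> 0 \<le> d" using der by blast
    qed
    then show ?thesis by (simp add: g_def)
  next
    case False
    have "g 1 \<le> g y"
    proof (rule DERIV_nonpos_imp_nonincreasing[OF assms(2)])
      fix x assume x: "y \<le> x" "x \<le> 1"
      then have "y\<^sup>2 * (pi / 2 + 1) \<le> x\<^sup>2 * (pi / 2 + 1)"
        using assms by (intro mult_right_mono power_mono) auto
      then have "g' x \<le> 0" using False sgn[of x] sgn[of y] by linarith
      then show "\<exists>d. (g has_real_derivative d) (at x) \<and> d \<le> 0" using der by blast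
    qed
    then show ?thesis by (simp add: g_def arctan_one)
  qed
  then show ?thesis by (simp add: g_def)
qed

lemma nn_integral_FTC_einterval:
  fixes f F :: "real \<Rightarrow> real" and a b :: ereal
  assumes "a < b"
    and F: "\<And>x. a < ereal x \<Longrightarrow> ereal x < b \<Longrightarrow> (F has_real_derivative f x) (at x)"
    and f: "\<And>x. a < ereal x \<Longrightarrow> ereal x < b \<Longrightarrow> isCont f x"
    and nonneg: "\<And>x. a < ereal x \<Longrightarrow> ereal x < b \<Longrightarrow> 0 \<le> f x"
    and lim: "((F \<circ> real_of_ereal) \<longlongrightarrow> A) (at_right a)" "((F \<circ> real_of_ereal) \<longlongrightarrow> B) (at_left b)"
  shows "(\<integral>\<^sup>+x. ennreal (f x) * indicator (einterval a b) x \<partial>lborel) = ennreal (B - A)"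
proof -
  have *: "set_integrable lborel (einterval a b) f" "(LBINT x=a..b. f x) = B - A"
    using interval_integral_FTC_nonneg[of a b F f A B] assms by auto
  have "(\<integral>\<^sup>+x. ennreal (f x) * indicator (einterval a b) x \<partial>lborel) =
      (\<integral>\<^sup>+x. ennreal (indicator (einterval a b) x * f x) \<partial>lborel)"
    by (intro nn_integral_cong) (auto split: split_indicator)
  also have "\<dots> = ennreal (\<integral>x. indicator (einterval a b) x * f x \<partial>lborel)"
    using * nonneg by (intro nn_integral_eq_integral)
      (auto simp: set_integrable_def einterval_def split: split_indicator)
  also have "(\<integral>x. indicator (einterval a b) x * f x \<partial>lborel) = B - A"
    using *(2) assms(1) by (simp add: interval_lebesgue_integral_def set_lebesgue_integral_def less_imp_le)
  finally show ?thesis .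
qed

text \<open>The potential of \<open>mu_R\<close> at \<open>s + i T\<close> exceeds the one at \<open>s\<close> by half of the left-hand side.\<close>

lemma nn_integral_mu_R_ln_recip_le:
  assumes T: "0 < T"
  shows "(\<integral>\<^sup>+x. ennreal (ln (1 + T\<^sup>2 / (x - s)\<^sup>2)) \<partial>mu_R) \<le>
      ennreal (2 * ((1 + T) * ln (1 + T) - T * ln T))"
proof -
  \<comment> \<open>By Jordan's inequality T / sin theta <= \<open>\<kappa>\<close> / a for a =
    arctan y = theta / 2. The function \<open>G\<close> below is the primitive of ln (1 +
    \<open>\<kappa>\<close> / a) that tends to 0 as a -> 0.\<close>
  define \<kappa> where "\<kappa> = pi / 4 * T"
  have \<kappa>: "\<kappa> > 0" using T by (simp add: \<kappa>_def)
  define G where "G a = (a + \<kappa>) * ln (a + \<kappa>) - a * ln a - \<kappa> * ln \<kappa>" for a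
  have G_deriv: "(G has_real_derivative ln (1 + \<kappa> / a)) (at a)" if a: "0 < a" for a
  proof -
    have "(G has_real_derivative ln (a + \<kappa>) - ln a) (at a)"
      unfolding G_def using a \<kappa> by (auto intro!: derivative_eq_intros)
    also have "ln (a + \<kappa>) - ln a = ln (1 + \<kappa> / a)"
      using a \<kappa> by (subst ln_divide_pos[symmetric]) (auto simp: add_divide_distrib)
    finally show ?thesis .
  qed
  have G4: "G (pi / 4) = pi / 4 * ((1 + T) * ln (1 + T) - T * ln T)"
  proof -
    have e1: "pi / 4 + \<kappa> = pi / 4 * (1 + T)" by (simp add: \<kappa>_def algebra_simps)
    have e2: "ln (pi / 4 * (1 + T)) = ln (pi / 4) + ln (1 + T)" "ln \<kappa> = ln (pi / 4) + ln T"
      unfolding \<kappa>_def by (rule ln_mult_pos; use T in simp)+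
    show ?thesis unfolding G_def e1 e2 unfolding \<kappa>_def by (simp add: algebra_simps add_divide_distrib)
  qed
  have Gpos: "G (pi / 4) \<ge> 0"
  proof -
    have "T * ln T \<le> T * ln (1 + T)" using T by (intro mult_left_mono) auto
    moreover have "0 \<le> ln (1 + T)" using T by simp
    ultimately have "0 \<le> (1 + T) * ln (1 + T) - T * ln T" by (simp add: algebra_simps)
    then show ?thesis unfolding G4 by simp
  qed
  have pos: "1 + y\<^sup>2 > 0" for y :: real by (simp add: add_pos_nonneg)
  have bound: "ln (1 + T / c) \<le> ln (1 + \<kappa> / a)" if "0 < c" "0 < a" "a \<le> pi / 4 * c" for a c
  proof -
    have "T * a \<le> T * (pi / 4 * c)" using that T by (intro mult_left_mono) auto
    then have "T / c \<le> \<kappa> / a" using that by (simp add: \<kappa>_def field_simps)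
    then show ?thesis using that T by (intro ln_mono) (auto intro!: add_pos_pos)
  qed
  have "(\<integral>\<^sup>+x. ennreal (ln (1 + T\<^sup>2 / (x - s)\<^sup>2)) \<partial>mu_R) =
     (\<integral>\<^sup>+y. ennreal (cauchy_density 0 1 y * ln (((s - circ_re y)\<^sup>2 + (circ_im y + T)\<^sup>2)
         / ((s - circ_re y)\<^sup>2 + (circ_im y)\<^sup>2))) \<partial>lborel)"
    using T circ_im_pos by (intro nn_integral_mu_R_eqI nn_integral_cauchy_density_ln_recip) auto
  \<comment> \<open>Dropping the common horizontal term \<open>d\<close> can only increase the
    quotient. This makes the bound independent of s.\<close>
  also have "\<dots> \<le> (\<integral>\<^sup>+y. ennreal (cauchy_density 0 1 y * (2 * ln (1 + T / circ_im y))) \<partial>lborel)"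
  proof (rule nn_integral_mono_AE)
    have "AE y::real in lborel. y \<noteq> 0" by (rule AE_lborel_singleton)
    then show "AE y in lborel. ennreal (cauchy_density 0 1 y * ln (((s - circ_re y)\<^sup>2 + (circ_im y + T)\<^sup>2)
         / ((s - circ_re y)\<^sup>2 + (circ_im y)\<^sup>2))) \<le> ennreal (cauchy_density 0 1 y * (2 * ln (1 + T / circ_im y)))"
    proof eventually_elim
      case (elim y)
      define b d where "b = circ_im y" and "d = (s - circ_re y)\<^sup>2"
      have b: "b > 0" and d: "d \<ge> 0" using elim circ_im_pos by (auto simp: b_def d_def)
      have db: "d + b\<^sup>2 > 0" "d + (b + T)\<^sup>2 > 0" using b d T by (auto intro: add_nonneg_pos)
      have "d * b\<^sup>2 \<le> d * (b + T)\<^sup>2" using d b T by (intro mult_left_mono power_mono) auto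
      moreover have "0 \<le> b ^ 4 + d * b\<^sup>2" using d by simp
      ultimately have "(d + (b + T)\<^sup>2) / (d + b\<^sup>2) \<le> (b + T)\<^sup>2 / b\<^sup>2"
        using b db by (subst frac_le_eq) (auto simp: divide_le_0_iff algebra_simps intro!: disjI2 mult_nonneg_nonneg)
      also have "\<dots> = (1 + T / b)\<^sup>2" using b by (simp add: power2_eq_square field_simps)
      finally have "ln ((d + (b + T)\<^sup>2) / (d + b\<^sup>2)) \<le> ln ((1 + T / b)\<^sup>2)"
        using db by (intro ln_mono) auto
      also have "\<dots> = 2 * ln (1 + T / b)" using b T by (simp add: ln_realpow)
      finally show ?case
        by (intro ennreal_leI mult_left_mono) (simp_all add: b_def d_def cauchy_density_nonneg)
    qed
  qed
  also have "\<dots> = 2 * (\<integral>\<^sup>+y. ennreal (cauchy_density 0 1 y * (2 * ln (1 + T / circ_im y))) * indicator {0..} y \<partial>lborel)"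
    by (rule nn_integral_even) (auto simp: cauchy_density_def)
  \<comment> \<open>The point y = 1 is theta = pi / 2, up to which Jordan's inequality is available.
    For y > 1 it is applied to 1 / y, that is, to pi - theta, which has the same sine.\<close>
  also have "(\<integral>\<^sup>+y. ennreal (cauchy_density 0 1 y * (2 * ln (1 + T / circ_im y))) * indicator {0..} y \<partial>lborel) =
     (\<integral>\<^sup>+y. ennreal (cauchy_density 0 1 y * (2 * ln (1 + T / circ_im y))) * indicator {0..1} y \<partial>lborel) +
     (\<integral>\<^sup>+y. ennreal (cauchy_density 0 1 y * (2 * ln (1 + T / circ_im y))) * indicator {1<..} y \<partial>lborel)"
    by (subst nn_integral_add[symmetric]) (auto intro!: nn_integral_cong split: split_indicator)
  also have "(\<integral>\<^sup>+y. ennreal (cauchy_density 0 1 y * (2 * ln (1 + T / circ_im y))) * indicator {0..1} y \<partial>lborel)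
      \<le> (\<integral>\<^sup>+y. ennreal (2 / pi * (ln (1 + \<kappa> / arctan y) / (1 + y\<^sup>2))) * indicator (einterval 0 1) y \<partial>lborel)"
  proof (rule nn_integral_mono_AE)
    have "AE y::real in lborel. y \<noteq> 0" "AE y::real in lborel. y \<noteq> 1" by (rule AE_lborel_singleton)+
    then show "AE y in lborel. ennreal (cauchy_density 0 1 y * (2 * ln (1 + T / circ_im y))) * indicator {0..1} y
        \<le> ennreal (2 / pi * (ln (1 + \<kappa> / arctan y) / (1 + y\<^sup>2))) * indicator (einterval 0 1) y"
    proof eventually_elim
      case (elim y)
      show ?case
      proof (cases "y \<in> {0..1}")
        case True
        then have y: "0 < y" "y < 1" using elim by auto
        have "ln (1 + T / circ_im y) \<le> ln (1 + \<kappa> / arctan y)"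
          using jordan_arctan[of y] y by (intro bound circ_im_pos) auto
        then show ?thesis using y pos[of y]
          by (auto simp: einterval_def cauchy_density_def add.commute divide_right_mono intro!: ennreal_leI)
      qed simp
    qed
  qed
  also have "\<dots> = ennreal (2 / pi * G (pi / 4) - 0)"
  proof (rule nn_integral_FTC_einterval[where F = "\<lambda>y. 2 / pi * G (arctan y)"])
    show "((\<lambda>y. 2 / pi * G (arctan y)) has_real_derivative 2 / pi * (ln (1 + \<kappa> / arctan y) / (1 + y\<^sup>2))) (at y)"
      if "0 < ereal y" "ereal y < 1" for y
      using DERIV_chain'[OF DERIV_arctan G_deriv, of y] that
      by (intro DERIV_cmult) (auto simp: divide_inverse)
    show "isCont (\<lambda>y. 2 / pi * (ln (1 + \<kappa> / arctan y) / (1 + y\<^sup>2))) y" if "0 < ereal y" "ereal y < 1" for y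
    proof -
      have "0 < arctan y" "0 < 1 + \<kappa> / arctan y" using that \<kappa> by (auto intro!: add_pos_pos divide_pos_pos)
      then show ?thesis using pos[of y] by (intro continuous_intros) (auto simp: less_imp_neq[symmetric])
    qed
    show "0 \<le> 2 / pi * (ln (1 + \<kappa> / arctan y) / (1 + y\<^sup>2))" if "0 < ereal y" "ereal y < 1" for y
      using that \<kappa> pos[of y] by (intro mult_nonneg_nonneg divide_nonneg_pos ln_ge_zero) auto
    have "((\<lambda>y. 2 / pi * G (arctan y)) \<longlongrightarrow> 0) (at_right 0)"
      unfolding G_def using \<kappa> by real_asymp
    then show "(((\<lambda>y. 2 / pi * G (arctan y)) \<circ> real_of_ereal) \<longlongrightarrow> 0) (at_right 0)"
      unfolding zero_ereal_def by (simp add: ereal_tendsto_simps1 del: zero_ereal_def[symmetric])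
    have "isCont (\<lambda>y. 2 / pi * G (arctan y)) 1"
      using DERIV_chain'[OF DERIV_arctan G_deriv, of 1] by (intro continuous_intros DERIV_isCont) auto
    then have "((\<lambda>y. 2 / pi * G (arctan y)) \<longlongrightarrow> 2 / pi * G (pi / 4)) (at_left 1)"
      by (simp add: isCont_def filterlim_at_split arctan_one)
    then show "(((\<lambda>y. 2 / pi * G (arctan y)) \<circ> real_of_ereal) \<longlongrightarrow> 2 / pi * G (pi / 4)) (at_left 1)"
      unfolding one_ereal_def by (simp add: ereal_tendsto_simps1)
  qed simp
  also have "(\<integral>\<^sup>+y. ennreal (cauchy_density 0 1 y * (2 * ln (1 + T / circ_im y))) * indicator {1<..} y \<partial>lborel)
      \<le> (\<integral>\<^sup>+y. ennreal (2 / pi * (ln (1 + \<kappa> / arctan (1 / y)) / (1 + y\<^sup>2))) * indicator {1..} y \<partial>lborel)"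
  proof (rule nn_integral_mono)
    fix y :: real
    show "ennreal (cauchy_density 0 1 y * (2 * ln (1 + T / circ_im y))) * indicator {1<..} y
        \<le> ennreal (2 / pi * (ln (1 + \<kappa> / arctan (1 / y)) / (1 + y\<^sup>2))) * indicator {1..} y"
    proof (cases "1 < y")
      case True
      have "circ_im y = 2 * (1 / y) / (1 + (1 / y)\<^sup>2)"
        using True by (simp add: power2_eq_square field_simps)
      then have "ln (1 + T / circ_im y) \<le> ln (1 + \<kappa> / arctan (1 / y))"
        using jordan_arctan[of "1 / y"] True by (intro bound circ_im_pos) (auto simp: field_simps)
      then show ?thesis using True pos[of y]
        by (auto simp: cauchy_density_def add.commute divide_right_mono intro!: ennreal_leI)
    qed simp
  qed
  also have "\<dots> = ennreal (0 - - (2 / pi * G (arctan (1 / 1))))"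
  proof (rule nn_integral_FTC_atLeast[where F = "\<lambda>y. - (2 / pi * G (arctan (1 / y)))"])
    show "((\<lambda>y. - (2 / pi * G (arctan (1 / y)))) has_real_derivative
        2 / pi * (ln (1 + \<kappa> / arctan (1 / y)) / (1 + y\<^sup>2))) (at y)" if "1 \<le> y" for y
    proof -
      have y: "y > 0" using that by simp
      have "((\<lambda>y. arctan (1 / y)) has_real_derivative - (1 / (1 + y\<^sup>2))) (at y)"
        using y pos[of y] by (auto intro!: derivative_eq_intros simp: field_simps power2_eq_square)
      from DERIV_chain'[OF this G_deriv] y
      have "((\<lambda>y. G (arctan (1 / y))) has_real_derivative - (1 / (1 + y\<^sup>2)) * ln (1 + \<kappa> / arctan (1 / y))) (at y)"
        by (simp add: mult.commute)
      from DERIV_minus[OF DERIV_cmult[OF this, of "2 / pi"]] show ?thesis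
        by (simp add: field_simps)
    qed
    show "0 \<le> 2 / pi * (ln (1 + \<kappa> / arctan (1 / y)) / (1 + y\<^sup>2))" if "1 \<le> y" for y
      using that \<kappa> pos[of y] by (intro mult_nonneg_nonneg divide_nonneg_pos ln_ge_zero) auto
    show "((\<lambda>y. - (2 / pi * G (arctan (1 / y)))) \<longlongrightarrow> 0) at_top"
      unfolding G_def using \<kappa> by real_asymp
  qed (auto simp: add.commute)
  finally have "(\<integral>\<^sup>+x. ennreal (ln (1 + T\<^sup>2 / (x - s)\<^sup>2)) \<partial>mu_R) \<le>
      2 * (ennreal (2 / pi * G (pi / 4)) + ennreal (2 / pi * G (pi / 4)))"
    by (simp add: add_mono mult_left_mono arctan_one)
  also have "\<dots> = ennreal (2 * (2 / pi * G (pi / 4) + 2 / pi * G (pi / 4)))"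
    by (subst ennreal_mult', simp, subst ennreal_plus) (use Gpos in auto)
  also have "2 * (2 / pi * G (pi / 4) + 2 / pi * G (pi / 4)) = 2 * ((1 + T) * ln (1 + T) - T * ln T)"
    unfolding G4 by simp
  finally show ?thesis .
qed

text \<open>Convexity of (1 + t) ln (1 + t) on [0, 1] bounds that term by 2 T ln 2. With T = e^(-L),
  division by T leaves 25 / 9 + 2 L <= 0.678 + 2.505 e^(7 L / 8), which already follows from e^x >=
  1 + x.\<close>

lemma strip_bound:
  fixes T :: real
  assumes T: "0 < T" "T < 1"
  shows "2 * ((1 + T) * ln (1 + T) - T * ln T) \<le> 0.678 * T + 2.505 * T powr (1 / 8)"
proof -
  define L where "L = - ln T"
  have L: "L > 0" using T ln_less_zero[of T] by (simp add: L_def)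
  have TL: "T = exp (- L)" using T by (simp add: L_def)
  have "(1 + T) * ln (1 + T) \<le> T * (2 * ln 2)"
  proof -
    define g where "g t = (1 + t) * ln (1 + t)" for t :: real
    have "convex_on {0..1} g"
    proof (rule convex_on_realI)
      show "connected {0..1::real}" by simp
      show "(g has_real_derivative (ln (1 + t) + 1)) (at t)" if "t \<in> {0..1}" for t
        unfolding g_def using that by (auto intro!: derivative_eq_intros)
    qed auto
    from convex_onD[OF this, of T 0 1] T have "g T \<le> (1 - T) * g 0 + T * g 1" by simp
    then show ?thesis by (simp add: g_def)
  qed
  moreover have "ln 2 \<le> (25 / 36 :: real)" by (rule ln2_le_25_over_36)
  then have "T * (2 * ln 2) \<le> T * (25 / 18)"
    using T by (intro mult_left_mono) auto
  ultimately have "(1 + T) * ln (1 + T) \<le> T * (25 / 18)" by (rule order_trans)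
  then have "2 * ((1 + T) * ln (1 + T) - T * ln T) \<le> T * (25 / 9) + 2 * T * L"
    by (simp add: L_def algebra_simps)
  also have "\<dots> \<le> 0.678 * T + 2.505 * (T * exp (7 / 8 * L))"
  proof -
    have "1 + 7 / 8 * L \<le> exp (7 / 8 * L)" by (rule exp_ge_add_one_self)
    then have "25 / 9 + 2 * L \<le> 339 / 500 + 501 / 200 * exp (7 / 8 * L)" using L by linarith
    then have "T * (25 / 9 + 2 * L) \<le> T * (339 / 500 + 501 / 200 * exp (7 / 8 * L))"
      using T by (intro mult_left_mono) auto
    then show ?thesis by (simp add: algebra_simps)
  qed
  also have "T * exp (7 / 8 * L) = T powr (1 / 8)"
    unfolding TL powr_def by (simp flip: exp_add)
  finally show ?thesis .
qed

text \<open>The value is deliberately left as an integral: wherever this mean occurs later, it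
  cancels. Integrability holds because the circle points lie in the unit disc, so the argument of
  the logarithm stays between 1 and a constant depending on s.\<close>

lemma has_bochner_integral_mu_R_ln_plus:
  "has_bochner_integral mu_R (\<lambda>x. ln (1 + (x - s)\<^sup>2))
     (\<integral>y. cauchy_density 0 1 y * ln ((s - circ_re y)\<^sup>2 + (circ_im y + 1)\<^sup>2) \<partial>lborel)"
  and integrable_cauchy_ln_circ:
  "integrable lborel (\<lambda>y. cauchy_density 0 1 y * ln ((s - circ_re y)\<^sup>2 + (circ_im y + 1)\<^sup>2))"
proof -
  have ge: "1 \<le> (s - circ_re y)\<^sup>2 + (circ_im y + 1)\<^sup>2" for y
  proof -
    have "1\<^sup>2 \<le> (circ_im y + 1)\<^sup>2" using circ_bounds(3)[of y] by (intro power_mono) auto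
    then have "1 \<le> (circ_im y + 1)\<^sup>2" by (simp only: one_power2)
    then show ?thesis by (rule add_increasing[OF zero_le_power2])
  qed
  have le: "(s - circ_re y)\<^sup>2 + (circ_im y + 1)\<^sup>2 \<le> (\<bar>s\<bar> + 1)\<^sup>2 + 2\<^sup>2" for y
  proof (rule add_mono)
    have "\<bar>s - circ_re y\<bar> \<le> \<bar>s\<bar> + \<bar>circ_re y\<bar>" by (rule abs_triangle_ineq4)
    also have "\<dots> \<le> \<bar>s\<bar> + 1" using circ_bounds(1)[of y] by linarith
    finally have "\<bar>s - circ_re y\<bar>\<^sup>2 \<le> (\<bar>s\<bar> + 1)\<^sup>2" by (rule power_mono) simp
    then show "(s - circ_re y)\<^sup>2 \<le> (\<bar>s\<bar> + 1)\<^sup>2" by simp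
    show "(circ_im y + 1)\<^sup>2 \<le> 2\<^sup>2" using circ_bounds(2,3)[of y] by (intro power_mono) auto
  qed
  show int: "integrable lborel (\<lambda>y. cauchy_density 0 1 y * ln ((s - circ_re y)\<^sup>2 + (circ_im y + 1)\<^sup>2))"
  proof (rule Bochner_Integration.integrable_bound)
    show "integrable lborel (\<lambda>y. cauchy_density 0 1 y * ln ((\<bar>s\<bar> + 1)\<^sup>2 + 2\<^sup>2))"
      using has_bochner_integral_cauchy_density[of 1 0] by (auto simp: has_bochner_integral_iff)
    show "AE y in lborel. norm (cauchy_density 0 1 y * ln ((s - circ_re y)\<^sup>2 + (circ_im y + 1)\<^sup>2))
        \<le> norm (cauchy_density 0 1 y * ln ((\<bar>s\<bar> + 1)\<^sup>2 + 2\<^sup>2))"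
    proof (rule always_eventually, rule allI)
      fix y
      have "ln ((s - circ_re y)\<^sup>2 + (circ_im y + 1)\<^sup>2) \<le> ln ((\<bar>s\<bar> + 1)\<^sup>2 + 2\<^sup>2)"
        using ge[of y] le[of y] by (intro ln_mono) auto
      moreover have "0 \<le> ln ((s - circ_re y)\<^sup>2 + (circ_im y + 1)\<^sup>2)" using ge[of y] by simp
      ultimately show "norm (cauchy_density 0 1 y * ln ((s - circ_re y)\<^sup>2 + (circ_im y + 1)\<^sup>2))
        \<le> norm (cauchy_density 0 1 y * ln ((\<bar>s\<bar> + 1)\<^sup>2 + 2\<^sup>2))"
        by (auto simp: abs_mult intro!: mult_left_mono)
    qed
  qed measurable
  show "has_bochner_integral mu_R (\<lambda>x. ln (1 + (x - s)\<^sup>2))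
     (\<integral>y. cauchy_density 0 1 y * ln ((s - circ_re y)\<^sup>2 + (circ_im y + 1)\<^sup>2) \<partial>lborel)"
  proof (rule has_bochner_integral_nn_integral)
    have "(\<integral>\<^sup>+x. ennreal (ln (1 + (x - s)\<^sup>2)) \<partial>mu_R) =
       (\<integral>\<^sup>+y. ennreal (cauchy_density 0 1 y * ln ((s - circ_re y)\<^sup>2 + (circ_im y + 1)\<^sup>2)) \<partial>lborel)"
    proof (rule nn_integral_mu_R_eqI)
      show "(\<integral>\<^sup>+x. ennreal (cauchy_density (circ_re y) (circ_im y) x * ln (1 + (x - s)\<^sup>2)) \<partial>lborel) =
          ennreal (ln ((s - circ_re y)\<^sup>2 + (circ_im y + 1)\<^sup>2))" if "y \<noteq> 0" for y
        using nn_integral_cauchy_density_ln_plus[OF circ_im_pos[OF that], of 1 "circ_re y" s] by simp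
    qed auto
    then show "(\<integral>\<^sup>+x. ennreal (ln (1 + (x - s)\<^sup>2)) \<partial>mu_R) =
       ennreal (\<integral>y. cauchy_density 0 1 y * ln ((s - circ_re y)\<^sup>2 + (circ_im y + 1)\<^sup>2) \<partial>lborel)"
      using int ge by (subst (asm) nn_integral_eq_integral) (auto simp: cauchy_density_nonneg)
    show "0 \<le> (\<integral>y. cauchy_density 0 1 y * ln ((s - circ_re y)\<^sup>2 + (circ_im y + 1)\<^sup>2) \<partial>lborel)"
      using ge by (intro integral_nonneg_AE) (auto simp: cauchy_density_nonneg)
  qed auto
qed

text \<open>Sweeping onto the line does not change the logarithmic potential on the line, so the
  value is the one of Jensen's formula. The logarithm is again split into two non-negative parts,
  each integrated against the mixture; their common unknown \<open>p\<close> cancels.\<close>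

lemma has_bochner_integral_mu_R_ln:
  "has_bochner_integral mu_R (\<lambda>x. ln ((x - s)\<^sup>2)) (2 * ln (max 1 \<bar>s\<bar>))"
proof -
  define P Q where "P y = (s - circ_re y)\<^sup>2 + (circ_im y + 1)\<^sup>2"
    and "Q y = (s - circ_re y)\<^sup>2 + (circ_im y)\<^sup>2" for y
  have [measurable]: "P \<in> borel_measurable borel" "Q \<in> borel_measurable borel"
    unfolding P_def Q_def by measurable
  define p where "p = (\<integral>y. cauchy_density 0 1 y * ln (P y) \<partial>lborel)"
  have Pint: "has_bochner_integral lborel (\<lambda>y. cauchy_density 0 1 y * ln (P y)) p"
    using integrable_cauchy_ln_circ[of s] by (simp add: has_bochner_integral_iff p_def P_def)
  have Qint: "has_bochner_integral lborel (\<lambda>y. cauchy_density 0 1 y * ln (Q y)) (2 * ln (max 1 \<bar>s\<bar>))"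
    unfolding Q_def by (rule ln_circ_integral)
  have AE0: "AE y::real in lborel. y \<noteq> 0" by (rule AE_lborel_singleton)
  have PQ: "Q y > 0" "P y \<ge> Q y" if "y \<noteq> 0" for y
  proof -
    show "Q y > 0" unfolding Q_def using circ_im_pos[OF that] by (intro add_nonneg_pos) auto
    show "P y \<ge> Q y" unfolding P_def Q_def using circ_im_pos[OF that] by (intro add_left_mono power_mono) auto
  qed
  have "has_bochner_integral lborel (\<lambda>y. cauchy_density 0 1 y * ln (P y) - cauchy_density 0 1 y * ln (Q y))
      (p - 2 * ln (max 1 \<bar>s\<bar>))"
    by (intro has_bochner_integral_diff Pint Qint)
  moreover have "AE y in lborel. cauchy_density 0 1 y * ln (P y) - cauchy_density 0 1 y * ln (Q y) =
      cauchy_density 0 1 y * ln (P y / Q y)"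
    using AE0
  proof eventually_elim
    case (elim y)
    with PQ[of y] have "ln (P y / Q y) = ln (P y) - ln (Q y)" by (intro ln_divide_pos) auto
    then show ?case by (simp add: right_diff_distrib)
  qed
  ultimately have RQ: "has_bochner_integral lborel (\<lambda>y. cauchy_density 0 1 y * ln (P y / Q y))
      (p - 2 * ln (max 1 \<bar>s\<bar>))"
    by (subst (asm) has_bochner_integral_cong_AE) auto
  have nn: "AE y in lborel. 0 \<le> cauchy_density 0 1 y * ln (P y / Q y)"
    using AE0
  proof eventually_elim
    case (elim y)
    then show ?case using PQ[of y] by (auto intro!: mult_nonneg_nonneg simp: cauchy_density_nonneg)
  qed
  have recip: "has_bochner_integral mu_R (\<lambda>x. ln (1 + 1\<^sup>2 / (x - s)\<^sup>2)) (p - 2 * ln (max 1 \<bar>s\<bar>))"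
  proof (rule has_bochner_integral_nn_integral)
    have "(\<integral>\<^sup>+x. ennreal (ln (1 + 1\<^sup>2 / (x - s)\<^sup>2)) \<partial>mu_R) =
       (\<integral>\<^sup>+y. ennreal (cauchy_density 0 1 y * ln (P y / Q y)) \<partial>lborel)"
      unfolding P_def Q_def
      by (intro nn_integral_mu_R_eqI nn_integral_cauchy_density_ln_recip circ_im_pos) auto
    also have "\<dots> = ennreal (p - 2 * ln (max 1 \<bar>s\<bar>))"
      using RQ nn by (subst nn_integral_eq_integral) (auto simp: has_bochner_integral_iff)
    finally show "(\<integral>\<^sup>+x. ennreal (ln (1 + 1\<^sup>2 / (x - s)\<^sup>2)) \<partial>mu_R) = ennreal (p - 2 * ln (max 1 \<bar>s\<bar>))" .
    show "0 \<le> p - 2 * ln (max 1 \<bar>s\<bar>)"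
      using RQ nn integral_nonneg_AE[OF nn] by (auto simp: has_bochner_integral_iff)
  qed auto
  have plus: "has_bochner_integral mu_R (\<lambda>x. ln (1 + (x - s)\<^sup>2)) p"
    using has_bochner_integral_mu_R_ln_plus[of s] by (simp add: p_def P_def)
  have *: "has_bochner_integral mu_R (\<lambda>x. ln (1 + (x - s)\<^sup>2) - ln (1 + 1\<^sup>2 / (x - s)\<^sup>2))
     (p - (p - 2 * ln (max 1 \<bar>s\<bar>)))"
    by (rule has_bochner_integral_diff[OF plus recip])
  have "AE x in lborel. x \<noteq> s" by (rule AE_lborel_singleton)
  then have "AE x in mu_R. x \<noteq> s"
    unfolding mu_R_eq by (subst AE_density) auto
  then have "AE x in mu_R. ln (1 + (x - s)\<^sup>2) - ln (1 + 1\<^sup>2 / (x - s)\<^sup>2) = ln ((x - s)\<^sup>2)"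
  proof eventually_elim
    case (elim x)
    then have d: "(x - s)\<^sup>2 > 0" by simp
    have "1 + 1\<^sup>2 / (x - s)\<^sup>2 = (1 + (x - s)\<^sup>2) / (x - s)\<^sup>2" using d by (simp add: field_simps)
    also have "ln \<dots> = ln (1 + (x - s)\<^sup>2) - ln ((x - s)\<^sup>2)"
      by (rule ln_divide_pos) (use d in \<open>auto intro: add_pos_pos\<close>)
    finally show ?case by simp
  qed
  with * show ?thesis by (subst (asm) has_bochner_integral_cong_AE) auto
qed

section \<open>The mean of ln (max 1 |x|) and zeta(3)\<close>

lemma sums_odd_inverse_cubes: "(\<lambda>k. 1 / real (2 * k + 1) ^ 3) sums (7 / 8 * zeta3)"
proof -
  have "summable (\<lambda>n. 1 / real (Suc n) ^ 3)"
  proof -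
    have "summable (\<lambda>n. inverse (real n ^ 3))" by (rule inverse_power_summable) simp
    then have "summable (\<lambda>n. inverse (real (Suc n) ^ 3))" by (subst summable_Suc_iff)
    then show ?thesis by (simp only: inverse_eq_divide)
  qed
  then have z: "(\<lambda>n. 1 / real (Suc n) ^ 3) sums zeta3"
    unfolding zeta3_def by (rule summable_sums)
  have "(\<lambda>k. \<Sum>n = k * 2..<k * 2 + 2. 1 / real (Suc n) ^ 3) sums zeta3"
    by (rule sums_group[OF z]) simp
  moreover have "(\<Sum>n = k * 2..<k * 2 + 2. 1 / real (Suc n) ^ 3) =
      1 / real (2 * k + 1) ^ 3 + 1 / 8 * (1 / real (Suc k) ^ 3)" for k
  proof -
    have "{k * 2..<k * 2 + 2} = {2 * k, 2 * k + 1}" by auto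
    then have "(\<Sum>n = k * 2..<k * 2 + 2. 1 / real (Suc n) ^ 3) =
       1 / real (Suc (2 * k)) ^ 3 + 1 / real (Suc (2 * k + 1)) ^ 3" by simp
    also have "real (Suc (2 * k + 1)) = 2 * real (Suc k)" by simp
    also have "(2 * real (Suc k)) ^ 3 = 8 * real (Suc k) ^ 3" by (subst power_mult_distrib) simp
    finally show ?thesis by simp
  qed
  ultimately have "(\<lambda>k. 1 / real (2 * k + 1) ^ 3 + 1 / 8 * (1 / real (Suc k) ^ 3)) sums zeta3" by simp
  from sums_diff[OF this sums_mult[OF z, of "1 / 8"]] show ?thesis by simp
qed

lemma mu_R_density_eq_ln:
  assumes "1 < x"
  shows "mu_R_density x = 1 / (pi\<^sup>2 * x) * ln ((x + 1) / (x - 1))"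
  using assms by (simp add: mu_R_density_def)

lemma mu_R_density_even: "mu_R_density (- x) = mu_R_density x"
proof (cases "x = 0 \<or> x = 1 \<or> x = -1")
  case False
  have "\<bar>(- x + 1) / (- x - 1)\<bar> = inverse \<bar>(x + 1) / (x - 1)\<bar>"
  proof -
    have "(- x + 1) / (- x - 1) = (- (x - 1)) / (- (x + 1))" by (simp add: algebra_simps)
    then have "(- x + 1) / (- x - 1) = (x - 1) / (x + 1)" by (simp only: minus_divide_divide)
    then show ?thesis by (simp only: inverse_divide abs_inverse[symmetric])
  qed
  then have "ln \<bar>(- x + 1) / (- x - 1)\<bar> = - ln \<bar>(x + 1) / (x - 1)\<bar>"
    using False by (simp only: ln_inverse)
  then show ?thesis unfolding mu_R_density_def by (simp only: mult_minus_right)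
qed (auto simp: mu_R_density_def)

text \<open>Only |x| > 1 contributes. There the density is expanded in odd powers of 1 / x, and the
  integral of ln x / x^(n + 1) over x >= 1 is 1 / n^2; with the factor 1 / n of the expansion this
  gives the sum of the inverse odd cubes.\<close>

lemma has_bochner_integral_mu_R_ln_max:
  "has_bochner_integral mu_R (\<lambda>x. ln (max 1 \<bar>x\<bar>)) (7 * zeta3 / (2 * pi\<^sup>2))"
proof (rule has_bochner_integral_nn_integral)
  have "(\<integral>\<^sup>+x. ennreal (ln (max 1 \<bar>x\<bar>)) \<partial>mu_R) = (\<integral>\<^sup>+x. ennreal (mu_R_density x) * ennreal (ln (max 1 \<bar>x\<bar>)) \<partial>lborel)"
    unfolding mu_R_eq by (rule nn_integral_density) auto
  also have "\<dots> = 2 * (\<integral>\<^sup>+x. ennreal (mu_R_density x) * ennreal (ln (max 1 \<bar>x\<bar>)) * indicator {0..} x \<partial>lborel)"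
    by (rule nn_integral_even) (auto simp: mu_R_density_even)
  also have "(\<integral>\<^sup>+x. ennreal (mu_R_density x) * ennreal (ln (max 1 \<bar>x\<bar>)) * indicator {0..} x \<partial>lborel) =
     (\<integral>\<^sup>+x. (\<Sum>k. ennreal (2 / (pi\<^sup>2 * real (2 * k + 1)) * (ln x / x ^ (2 * k + 2))) * indicator {1..} x) \<partial>lborel)"
  proof (rule nn_integral_cong_AE)
    have "AE x::real in lborel. x \<noteq> 1" by (rule AE_lborel_singleton)
    then show "AE x in lborel. ennreal (mu_R_density x) * ennreal (ln (max 1 \<bar>x\<bar>)) * indicator {0..} x =
       (\<Sum>k. ennreal (2 / (pi\<^sup>2 * real (2 * k + 1)) * (ln x / x ^ (2 * k + 2))) * indicator {1..} x)"
    proof eventually_elim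
      case (elim x)
      show ?case
      proof (cases "1 < x")
        case False
        then have "ln (max 1 \<bar>x\<bar>) = 0 \<or> x < 0" "\<not> 1 \<le> x" using elim by (auto simp: max_def)
        then show ?thesis by auto
      next
        case True
        have X: "((x + 1) / (x - 1) - 1) / ((x + 1) / (x - 1) + 1) = 1 / x"
          using True by (simp add: field_simps)
        have "(\<lambda>k. 2 * (1 / x) ^ (2 * k + 1) / of_nat (2 * k + 1)) sums ln ((x + 1) / (x - 1))"
          using ln_series_quadratic[of "(x + 1) / (x - 1)"] True unfolding X by simp
        from sums_mult[OF this, of "1 / (pi\<^sup>2 * x) * ln x"]
        have "(\<lambda>k. 1 / (pi\<^sup>2 * x) * ln x * (2 * (1 / x) ^ (2 * k + 1) / of_nat (2 * k + 1))) sums (mu_R_density x * ln x)"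
          using True by (simp add: mu_R_density_eq_ln mult_ac)
        also have "(\<lambda>k. 1 / (pi\<^sup>2 * x) * ln x * (2 * (1 / x) ^ (2 * k + 1) / of_nat (2 * k + 1))) =
           (\<lambda>k. 2 / (pi\<^sup>2 * real (2 * k + 1)) * (ln x / x ^ (2 * k + 2)))"
          using True by (simp add: power_one_over field_simps)
        finally have s: "(\<lambda>k. 2 / (pi\<^sup>2 * real (2 * k + 1)) * (ln x / x ^ (2 * k + 2))) sums (mu_R_density x * ln x)" .
        have "(\<Sum>k. ennreal (2 / (pi\<^sup>2 * real (2 * k + 1)) * (ln x / x ^ (2 * k + 2)))) = ennreal (mu_R_density x * ln x)"
          using s True by (intro suminf_ennreal_eq) auto
        then show ?thesis using True by (simp add: ennreal_mult'' max_def)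
      qed
    qed
  qed
  also have "\<dots> = (\<Sum>k. \<integral>\<^sup>+x. ennreal (2 / (pi\<^sup>2 * real (2 * k + 1)) * (ln x / x ^ (2 * k + 2))) * indicator {1..} x \<partial>lborel)"
    by (rule nn_integral_suminf) measurable
  also have "\<dots> = (\<Sum>k. ennreal (2 / pi\<^sup>2 * (1 / real (2 * k + 1) ^ 3)))"
  proof (rule suminf_cong)
    fix k :: nat
    define n where "n = 2 * k + 1"
    have n: "n > 0" by (simp add: n_def)
    have "(\<integral>\<^sup>+x. ennreal (2 / (pi\<^sup>2 * real n) * (ln x / x ^ (n + 1))) * indicator {1..} x \<partial>lborel) =
        ennreal (0 - - (2 / (pi\<^sup>2 * real n) * (ln 1 / (real n * 1 ^ n) + 1 / ((real n)\<^sup>2 * 1 ^ n))))"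
    proof (rule nn_integral_FTC_atLeast[where F = "\<lambda>x. - (2 / (pi\<^sup>2 * real n) * (ln x / (real n * x ^ n) + 1 / ((real n)\<^sup>2 * x ^ n)))"])
      show "((\<lambda>x. - (2 / (pi\<^sup>2 * real n) * (ln x / (real n * x ^ n) + 1 / ((real n)\<^sup>2 * x ^ n)))) has_real_derivative
          2 / (pi\<^sup>2 * real n) * (ln x / x ^ (n + 1))) (at x)" if "1 \<le> x" for x
      proof -
        have x: "x > 0" using that by simp
        have xn: "x ^ n = x * x ^ (n - 1)" using n by (cases n) auto
        define w where "w = x ^ (n - 1)"
        have w: "w > 0" using x by (simp add: w_def)
        have "((\<lambda>x. ln x / (real n * x ^ n) + 1 / ((real n)\<^sup>2 * x ^ n)) has_real_derivative
          - (ln x / x ^ (n + 1))) (at x)"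
          using x n w
          apply (auto intro!: derivative_eq_intros simp flip: w_def)
          apply (simp add: xn flip: w_def)
          apply (simp add: field_simps power2_eq_square)
          done
        from DERIV_minus[OF DERIV_cmult[OF this, of "2 / (pi\<^sup>2 * real n)"]] show ?thesis by simp
      qed
      show "((\<lambda>x. - (2 / (pi\<^sup>2 * real n) * (ln x / (real n * x ^ n) + 1 / ((real n)\<^sup>2 * x ^ n)))) \<longlongrightarrow> 0) at_top"
        using n by real_asymp
    qed auto
    then show "(\<integral>\<^sup>+x. ennreal (2 / (pi\<^sup>2 * real (2 * k + 1)) * (ln x / x ^ (2 * k + 2))) * indicator {1..} x \<partial>lborel) =
       ennreal (2 / pi\<^sup>2 * (1 / real (2 * k + 1) ^ 3))"
      by (simp add: n_def power2_eq_square power3_eq_cube mult_ac)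
  qed
  also have "\<dots> = ennreal (2 / pi\<^sup>2 * (7 / 8 * zeta3))"
    by (intro suminf_ennreal_eq sums_mult sums_odd_inverse_cubes) auto
  also have "2 * ennreal (2 / pi\<^sup>2 * (7 / 8 * zeta3)) = ennreal (2 * (2 / pi\<^sup>2 * (7 / 8 * zeta3)))"
    by (subst ennreal_mult') simp_all
  also have "2 * (2 / pi\<^sup>2 * (7 / 8 * zeta3)) = 7 * zeta3 / (2 * pi\<^sup>2)" by simp
  finally show "(\<integral>\<^sup>+x. ennreal (ln (max 1 \<bar>x\<bar>)) \<partial>mu_R) = ennreal (7 * zeta3 / (2 * pi\<^sup>2))" .
  have "0 \<le> 7 / 8 * zeta3"
    using sums_odd_inverse_cubes by (rule sums_le[OF _ sums_zero, rotated]) auto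
  then show "0 \<le> 7 * zeta3 / (2 * pi\<^sup>2)" by simp
qed auto

subsection \<open>The Fubini-Study kernel\<close>

lemma p1_rel_refl: "x \<noteq> 0 \<Longrightarrow> p1_rel x x"
  by (auto simp: p1_rel_def intro: exI[of _ 1])

lemma cp1_cases:
  obtains x where "x \<noteq> 0" "c = abs_cp1 x"
proof -
  have "p1_rel (rep_cp1 c) (rep_cp1 c)" using Quotient_rep_reflp[OF Quotient_cp1] .
  then have "rep_cp1 c \<noteq> 0" by (simp add: p1_rel_def)
  moreover have "c = abs_cp1 (rep_cp1 c)" using Quotient_abs_rep[OF Quotient_cp1] by simp
  ultimately show ?thesis using that by blast
qed

definition sqnorm2 :: "complex \<times> complex \<Rightarrow> real" where
  "sqnorm2 x = (cmod (fst x))\<^sup>2 + (cmod (snd x))\<^sup>2"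

lemma sqnorm2_pos: "x \<noteq> 0 \<Longrightarrow> 0 < sqnorm2 x"
  by (cases x) (auto simp: sqnorm2_def zero_prod_def intro: add_pos_nonneg add_nonneg_pos)

lemma one_minus_sqnorm2_ratio:
  assumes "z \<noteq> 0"
  shows "1 - (cmod (fst z))\<^sup>2 / sqnorm2 z = (cmod (snd z))\<^sup>2 / sqnorm2 z"
proof -
  have "1 - (cmod (fst z))\<^sup>2 / sqnorm2 z = (sqnorm2 z - (cmod (fst z))\<^sup>2) / sqnorm2 z"
    using sqnorm2_pos[OF assms] by (simp add: diff_divide_distrib)
  then show ?thesis by (simp add: sqnorm2_def)
qed

text \<open>Entries of the orthogonal projection onto the complex line x: a diagonal entry and an
  off-diagonal one. They determine the projection, since it is Hermitian with trace 1, and they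
  provide continuous, hence measurable, functions on the quotient.\<close>

lift_definition bloch :: "cp1 \<Rightarrow> real \<times> complex" is
  "\<lambda>x. ((cmod (fst x))\<^sup>2 / sqnorm2 x, fst x * cnj (snd x) / of_real (sqnorm2 x))"
proof -
  fix x y assume "p1_rel x y"
  then obtain c where c: "x \<noteq> 0" "c \<noteq> 0" "fst y = c * fst x" "snd y = c * snd x"
    by (auto simp: p1_rel_def)
  have N: "sqnorm2 y = (cmod c)\<^sup>2 * sqnorm2 x"
    using c by (simp add: sqnorm2_def norm_mult power_mult_distrib algebra_simps)
  have e: "fst y * cnj (snd y) = of_real ((cmod c)\<^sup>2) * (fst x * cnj (snd x))"
    using c complex_norm_square[of c] by auto
  have "fst y * cnj (snd y) / of_real (sqnorm2 y) = fst x * cnj (snd x) / of_real (sqnorm2 x)"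
    unfolding e N of_real_mult using c(2) by (subst mult_divide_mult_cancel_left) auto
  moreover have "(cmod (fst y))\<^sup>2 / sqnorm2 y = (cmod (fst x))\<^sup>2 / sqnorm2 x"
    unfolding N using c by (simp add: norm_mult power_mult_distrib)
  ultimately show "((cmod (fst x))\<^sup>2 / sqnorm2 x, fst x * cnj (snd x) / of_real (sqnorm2 x)) =
     ((cmod (fst y))\<^sup>2 / sqnorm2 y, fst y * cnj (snd y) / of_real (sqnorm2 y))"
    by simp
qed

lemma bloch_abs: "x \<noteq> 0 \<Longrightarrow>
    bloch (abs_cp1 x) = ((cmod (fst x))\<^sup>2 / sqnorm2 x, fst x * cnj (snd x) / of_real (sqnorm2 x))"
  by (simp add: bloch.abs_eq p1_rel_refl)

lemma continuous_on_bloch: "continuous_on UNIV bloch"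
proof (rule continuous_on_open_vimage[THEN iffD2])
  show "open (UNIV :: cp1 set)" by simp
  show "\<forall>B. open B \<longrightarrow> open (bloch -` B \<inter> UNIV)"
  proof (intro allI impI)
    fix B :: "(real \<times> complex) set" assume B: "open B"
    let ?f = "\<lambda>x. ((cmod (fst x))\<^sup>2 / sqnorm2 x, fst x * cnj (snd x) / of_real (sqnorm2 x))"
    have "{x. x \<noteq> 0 \<and> abs_cp1 x \<in> bloch -` B \<inter> UNIV} = ?f -` B \<inter> (- {0})"
      by (auto simp: bloch_abs)
    moreover have "open (?f -` B \<inter> (- {0}))"
    proof -
      have nz: "(cmod (fst x))\<^sup>2 + (cmod (snd x))\<^sup>2 \<noteq> 0" if "x \<noteq> 0" for x
        using sqnorm2_pos[OF that] unfolding sqnorm2_def by linarith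
      have "continuous_on (- {0}) ?f"
        unfolding sqnorm2_def
        by (intro continuous_intros ballI)
           (simp_all only: of_real_eq_0_iff Compl_iff insert_iff empty_iff simp_thms nz)
      moreover have "open (- {0 :: complex \<times> complex})" by auto
      ultimately show ?thesis using B continuous_on_open_vimage by blast
    qed
    ultimately show "open (bloch -` B \<inter> UNIV)" unfolding open_cp1_def by simp
  qed
qed

lemma bloch_measurable [measurable]:
  "(\<lambda>c. fst (bloch c)) \<in> borel_measurable borel" "(\<lambda>c. snd (bloch c)) \<in> borel_measurable borel"
  by (rule borel_measurable_continuous_onI[OF continuous_on_fst[OF continuous_on_bloch]]
      borel_measurable_continuous_onI[OF continuous_on_snd[OF continuous_on_bloch]])+

lemma cp1_of_complex_measurable [measurable]: "cp1_of_complex \<in> borel_measurable borel"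
proof (rule borel_measurable_continuous_onI, rule continuous_on_open_vimage[THEN iffD2])
  show "\<forall>B. open B \<longrightarrow> open (cp1_of_complex -` B \<inter> UNIV)"
  proof (intro allI impI)
    fix B :: "cp1 set" assume "open B"
    then have "open {x. x \<noteq> 0 \<and> abs_cp1 x \<in> B}" by (simp add: open_cp1_def)
    then have "open ((\<lambda>z. (z, 1)) -` {x. x \<noteq> 0 \<and> abs_cp1 x \<in> B} \<inter> UNIV)"
      by (rule continuous_on_open_vimage[THEN iffD1, rule_format, rotated 2])
         (auto intro!: continuous_intros)
    moreover have "(\<lambda>z. (z, 1)) -` {x. x \<noteq> 0 \<and> abs_cp1 x \<in> B} \<inter> UNIV = cp1_of_complex -` B \<inter> UNIV"
      by (auto simp: cp1_of_complex.abs_eq zero_prod_def)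
    ultimately show "open (cp1_of_complex -` B \<inter> UNIV)" by simp
  qed
qed simp

text \<open>The projection as a vector in R^4. The factors sqrt 2 account for the two off-diagonal
  entries, so that the Euclidean inner product is the trace of the product of two
  projections.\<close>

definition fs_feature :: "nat \<Rightarrow> cp1 \<Rightarrow> real" where
  "fs_feature k c = (if k = 0 then fst (bloch c) else if k = 1 then 1 - fst (bloch c)
     else if k = 2 then sqrt 2 * Re (snd (bloch c)) else sqrt 2 * Im (snd (bloch c)))"

definition fs_kernel :: "cp1 \<Rightarrow> cp1 \<Rightarrow> real" where
  "fs_kernel c d = (\<Sum>k<4. fs_feature k c * fs_feature k d)"

text \<open>The squared quotient of the maximum norm by the Euclidean norm of a representative. Half
  its logarithm converts the chordal distance into delta, one term for each argument.\<close>

definition max_weight :: "cp1 \<Rightarrow> real" where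
  "max_weight c = max (fst (bloch c)) (1 - fst (bloch c))"

lemma sum_lessThan_4: "(\<Sum>k<4. f k) = f 0 + f 1 + f 2 + f (3::nat)"
  for f :: "nat \<Rightarrow> 'a::comm_monoid_add"
  by (simp add: eval_nat_numeral add_ac)

lemma fs_feature_measurable [measurable]: "fs_feature k \<in> borel_measurable borel"
  unfolding fs_feature_def by measurable

lemma max_weight_measurable [measurable]: "max_weight \<in> borel_measurable borel"
  unfolding max_weight_def by measurable

lemma fs_kernel_measurable [measurable]:
  assumes [measurable]: "f \<in> measurable M borel" "g \<in> measurable M borel"
  shows "(\<lambda>x. fs_kernel (f x) (g x)) \<in> borel_measurable M"
  unfolding fs_kernel_def by measurable

text \<open>With unit vectors representing \<open>c\<close> and \<open>d\<close>, the kernel is \<open>|\<langle>c, d\<rangle>|\<^sup>2\<close>.\<close>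

lemma one_minus_fs_kernel:
  assumes x: "x \<noteq> 0" and y: "y \<noteq> 0"
  shows "1 - fs_kernel (abs_cp1 x) (abs_cp1 y) =
     (cmod (fst x * snd y - fst y * snd x))\<^sup>2 / (sqnorm2 x * sqnorm2 y)"
proof -
  define M N where "M = sqnorm2 x" and "N = sqnorm2 y"
  have MN: "M > 0" "N > 0" using sqnorm2_pos x y by (auto simp: M_def N_def)
  obtain a b where xab: "x = (a, b)" by (cases x)
  obtain c d where ycd: "y = (c, d)" by (cases y)
  have M': "M = (cmod a)\<^sup>2 + (cmod b)\<^sup>2" and N': "N = (cmod c)\<^sup>2 + (cmod d)\<^sup>2"
    by (simp_all add: M_def N_def sqnorm2_def xab ycd)
  have q: "1 - (cmod a)\<^sup>2 / M = (cmod b)\<^sup>2 / M" "1 - (cmod c)\<^sup>2 / N = (cmod d)\<^sup>2 / N"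
    using one_minus_sqnorm2_ratio[OF x] one_minus_sqnorm2_ratio[OF y]
    by (simp_all add: xab ycd M_def N_def)
  have s2: "sqrt 2 * u * (sqrt 2 * v) = 2 * u * v" for u v :: real
    using real_sqrt_mult_self[of 2] by (simp add: mult_ac)
  have "fs_kernel (abs_cp1 x) (abs_cp1 y) =
      (cmod a)\<^sup>2 / M * ((cmod c)\<^sup>2 / N) + (cmod b)\<^sup>2 / M * ((cmod d)\<^sup>2 / N)
      + 2 * (Re (a * cnj b) / M) * (Re (c * cnj d) / N) + 2 * (Im (a * cnj b) / M) * (Im (c * cnj d) / N)"
    unfolding fs_kernel_def fs_feature_def
    using x y by (simp add: bloch_abs sum_lessThan_4 s2 q xab ycd flip: M_def[unfolded xab] N_def[unfolded ycd])
  also have "\<dots> = ((cmod a)\<^sup>2 * (cmod c)\<^sup>2 + (cmod b)\<^sup>2 * (cmod d)\<^sup>2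
      + 2 * Re (a * cnj b) * Re (c * cnj d) + 2 * Im (a * cnj b) * Im (c * cnj d)) / (M * N)"
  proof -
    have "A / M * (C / N) + B / M * (D / N) + 2 * (R / M) * (R' / N) + 2 * (I / M) * (I' / N) =
       (A * C + B * D + 2 * R * R' + 2 * I * I') / (M * N)" for A B C D R R' I I'
      by (simp add: add_divide_distrib)
    then show ?thesis .
  qed
  also have "(cmod a)\<^sup>2 * (cmod c)\<^sup>2 + (cmod b)\<^sup>2 * (cmod d)\<^sup>2
      + 2 * Re (a * cnj b) * Re (c * cnj d) + 2 * Im (a * cnj b) * Im (c * cnj d) =
      M * N - (cmod (a * d - c * b))\<^sup>2"
    unfolding M' N' cmod_power2 by (simp add: power2_eq_square algebra_simps)
  also have "(M * N - (cmod (a * d - c * b))\<^sup>2) / (M * N) = 1 - (cmod (a * d - c * b))\<^sup>2 / (M * N)"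
    using MN by (simp add: diff_divide_distrib)
  finally show ?thesis by (simp add: xab ycd M_def N_def)
qed

lemma fs_kernel_le_1: "fs_kernel c d \<le> 1"
proof -
  obtain x where x: "x \<noteq> 0" "c = abs_cp1 x" by (rule cp1_cases)
  obtain y where y: "y \<noteq> 0" "d = abs_cp1 y" by (rule cp1_cases)
  have "0 \<le> 1 - fs_kernel c d"
    unfolding x(2) y(2) one_minus_fs_kernel[OF x(1) y(1)]
    using sqnorm2_pos[OF x(1)] sqnorm2_pos[OF y(1)] by simp
  then show ?thesis by simp
qed

lemma bloch_fst_bounds: "0 \<le> fst (bloch c)" "fst (bloch c) \<le> 1"
proof -
  obtain x where x: "x \<noteq> 0" "c = abs_cp1 x" by (rule cp1_cases)
  show "0 \<le> fst (bloch c)" "fst (bloch c) \<le> 1"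
    using sqnorm2_pos[OF x(1)] by (auto simp: x bloch_abs divide_le_eq_1) (simp add: sqnorm2_def)
qed

lemma max_weight_bounds: "1 / 2 \<le> max_weight c" "max_weight c \<le> 1"
  using bloch_fst_bounds[of c] by (auto simp: max_weight_def max_def)

lemma bloch_snd_sq: "(cmod (snd (bloch c)))\<^sup>2 = fst (bloch c) * (1 - fst (bloch c))"
proof -
  obtain x where x: "x \<noteq> 0" "c = abs_cp1 x" by (rule cp1_cases)
  note q = one_minus_sqnorm2_ratio[OF x(1)]
  show ?thesis using sqnorm2_pos[OF x(1)]
    by (simp add: x bloch_abs q norm_divide norm_mult power_divide power_mult_distrib power2_eq_square[of "sqnorm2 x"])
qed

lemma abs_fs_feature_le: "\<bar>fs_feature k c\<bar> \<le> 2"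
proof -
  have "(cmod (snd (bloch c)))\<^sup>2 \<le> 1\<^sup>2"
    unfolding bloch_snd_sq using bloch_fst_bounds[of c] by (simp add: mult_le_one)
  then have "cmod (snd (bloch c)) \<le> 1" by (rule power2_le_imp_le) simp
  then have "\<bar>Re (snd (bloch c))\<bar> \<le> 1" "\<bar>Im (snd (bloch c))\<bar> \<le> 1"
    using abs_Re_le_cmod[of "snd (bloch c)"] abs_Im_le_cmod[of "snd (bloch c)"] by linarith+
  moreover have "\<bar>sqrt 2 * u\<bar> \<le> 2" if "\<bar>u\<bar> \<le> 1" for u
  proof -
    have "sqrt 2 * \<bar>u\<bar> \<le> 2 * 1" using that sqrt2_less_2 by (intro mult_mono) auto
    then show ?thesis by (simp add: abs_mult)
  qed
  ultimately show ?thesis using bloch_fst_bounds[of c] by (auto simp: fs_feature_def)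
qed

lemma fs_kernel_nonneg: "0 \<le> fs_kernel c d"
proof -
  define p q u v where "p = fst (bloch c)" and "q = fst (bloch d)" and "u = snd (bloch c)" and "v = snd (bloch d)"
  have pq: "0 \<le> p" "p \<le> 1" "0 \<le> q" "q \<le> 1" using bloch_fst_bounds by (auto simp: p_def q_def)
  have uv: "(cmod u)\<^sup>2 = p * (1 - p)" "(cmod v)\<^sup>2 = q * (1 - q)"
    by (auto simp: bloch_snd_sq p_def q_def u_def v_def)
  have s2: "sqrt 2 * r * (sqrt 2 * s) = 2 * r * s" for r s :: real
    using real_sqrt_mult_self[of 2] by (simp add: mult_ac)
  have "fs_kernel c d = p * q + (1 - p) * (1 - q) + 2 * Re (u * cnj v)"
    unfolding fs_kernel_def fs_feature_def
    by (simp add: sum_lessThan_4 s2 flip: p_def q_def u_def v_def)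
  moreover have "\<bar>Re (u * cnj v)\<bar> \<le> cmod u * cmod v"
    using abs_Re_le_cmod[of "u * cnj v"] by (simp add: norm_mult)
  \<comment> \<open>Inequality of arithmetic and geometric means for p q and (1 - p) (1 - q), whose
    product is |u|^2 |v|^2.\<close>
  moreover have "2 * (cmod u * cmod v) \<le> p * q + (1 - p) * (1 - q)"
  proof (rule power2_le_imp_le)
    have "(2 * (cmod u * cmod v))\<^sup>2 = 4 * ((p * q) * ((1 - p) * (1 - q)))"
      by (simp add: power_mult_distrib uv)
    also have "\<dots> \<le> (p * q + (1 - p) * (1 - q))\<^sup>2"
      using zero_le_power2[of "p * q - (1 - p) * (1 - q)"] by (simp add: power2_eq_square algebra_simps)
    finally show "(2 * (cmod u * cmod v))\<^sup>2 \<le> (p * q + (1 - p) * (1 - q))\<^sup>2" .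
  qed (use pq in simp)
  ultimately show ?thesis by linarith
qed

lemma delta_sq: "(delta c d)\<^sup>2 = (1 - fs_kernel c d) / (max_weight c * max_weight d)"
proof -
  obtain x where x: "x \<noteq> 0" "c = abs_cp1 x" by (rule cp1_cases)
  obtain y where y: "y \<noteq> 0" "d = abs_cp1 y" by (rule cp1_cases)
  have mw: "max_weight (abs_cp1 z) = (max (cmod (fst z)) (cmod (snd z)))\<^sup>2 / sqnorm2 z" if z: "z \<noteq> 0" for z
  proof -
    note q = one_minus_sqnorm2_ratio[OF z]
    have "(max (cmod (fst z)) (cmod (snd z)))\<^sup>2 = max ((cmod (fst z))\<^sup>2) ((cmod (snd z))\<^sup>2)"
      by (auto simp: max_def power_mono)
    then show ?thesis using z sqnorm2_pos[OF z]
      by (simp add: max_weight_def bloch_abs q max_divide_distrib_right)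
  qed
  have "(delta c d)\<^sup>2 = (cmod (fst x * snd y - fst y * snd x))\<^sup>2 /
      ((max (cmod (fst x)) (cmod (snd x)))\<^sup>2 * (max (cmod (fst y)) (cmod (snd y)))\<^sup>2)"
    using x y by (simp add: delta.abs_eq p1_rel_refl power_divide power_mult_distrib)
  also have "\<dots> = (1 - fs_kernel c d) / (max_weight c * max_weight d)"
    unfolding x(2) y(2) mw[OF x(1)] mw[OF y(1)] one_minus_fs_kernel[OF x(1) y(1)]
    using sqnorm2_pos[OF x(1)] sqnorm2_pos[OF y(1)] by simp
  finally show ?thesis .
qed

lemma neg_log_delta_eq:
  assumes "fs_kernel c d < 1"
  shows "neg_log_delta c d = ereal (- ln (1 - fs_kernel c d) / 2 + ln (max_weight c) / 2 + ln (max_weight d) / 2)"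
proof -
  have m: "max_weight c > 0" "max_weight d > 0" using max_weight_bounds(1)[of c] max_weight_bounds(1)[of d] by linarith+
  have pos: "(delta c d)\<^sup>2 > 0" unfolding delta_sq using assms m by simp
  have "delta c d \<ge> 0" by transfer (auto intro!: divide_nonneg_nonneg mult_nonneg_nonneg simp: le_max_iff_disj)
  with pos have d: "delta c d > 0" by (simp add: less_le)
  have "2 * ln (delta c d) = ln ((delta c d)\<^sup>2)" using d by (simp add: ln_realpow)
  also have "\<dots> = ln (1 - fs_kernel c d) - (ln (max_weight c) + ln (max_weight d))"
    unfolding delta_sq using assms m by (simp add: ln_divide_pos ln_mult_pos)
  finally show ?thesis using d by (simp add: neg_log_delta_def)
qed

lemma neg_log_delta_infinite:
  assumes "fs_kernel c d = 1"
  shows "neg_log_delta c d = \<infinity>"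
  using delta_sq[of c d] assms by (simp add: neg_log_delta_def)

subsection \<open>Positive semidefiniteness of the energy\<close>

text \<open>Against probability measures such kernels have finite iterated integrals, so mutual
  energies can be added and subtracted as real numbers. Measurability is with respect to the product
  sigma-algebra, the one used by Fubini's theorem.\<close>

definition bounded_kernel :: "(cp1 \<Rightarrow> cp1 \<Rightarrow> real) \<Rightarrow> bool" where
  "bounded_kernel k \<longleftrightarrow> (\<lambda>(x, y). k x y) \<in> borel_measurable (borel \<Otimes>\<^sub>M borel) \<and> (\<exists>B. \<forall>x y. \<bar>k x y\<bar> \<le> B)"

definition borel_prob :: "cp1 measure \<Rightarrow> bool" where
  "borel_prob M \<longleftrightarrow> prob_space M \<and> sets M = sets borel"

definition mutual_energy :: "cp1 measure \<Rightarrow> cp1 measure \<Rightarrow> (cp1 \<Rightarrow> cp1 \<Rightarrow> real) \<Rightarrow> real" where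
  "mutual_energy M N k = (\<integral>y. (\<integral>x. k x y \<partial>M) \<partial>N)"

lemma bounded_kernelI:
  assumes "(\<lambda>(x, y). k x y) \<in> borel_measurable (borel \<Otimes>\<^sub>M borel)" "\<And>x y. \<bar>k x y\<bar> \<le> B"
  shows "bounded_kernel k"
  using assms by (auto simp: bounded_kernel_def)

lemma bounded_kernel_measurable1:
  assumes "bounded_kernel k" "borel_prob M"
  shows "(\<lambda>x. k x y) \<in> borel_measurable M"
proof -
  have [measurable]: "(\<lambda>(x, y). k x y) \<in> borel_measurable (borel \<Otimes>\<^sub>M borel)" and s: "sets M = sets borel"
    using assms by (auto simp: bounded_kernel_def borel_prob_def)
  have "(\<lambda>x. case (x, y) of (x, y) \<Rightarrow> k x y) \<in> borel_measurable borel"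
    by measurable
  then show ?thesis by (simp add: measurable_cong_sets[OF s refl])
qed

lemma bounded_kernel_integrable1:
  assumes "bounded_kernel k" "borel_prob M"
  shows "integrable M (\<lambda>x. k x y)"
proof -
  obtain B where B: "\<forall>x y. \<bar>k x y\<bar> \<le> B" using assms by (auto simp: bounded_kernel_def)
  interpret prob_space M using assms by (simp add: borel_prob_def)
  from B show ?thesis
    using bounded_kernel_measurable1[OF assms] by (intro integrable_const_bound[of _ B]) auto
qed

lemma bounded_kernel_inner_measurable:
  assumes "bounded_kernel k" "borel_prob M"
  shows "(\<lambda>y. \<integral>x. k x y \<partial>M) \<in> borel_measurable borel"
proof -
  interpret prob_space M using assms by (simp add: borel_prob_def)
  have s: "sets M = sets borel" using assms by (simp add: borel_prob_def)
  have m: "(\<lambda>(x, y). k x y) \<in> borel_measurable (borel \<Otimes>\<^sub>M borel)"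
    using assms by (simp add: bounded_kernel_def)
  have "(\<lambda>p. (\<lambda>(x, y). k x y) (snd p, fst p)) \<in> borel_measurable (borel \<Otimes>\<^sub>M M)"
    by (rule measurable_compose[OF _ m]) (auto simp: s intro!: measurable_Pair measurable_compose[OF measurable_snd] simp: measurable_cong_sets[OF sets_pair_measure_cong[OF refl s] refl])
  then show ?thesis
    by (intro borel_measurable_lebesgue_integral) (simp add: split_beta')
qed

lemma bounded_kernel_integrable2:
  assumes k: "bounded_kernel k" and M: "borel_prob M" and N: "borel_prob N"
  shows "integrable N (\<lambda>y. \<integral>x. k x y \<partial>M)"
proof -
  obtain B where B: "\<forall>x y. \<bar>k x y\<bar> \<le> B" using k by (auto simp: bounded_kernel_def)
  interpret M: prob_space M using M by (simp add: borel_prob_def)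
  interpret N: prob_space N using N by (simp add: borel_prob_def)
  have "\<bar>\<integral>x. k x y \<partial>M\<bar> \<le> B" for y
  proof -
    have "norm (\<integral>x. k x y \<partial>M) \<le> (\<integral>x. norm (k x y) \<partial>M)" by (rule integral_norm_bound)
    also have "\<dots> \<le> (\<integral>x. B \<partial>M)"
      using B bounded_kernel_integrable1[OF k M] by (intro integral_mono) auto
    finally show ?thesis by (simp add: M.prob_space)
  qed
  moreover have "(\<lambda>y. \<integral>x. k x y \<partial>M) \<in> borel_measurable N"
    using bounded_kernel_inner_measurable[OF k M] N
    by (simp add: borel_prob_def cong: measurable_cong_sets)
  ultimately show ?thesis by (intro N.integrable_const_bound[of _ B]) auto
qed

lemma bounded_kernel_add:
  assumes "bounded_kernel k" "bounded_kernel l"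
  shows "bounded_kernel (\<lambda>x y. k x y + l x y)"
proof -
  obtain B C where "\<forall>x y. \<bar>k x y\<bar> \<le> B" "\<forall>x y. \<bar>l x y\<bar> \<le> C" using assms by (auto simp: bounded_kernel_def)
  then have "\<bar>k x y + l x y\<bar> \<le> B + C" for x y
    by (meson abs_triangle_ineq add_mono order_trans)
  moreover have "(\<lambda>(x, y). k x y + l x y) \<in> borel_measurable (borel \<Otimes>\<^sub>M borel)"
    using assms borel_measurable_add[of "\<lambda>(x, y). k x y" _ "\<lambda>(x, y). l x y"]
    by (auto simp: bounded_kernel_def split_beta')
  ultimately show ?thesis by (rule bounded_kernelI[rotated])
qed

lemma bounded_kernel_mult:
  assumes "bounded_kernel k" "bounded_kernel l"
  shows "bounded_kernel (\<lambda>x y. k x y * l x y)"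
proof -
  obtain B C where BC: "\<forall>x y. \<bar>k x y\<bar> \<le> B" "\<forall>x y. \<bar>l x y\<bar> \<le> C" using assms by (auto simp: bounded_kernel_def)
  then have "\<bar>k x y * l x y\<bar> \<le> B * C" for x y
    unfolding abs_mult by (intro mult_mono) (auto intro: order_trans[OF abs_ge_zero])
  moreover have "(\<lambda>(x, y). k x y * l x y) \<in> borel_measurable (borel \<Otimes>\<^sub>M borel)"
    using assms borel_measurable_times[of "\<lambda>(x, y). k x y" _ "\<lambda>(x, y). l x y"]
    by (auto simp: bounded_kernel_def split_beta')
  ultimately show ?thesis by (rule bounded_kernelI[rotated])
qed

lemma bounded_kernel_const: "bounded_kernel (\<lambda>x y. c)"
  by (rule bounded_kernelI[of _ "\<bar>c\<bar>"]) auto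

lemma bounded_kernel_power: "bounded_kernel k \<Longrightarrow> bounded_kernel (\<lambda>x y. k x y ^ n)"
  by (induction n) (auto intro: bounded_kernel_const bounded_kernel_mult)

lemma bounded_kernel_sum:
  "(\<And>i. i \<in> I \<Longrightarrow> bounded_kernel (k i)) \<Longrightarrow> bounded_kernel (\<lambda>x y. \<Sum>i\<in>I. k i x y)"
  by (induction I rule: infinite_finite_induct) (auto intro: bounded_kernel_const bounded_kernel_add)

lemma bounded_kernel_left: "a \<in> borel_measurable borel \<Longrightarrow> (\<And>x. \<bar>a x\<bar> \<le> B) \<Longrightarrow> bounded_kernel (\<lambda>x y. a x)"
  by (rule bounded_kernelI[of _ B]) auto

lemma bounded_kernel_right: "a \<in> borel_measurable borel \<Longrightarrow> (\<And>x. \<bar>a x\<bar> \<le> B) \<Longrightarrow> bounded_kernel (\<lambda>x y. a y)"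
  by (rule bounded_kernelI[of _ B]) auto

lemma bounded_kernel_fs: "bounded_kernel fs_kernel"
  by (rule bounded_kernelI[of _ 1]) (auto simp: fs_kernel_nonneg fs_kernel_le_1 split_beta')

context
  fixes M N :: "cp1 measure"
  assumes M: "borel_prob M" and N: "borel_prob N"
begin

lemma mutual_energy_mono:
  assumes k: "bounded_kernel k" "bounded_kernel l" "\<And>x y. k x y \<le> l x y"
  shows "mutual_energy M N k \<le> mutual_energy M N l"
  unfolding mutual_energy_def
  using assms M N by (intro integral_mono bounded_kernel_integrable1 bounded_kernel_integrable2) auto

lemma mutual_energy_add:
  assumes "bounded_kernel k" "bounded_kernel l"
  shows "mutual_energy M N (\<lambda>x y. k x y + l x y) = mutual_energy M N k + mutual_energy M N l"
  unfolding mutual_energy_def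
  using assms M N by (simp add: bounded_kernel_integrable1 bounded_kernel_integrable2)

lemma mutual_energy_cmult: "mutual_energy M N (\<lambda>x y. c * k x y) = c * mutual_energy M N k"
  unfolding mutual_energy_def by simp

lemma mutual_energy_sum:
  assumes "\<And>i. i \<in> I \<Longrightarrow> bounded_kernel (k i)"
  shows "mutual_energy M N (\<lambda>x y. \<Sum>i\<in>I. k i x y) = (\<Sum>i\<in>I. mutual_energy M N (k i))"
  using assms
proof (induction I rule: infinite_finite_induct)
  case (insert i I)
  then show ?case by (simp add: mutual_energy_add bounded_kernel_sum)
qed (simp_all add: mutual_energy_def)

lemma mutual_energy_const: "mutual_energy M N (\<lambda>x y. c) = c"
proof -
  interpret M: prob_space M using M by (simp add: borel_prob_def)
  interpret N: prob_space N using N by (simp add: borel_prob_def)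
  show ?thesis by (simp add: mutual_energy_def M.prob_space N.prob_space)
qed

lemma mutual_energy_left: "mutual_energy M N (\<lambda>x y. a x) = (\<integral>x. a x \<partial>M)"
proof -
  interpret N: prob_space N using N by (simp add: borel_prob_def)
  show ?thesis by (simp add: mutual_energy_def N.prob_space)
qed

lemma mutual_energy_right: "mutual_energy M N (\<lambda>x y. a y) = (\<integral>x. a x \<partial>N)"
proof -
  interpret M: prob_space M using M by (simp add: borel_prob_def)
  show ?thesis by (simp add: mutual_energy_def M.prob_space)
qed

lemma mutual_energy_commute:
  assumes k: "bounded_kernel k" and sym: "\<And>x y. k x y = k y x"
  shows "mutual_energy M N k = mutual_energy N M k"
proof -
  interpret M: prob_space M using M by (simp add: borel_prob_def)
  interpret N: prob_space N using N by (simp add: borel_prob_def)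
  interpret P: pair_prob_space M N ..
  have s: "sets (M \<Otimes>\<^sub>M N) = sets (borel \<Otimes>\<^sub>M borel)"
    using M N by (intro sets_pair_measure_cong) (auto simp: borel_prob_def)
  obtain B where B: "\<forall>x y. \<bar>k x y\<bar> \<le> B" using k by (auto simp: bounded_kernel_def)
  have "integrable (M \<Otimes>\<^sub>M N) (\<lambda>(x, y). k x y)"
    using k B by (intro P.integrable_const_bound[of _ B])
      (auto simp: bounded_kernel_def measurable_cong_sets[OF s refl])
  from P.Fubini_integral[OF this] show ?thesis
    unfolding mutual_energy_def by (subst (2) sym) simp
qed

end

text \<open>The quadratic form of the kernel at the signed measure M - N, expanded into its four
  terms.\<close>

definition energy_diff :: "cp1 measure \<Rightarrow> cp1 measure \<Rightarrow> (cp1 \<Rightarrow> cp1 \<Rightarrow> real) \<Rightarrow> real" where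
  "energy_diff M N k = mutual_energy M M k - mutual_energy M N k - mutual_energy N M k + mutual_energy N N k"

text \<open>The kernel is a finite sum of products \<open>\<phi>\<^sub>k(x) \<phi>\<^sub>k(y)\<close>, so one factor of its power can be
  absorbed into the weight \<open>a\<close>.\<close>

lemma energy_diff_fs_power_nonneg:
  assumes M: "borel_prob M" and N: "borel_prob N"
    and a: "a \<in> borel_measurable borel" "\<And>x. \<bar>a x\<bar> \<le> B"
  shows "0 \<le> energy_diff M N (\<lambda>x y. a x * a y * fs_kernel x y ^ n)"
  using a
proof (induction n arbitrary: a B)
  case 0
  have "energy_diff M N (\<lambda>x y. a x * a y * fs_kernel x y ^ 0) = ((\<integral>x. a x \<partial>M) - (\<integral>x. a x \<partial>N))\<^sup>2"
    by (simp add: energy_diff_def mutual_energy_def power2_eq_square algebra_simps)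
  then show ?case by simp
next
  case (Suc n)
  define b where "b i x = a x * fs_feature i x" for i x
  have b: "b i \<in> borel_measurable borel" "\<bar>b i x\<bar> \<le> B * 2" for i x
    using Suc.prems abs_fs_feature_le[of i x] unfolding b_def abs_mult
    by (auto intro!: mult_mono intro: order_trans[OF abs_ge_zero])
  have bk: "bounded_kernel (\<lambda>x y. b i x * b i y * fs_kernel x y ^ n)" for i
    using b by (intro bounded_kernel_mult bounded_kernel_power bounded_kernel_fs
        bounded_kernel_left bounded_kernel_right) auto
  have "(\<lambda>x y. a x * a y * fs_kernel x y ^ Suc n) = (\<lambda>x y. \<Sum>i<4. b i x * b i y * fs_kernel x y ^ n)"
    by (intro ext) (simp add: fs_kernel_def[of _ _] b_def sum_distrib_left sum_distrib_right mult_ac)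
  then have "energy_diff M N (\<lambda>x y. a x * a y * fs_kernel x y ^ Suc n) =
     (\<Sum>i<4. energy_diff M N (\<lambda>x y. b i x * b i y * fs_kernel x y ^ n))"
    unfolding energy_diff_def using M N bk
    by (simp add: mutual_energy_sum sum.distrib sum_subtractf)
  also have "\<dots> \<ge> 0" using b by (intro sum_nonneg Suc.IH) auto
  finally show ?case .
qed

text \<open>For r -> 1 this increases to -log sin^2, twice the singular part of the kernel. For r <
  1 it is bounded, and it is a power series in \<open>fs_kernel\<close> with non-negative
  coefficients.\<close>

definition log_kernel :: "real \<Rightarrow> cp1 \<Rightarrow> cp1 \<Rightarrow> real" where
  "log_kernel r x y = - ln (1 - r * fs_kernel x y)"

lemma r_fs_bounds: "0 \<le> r \<Longrightarrow> r < 1 \<Longrightarrow> 0 \<le> r * fs_kernel x y \<and> r * fs_kernel x y \<le> r"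
  using fs_kernel_nonneg[of x y] fs_kernel_le_1[of x y] by (auto simp: mult_left_le)

lemma bounded_kernel_log:
  assumes r: "0 \<le> r" "r < 1"
  shows "bounded_kernel (log_kernel r)"
proof (rule bounded_kernelI[of _ "- ln (1 - r)"])
  show "(\<lambda>(x, y). log_kernel r x y) \<in> borel_measurable (borel \<Otimes>\<^sub>M borel)"
    unfolding log_kernel_def split_beta' by measurable
  fix x y
  have "1 - r \<le> 1 - r * fs_kernel x y" "1 - r * fs_kernel x y \<le> 1" "1 - r > 0"
    using r_fs_bounds[OF r, of x y] r by auto
  then have "ln (1 - r) \<le> ln (1 - r * fs_kernel x y)" "ln (1 - r * fs_kernel x y) \<le> 0"
    by (auto intro!: ln_mono)
  then show "\<bar>log_kernel r x y\<bar> \<le> - ln (1 - r)" by (simp add: log_kernel_def)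
qed

text \<open>The error term does not depend on x and y, so it passes through integration against
  probability measures and the limit over m needs no convergence theorem.\<close>

lemma log_kernel_series_bounds:
  assumes r: "0 \<le> r" "r < 1"
  shows "(\<Sum>n<m. r ^ Suc n / Suc n * fs_kernel x y ^ Suc n) \<le> log_kernel r x y"
    and "log_kernel r x y \<le> (\<Sum>n<m. r ^ Suc n / Suc n * fs_kernel x y ^ Suc n) + r ^ m * (r / (1 - r))"
proof -
  define t where "t = r * fs_kernel x y"
  have t: "0 \<le> t" "t \<le> r" "t < 1" using r_fs_bounds[OF r, of x y] r by (auto simp: t_def)
  have dle: "a / real (Suc k) \<le> a" if "0 \<le> a" for a k
    using divide_left_mono[of 1 "real (Suc k)" a] that by simp
  have s: "(\<lambda>n. t ^ Suc n / Suc n) sums (- ln (1 - t))"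
  proof -
    have "(\<lambda>n. - ((- 1) ^ n * (1 - t - 1) ^ Suc n * (1 / real (n + 1)))) sums (- ln (1 - t))"
    proof (intro sums_minus)
      have "summable (\<lambda>n. (- 1) ^ n * (1 - t - 1) ^ Suc n * (1 / real (n + 1)))"
      proof (rule summable_comparison_test'[of "\<lambda>n. t ^ Suc n" 0])
        show "summable (\<lambda>n. t ^ Suc n)" using t by (simp add: summable_geometric summable_mult)
        show "norm ((- 1) ^ n * (1 - t - 1) ^ Suc n * (1 / real (n + 1))) \<le> t ^ Suc n" for n
          using t dle[of "t ^ Suc n" n] by (simp add: abs_mult power_abs)
      qed
      then show "(\<lambda>n. (- 1) ^ n * (1 - t - 1) ^ Suc n * (1 / real (n + 1))) sums ln (1 - t)"
        using ln_series[of "1 - t"] t by (cases "t = 0") (auto simp: sums_iff mult_ac)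
    qed
    moreover have "- ((- 1) ^ n * (1 - t - 1) ^ Suc n * (1 / real (n + 1))) = t ^ Suc n / Suc n" for n
    proof -
      have "(- 1) ^ n * (- t) ^ Suc n = - (t ^ Suc n)" by (induction n) auto
      then show ?thesis by (simp del: power_Suc)
    qed
    ultimately show ?thesis by (simp only:)
  qed
  have eq: "r ^ Suc n / Suc n * fs_kernel x y ^ Suc n = t ^ Suc n / Suc n" for n
    by (simp add: t_def power_mult_distrib)
  have L: "log_kernel r x y = - ln (1 - t)" by (simp add: log_kernel_def t_def)
  have nonneg: "0 \<le> t ^ Suc n / Suc n" for n using t by simp
  show "(\<Sum>n<m. r ^ Suc n / Suc n * fs_kernel x y ^ Suc n) \<le> log_kernel r x y"
    unfolding eq L sums_unique[OF s] by (rule sum_le_suminf[OF sums_summable[OF s]]) (use nonneg in auto)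
  have tail: "(\<lambda>n. t ^ Suc (n + m) / Suc (n + m)) sums (- ln (1 - t) - (\<Sum>n<m. t ^ Suc n / Suc n))"
    using s by (subst sums_iff_shift) simp
  have geo: "(\<lambda>n. r ^ m * (r * r ^ n)) sums (r ^ m * (r * (1 / (1 - r))))"
    using r by (intro sums_mult geometric_sums) auto
  have "- ln (1 - t) - (\<Sum>n<m. t ^ Suc n / Suc n) \<le> r ^ m * (r * (1 / (1 - r)))"
  proof (rule sums_le[OF _ tail geo])
    fix n
    have "t ^ Suc (n + m) / Suc (n + m) \<le> t ^ Suc (n + m)" using t by (intro dle) simp
    also have "\<dots> \<le> r ^ Suc (n + m)" using t by (intro power_mono) auto
    finally show "t ^ Suc (n + m) / Suc (n + m) \<le> r ^ m * (r * r ^ n)" by (simp add: power_add mult_ac)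
  qed
  then show "log_kernel r x y \<le> (\<Sum>n<m. r ^ Suc n / Suc n * fs_kernel x y ^ Suc n) + r ^ m * (r / (1 - r))"
    unfolding eq L by simp
qed

lemma energy_diff_log_kernel_nonneg:
  assumes M: "borel_prob M" and N: "borel_prob N" and r: "0 \<le> r" "r < 1"
  shows "0 \<le> energy_diff M N (log_kernel r)"
proof -
  define S where "S m x y = (\<Sum>n<m. r ^ Suc n / Suc n * fs_kernel x y ^ Suc n)" for m x y
  define e where "e m = r ^ m * (r / (1 - r))" for m
  have bk: "bounded_kernel (\<lambda>x y. c * fs_kernel x y ^ n)" for c n
    by (intro bounded_kernel_mult bounded_kernel_const bounded_kernel_power bounded_kernel_fs)
  have bS: "bounded_kernel (S m)" for m
    unfolding S_def by (intro bounded_kernel_sum bk)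
  have S: "0 \<le> energy_diff M N (S m)" for m
  proof -
    have "energy_diff M N (S m) = (\<Sum>n<m. r ^ Suc n / Suc n * energy_diff M N (\<lambda>x y. fs_kernel x y ^ Suc n))"
    proof -
      have ms: "mutual_energy P Q (S m) = (\<Sum>n<m. r ^ Suc n / Suc n * mutual_energy P Q (\<lambda>x y. fs_kernel x y ^ Suc n))"
        if "borel_prob P" "borel_prob Q" for P Q
        unfolding S_def by (subst mutual_energy_sum[OF that]) (rule bk, simp only: mutual_energy_cmult[OF that])
      show ?thesis
        by (simp add: energy_diff_def ms M N right_diff_distrib distrib_left sum.distrib sum_subtractf del: power_Suc)
    qed
    moreover have "0 \<le> energy_diff M N (\<lambda>x y. fs_kernel x y ^ Suc n)" for n
      using energy_diff_fs_power_nonneg[OF M N, of "\<lambda>_. 1" 1 "Suc n"] by simp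
    ultimately show ?thesis using r by (auto intro!: sum_nonneg mult_nonneg_nonneg simp del: power_Suc)
  qed
  have lo: "mutual_energy P Q (S m) \<le> mutual_energy P Q (log_kernel r)"
    if "borel_prob P" "borel_prob Q" for P Q m
    using log_kernel_series_bounds(1)[OF r] bS bounded_kernel_log[OF r]
    by (intro mutual_energy_mono that) (auto simp: S_def)
  have hi: "mutual_energy P Q (log_kernel r) \<le> mutual_energy P Q (S m) + e m"
    if "borel_prob P" "borel_prob Q" for P Q m
  proof -
    have "mutual_energy P Q (log_kernel r) \<le> mutual_energy P Q (\<lambda>x y. S m x y + e m)"
    proof (rule mutual_energy_mono[OF that bounded_kernel_log[OF r] bounded_kernel_add[OF bS bounded_kernel_const]])
      show "log_kernel r x y \<le> S m x y + e m" for x y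
        unfolding S_def e_def by (rule log_kernel_series_bounds(2)[OF r])
    qed
    then show ?thesis using that by (simp add: mutual_energy_add bS bounded_kernel_const mutual_energy_const)
  qed
  \<comment> \<open>The two pure energies are bounded below by those of the partial sum; the two
    mixed ones enter negatively and cost \<open>e m\<close> each.\<close>
  have "- 2 * e m \<le> energy_diff M N (log_kernel r)" for m
    using S[of m] lo[OF M M, of m] lo[OF N N, of m] hi[OF M N, of m] hi[OF N M, of m]
    unfolding energy_diff_def by linarith
  moreover have "(\<lambda>m. - 2 * e m) \<longlonglongrightarrow> - 2 * (0 * (r / (1 - r)))"
    unfolding e_def using r by (intro tendsto_intros LIMSEQ_realpow_zero) auto
  ultimately show ?thesis by (intro LIMSEQ_le_const2[where X = "\<lambda>m. - 2 * e m"]) auto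
qed

subsection \<open>The energy lower bound\<close>

abbreviation (input) cp1_of_real :: "real \<Rightarrow> cp1" where
  "cp1_of_real x \<equiv> cp1_of_complex (complex_of_real x)"

definition mu_P1 :: "cp1 measure" where
  "mu_P1 = distr mu_R borel cp1_of_real"

lemma cp1_of_real_measurable [measurable]: "cp1_of_real \<in> measurable borel borel"
  by measurable

lemma borel_prob_mu_P1: "borel_prob mu_P1"
proof -
  interpret prob_space mu_R by (rule prob_space_mu_R)
  show ?thesis unfolding borel_prob_def mu_P1_def by (auto intro!: prob_space_distr)
qed

lemma integral_mu_P1:
  "f \<in> borel_measurable borel \<Longrightarrow> (\<integral>x. f x \<partial>mu_P1) = (\<integral>x. f (cp1_of_real x) \<partial>mu_R)" for f :: "cp1 \<Rightarrow> real"
  unfolding mu_P1_def by (rule integral_distr) auto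

lemma one_minus_fs_kernel_complex:
  "1 - fs_kernel (cp1_of_complex z) (cp1_of_complex w) = (cmod (z - w))\<^sup>2 / ((1 + (cmod z)\<^sup>2) * (1 + (cmod w)\<^sup>2))"
  using one_minus_fs_kernel[of "(z, 1)" "(w, 1)"]
  by (simp add: cp1_of_complex.abs_eq zero_prod_def sqnorm2_def add.commute)

lemma one_minus_fs_kernel_infinity:
  "1 - fs_kernel (cp1_of_complex z) cp1_infinity = 1 / (1 + (cmod z)\<^sup>2)"
  using one_minus_fs_kernel[of "(z, 1)" "(1, 0)"]
  by (simp add: cp1_of_complex.abs_eq cp1_infinity_def zero_prod_def sqnorm2_def add.commute)

lemma max_weight_complex: "max_weight (cp1_of_complex z) = (max 1 (cmod z))\<^sup>2 / (1 + (cmod z)\<^sup>2)"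
proof -
  have p: "1 + (cmod z)\<^sup>2 > 0" by (simp add: add_pos_nonneg)
  have "fst (bloch (cp1_of_complex z)) = (cmod z)\<^sup>2 / (1 + (cmod z)\<^sup>2)"
    by (simp add: cp1_of_complex.abs_eq bloch_abs zero_prod_def sqnorm2_def add.commute)
  moreover have "1 - (cmod z)\<^sup>2 / (1 + (cmod z)\<^sup>2) = 1 / (1 + (cmod z)\<^sup>2)"
  proof -
    have "1 - (cmod z)\<^sup>2 / (1 + (cmod z)\<^sup>2) = ((1 + (cmod z)\<^sup>2) - (cmod z)\<^sup>2) / (1 + (cmod z)\<^sup>2)"
      using p by (simp only: diff_divide_distrib) simp
    then show ?thesis by simp
  qed
  moreover have "(max 1 (cmod z))\<^sup>2 = max ((cmod z)\<^sup>2) 1"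
  proof (cases "cmod z \<le> 1")
    case True
    then have "(cmod z)\<^sup>2 \<le> 1" by (simp add: power_le_one)
    with True show ?thesis by (simp add: max_def)
  next
    case False
    then have "max 1 (cmod z) = cmod z" by simp
    moreover have "max ((cmod z)\<^sup>2) 1 = (cmod z)\<^sup>2"
      by (rule max_absorb1, rule one_le_power) (use False in simp)
    ultimately show ?thesis by (simp only:)
  qed
  ultimately show ?thesis using p by (simp add: max_weight_def max_divide_distrib_right)
qed

lemma max_weight_infinity: "max_weight cp1_infinity = 1"
  by (simp add: max_weight_def cp1_infinity_def bloch_abs zero_prod_def sqnorm2_def)

lemma ln_max_weight_complex:
  "ln (max_weight (cp1_of_complex z)) / 2 = ln (max 1 (cmod z)) - ln (1 + (cmod z)\<^sup>2) / 2"
proof -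
  have p: "1 + (cmod z)\<^sup>2 > 0" by (simp add: add_pos_nonneg)
  have "ln ((max 1 (cmod z))\<^sup>2 / (1 + (cmod z)\<^sup>2)) = ln ((max 1 (cmod z))\<^sup>2) - ln (1 + (cmod z)\<^sup>2)"
    using p by (intro ln_divide_pos) auto
  also have "ln ((max 1 (cmod z))\<^sup>2) = 2 * ln (max 1 (cmod z))" by (subst ln_realpow) auto
  finally show ?thesis by (simp add: max_weight_complex)
qed

abbreviation (input) VR :: real where "VR \<equiv> 7 * zeta3 / (2 * pi\<^sup>2)"

lemma integral_mu_P1_ln_max_weight:
  "(\<integral>x. ln (max_weight x) / 2 \<partial>mu_P1) = VR - (\<integral>x. ln (1 + x\<^sup>2) \<partial>mu_R) / 2"
proof -
  have i: "integrable mu_R (\<lambda>x. ln (1 + x\<^sup>2))"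
    using has_bochner_integral_mu_R_ln_plus[of 0] by (simp add: has_bochner_integral_iff)
  have "(\<integral>x. ln (max_weight x) / 2 \<partial>mu_P1) = (\<integral>x. ln (max 1 \<bar>x\<bar>) - ln (1 + x\<^sup>2) / 2 \<partial>mu_R)"
    by (subst integral_mu_P1) (auto simp: ln_max_weight_complex)
  also have "\<dots> = (\<integral>x. ln (max 1 \<bar>x\<bar>) \<partial>mu_R) - (\<integral>x. ln (1 + x\<^sup>2) / 2 \<partial>mu_R)"
    using has_bochner_integral_mu_R_ln_max i
    by (intro Bochner_Integration.integral_diff) (auto simp: has_bochner_integral_iff)
  also have "(\<integral>x. ln (max 1 \<bar>x\<bar>) \<partial>mu_R) = VR"
    using has_bochner_integral_mu_R_ln_max by (simp add: has_bochner_integral_iff)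
  finally show ?thesis by simp
qed

lemma AE_mu_R_neq: "AE x in mu_R. x \<noteq> s"
proof -
  have "AE x in lborel. x \<noteq> s" by (rule AE_lborel_singleton)
  then show ?thesis unfolding mu_R_eq by (subst AE_density) auto
qed

text \<open>The integral of -log delta(x, c) over x with respect to \<open>mu_P1\<close>, with the
  three summands of the kernel integrated separately so that the value is a real number.\<close>

definition potential :: "cp1 \<Rightarrow> real" where
  "potential c = (\<integral>x. - ln (1 - fs_kernel (cp1_of_real x) c) \<partial>mu_R) / 2 + ln (max_weight c) / 2
     + (\<integral>x. ln (max_weight x) / 2 \<partial>mu_P1)"

text \<open>The factorisation |x - w|^2 = (x - Re w)^2 (1 + (Im w)^2 / (x - Re w)^2) separates the
  known potential at Re w from the loss \<open>R\<close>. The mean of ln (1 + x^2) produced by the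
  normalisation cancels against the one in the mean of \<open>max_weight\<close>.\<close>

lemma potential_complex:
  fixes w :: complex
  defines "R \<equiv> \<lambda>x. ln (1 + (Im w)\<^sup>2 / (x - Re w)\<^sup>2)"
  assumes R: "integrable mu_R R"
  shows "integrable mu_R (\<lambda>x. - ln (1 - fs_kernel (cp1_of_real x) (cp1_of_complex w)))"
    and "potential (cp1_of_complex w) =
      VR + ln (max 1 (cmod w)) - ln (max 1 \<bar>Re w\<bar>) - (\<integral>x. R x \<partial>mu_R) / 2"
proof -
  interpret prob_space mu_R by (rule prob_space_mu_R)
  have i: "integrable mu_R (\<lambda>x. ln (1 + x\<^sup>2))"
    using has_bochner_integral_mu_R_ln_plus[of 0] by (simp add: has_bochner_integral_iff)
  have l: "integrable mu_R (\<lambda>x. ln ((x - Re w)\<^sup>2))" "(\<integral>x. ln ((x - Re w)\<^sup>2) \<partial>mu_R) = 2 * ln (max 1 \<bar>Re w\<bar>)"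
    using has_bochner_integral_mu_R_ln[of "Re w"] by (auto simp: has_bochner_integral_iff)
  have p: "1 + (cmod w)\<^sup>2 > 0" by (simp add: add_pos_nonneg)
  let ?F = "\<lambda>x. ln (1 + x\<^sup>2) + ln (1 + (cmod w)\<^sup>2) - ln ((x - Re w)\<^sup>2) - R x"
  have hb: "has_bochner_integral mu_R ?F ((\<integral>x. ln (1 + x\<^sup>2) \<partial>mu_R) + ln (1 + (cmod w)\<^sup>2)
      - 2 * ln (max 1 \<bar>Re w\<bar>) - (\<integral>x. R x \<partial>mu_R))"
    using i l R prob_space by (auto simp: has_bochner_integral_iff)
  have AE: "AE x in mu_R. ?F x = - ln (1 - fs_kernel (cp1_of_real x) (cp1_of_complex w))"
    using AE_mu_R_neq[of "Re w"]
  proof eventually_elim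
    case (elim x)
    have q: "(x - Re w)\<^sup>2 > 0" "1 + x\<^sup>2 > 0" using elim by (auto simp: add_pos_nonneg)
    have "(cmod (complex_of_real x - w))\<^sup>2 = (x - Re w)\<^sup>2 * (1 + (Im w)\<^sup>2 / (x - Re w)\<^sup>2)"
      using q by (simp add: cmod_power2 distrib_left)
    moreover have r: "1 + (Im w)\<^sup>2 / (x - Re w)\<^sup>2 > 0" by (simp add: add_pos_nonneg)
    ultimately have "1 - fs_kernel (cp1_of_real x) (cp1_of_complex w) =
        (x - Re w)\<^sup>2 * (1 + (Im w)\<^sup>2 / (x - Re w)\<^sup>2) / ((1 + x\<^sup>2) * (1 + (cmod w)\<^sup>2))"
      by (simp add: one_minus_fs_kernel_complex)
    also have "ln \<dots> = ln ((x - Re w)\<^sup>2 * (1 + (Im w)\<^sup>2 / (x - Re w)\<^sup>2)) - ln ((1 + x\<^sup>2) * (1 + (cmod w)\<^sup>2))"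
      using q r p by (intro ln_divide_pos mult_pos_pos)
    also have "ln ((x - Re w)\<^sup>2 * (1 + (Im w)\<^sup>2 / (x - Re w)\<^sup>2)) = ln ((x - Re w)\<^sup>2) + R x"
      unfolding R_def using q r by (intro ln_mult_pos)
    also have "ln ((1 + x\<^sup>2) * (1 + (cmod w)\<^sup>2)) = ln (1 + x\<^sup>2) + ln (1 + (cmod w)\<^sup>2)"
      using q p by (intro ln_mult_pos)
    finally show ?case by simp
  qed
  have meas: "(\<lambda>x. - ln (1 - fs_kernel (cp1_of_real x) (cp1_of_complex w))) \<in> borel_measurable mu_R"
    by measurable
  have "has_bochner_integral mu_R (\<lambda>x. - ln (1 - fs_kernel (cp1_of_real x) (cp1_of_complex w)))
      ((\<integral>x. ln (1 + x\<^sup>2) \<partial>mu_R) + ln (1 + (cmod w)\<^sup>2) - 2 * ln (max 1 \<bar>Re w\<bar>) - (\<integral>x. R x \<partial>mu_R))"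
    using hb AE meas borel_measurable_has_bochner_integral[OF hb]
    by (subst (asm) has_bochner_integral_cong_AE) auto
  then have I: "integrable mu_R (\<lambda>x. - ln (1 - fs_kernel (cp1_of_real x) (cp1_of_complex w)))"
    "(\<integral>x. - ln (1 - fs_kernel (cp1_of_real x) (cp1_of_complex w)) \<partial>mu_R) =
      (\<integral>x. ln (1 + x\<^sup>2) \<partial>mu_R) + ln (1 + (cmod w)\<^sup>2) - 2 * ln (max 1 \<bar>Re w\<bar>) - (\<integral>x. R x \<partial>mu_R)"
    by (simp_all only: has_bochner_integral_iff)
  show "integrable mu_R (\<lambda>x. - ln (1 - fs_kernel (cp1_of_real x) (cp1_of_complex w)))" by (rule I(1))
  show "potential (cp1_of_complex w) =
      VR + ln (max 1 (cmod w)) - ln (max 1 \<bar>Re w\<bar>) - (\<integral>x. R x \<partial>mu_R) / 2"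
    unfolding potential_def ln_max_weight_complex integral_mu_P1_ln_max_weight I(2)
    by (simp add: diff_divide_distrib add_divide_distrib)
qed

lemma potential_infinity:
  "integrable mu_R (\<lambda>x. - ln (1 - fs_kernel (cp1_of_real x) cp1_infinity))"
  "potential cp1_infinity = VR"
proof -
  have i: "integrable mu_R (\<lambda>x. ln (1 + x\<^sup>2))"
    using has_bochner_integral_mu_R_ln_plus[of 0] by (simp add: has_bochner_integral_iff)
  have eq: "- ln (1 - fs_kernel (cp1_of_real x) cp1_infinity) = ln (1 + x\<^sup>2)" for x
    using ln_inverse[of "1 + x\<^sup>2"] by (simp add: one_minus_fs_kernel_infinity inverse_eq_divide)
  show "integrable mu_R (\<lambda>x. - ln (1 - fs_kernel (cp1_of_real x) cp1_infinity))"
    unfolding eq by (rule i)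
  show "potential cp1_infinity = VR"
    unfolding potential_def eq integral_mu_P1_ln_max_weight by (simp add: max_weight_infinity)
qed

lemma potential_real:
  "integrable mu_R (\<lambda>x. - ln (1 - fs_kernel (cp1_of_real x) (cp1_of_real s)))"
  "potential (cp1_of_real s) = VR"
  using potential_complex[of "complex_of_real s"] by simp_all

text \<open>The loss grows with the height, so it is estimated at height T. The difference ln (max 1
  |w|) - ln (max 1 |Re w|) is non-negative and is dropped.\<close>

lemma potential_strip:
  assumes T: "0 < T" and c: "c \<in> strip T"
  shows "integrable mu_R (\<lambda>x. - ln (1 - fs_kernel (cp1_of_real x) c))"
    and "potential c \<ge> VR - ((1 + T) * ln (1 + T) - T * ln T)"
proof -
  define \<Lambda> where "\<Lambda> = 2 * ((1 + T) * ln (1 + T) - T * ln T)"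
  have \<Lambda>: "\<Lambda> \<ge> 0"
  proof -
    have "T * ln T \<le> T * ln (1 + T)" using T by (intro mult_left_mono) auto
    moreover have "0 \<le> ln (1 + T)" using T by simp
    ultimately show ?thesis by (simp add: \<Lambda>_def algebra_simps)
  qed
  have "integrable mu_R (\<lambda>x. - ln (1 - fs_kernel (cp1_of_real x) c)) \<and> potential c \<ge> VR - \<Lambda> / 2"
  proof (cases "c = cp1_infinity")
    case True
    then show ?thesis using potential_infinity \<Lambda> by simp
  next
    case False
    then obtain w where w: "c = cp1_of_complex w" "\<bar>Im w\<bar> \<le> T" using c by (auto simp: strip_def)
    let ?R = "\<lambda>x. ln (1 + (Im w)\<^sup>2 / (x - Re w)\<^sup>2)"
    have "(\<integral>\<^sup>+x. ennreal (?R x) \<partial>mu_R) \<le> (\<integral>\<^sup>+x. ennreal (ln (1 + T\<^sup>2 / (x - Re w)\<^sup>2)) \<partial>mu_R)"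
    proof (intro nn_integral_mono ennreal_leI ln_mono)
      fix x
      show "0 < 1 + (Im w)\<^sup>2 / (x - Re w)\<^sup>2" by (simp add: add_pos_nonneg)
      have "(Im w)\<^sup>2 \<le> T\<^sup>2" using w(2) T by (simp add: abs_le_square_iff[symmetric])
      then show "1 + (Im w)\<^sup>2 / (x - Re w)\<^sup>2 \<le> 1 + T\<^sup>2 / (x - Re w)\<^sup>2" by (simp add: divide_right_mono)
    qed
    also have "\<dots> \<le> ennreal \<Lambda>"
      unfolding \<Lambda>_def using T by (rule nn_integral_mu_R_ln_recip_le)
    finally have le: "(\<integral>\<^sup>+x. ennreal (?R x) \<partial>mu_R) \<le> ennreal \<Lambda>" .
    have R: "integrable mu_R ?R"
    proof (rule integrableI_nonneg)
      show "(\<integral>\<^sup>+x. ennreal (?R x) \<partial>mu_R) < \<infinity>" using le by (rule le_less_trans) simp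
    qed auto
    have "ennreal (\<integral>x. ?R x \<partial>mu_R) \<le> ennreal \<Lambda>"
      using le R by (subst (asm) nn_integral_eq_integral) auto
    then have "(\<integral>x. ?R x \<partial>mu_R) \<le> \<Lambda>" using \<Lambda> by (simp add: ennreal_le_iff)
    moreover have "ln (max 1 \<bar>Re w\<bar>) \<le> ln (max 1 (cmod w))"
      using abs_Re_le_cmod[of w] by (intro ln_mono) auto
    ultimately show ?thesis unfolding w(1) potential_complex(2)[OF R]
      by (intro conjI potential_complex(1)[OF R]) linarith
  qed
  then show "integrable mu_R (\<lambda>x. - ln (1 - fs_kernel (cp1_of_real x) c))"
    and "potential c \<ge> VR - ((1 + T) * ln (1 + T) - T * ln T)" by (simp_all add: \<Lambda>_def diff_divide_distrib)
qed

section \<open>Comparison of the truncated kernel with -log delta\<close>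

definition delta_kernel :: "real \<Rightarrow> cp1 \<Rightarrow> cp1 \<Rightarrow> real" where
  "delta_kernel r x y = log_kernel r x y / 2 + ln (max_weight x) / 2 + ln (max_weight y) / 2"

lemma ln_max_weight_bound: "\<bar>ln (max_weight x) / 2\<bar> \<le> 1"
proof -
  have "ln (1 / 2) \<le> ln (max_weight x)" "ln (max_weight x) \<le> 0"
    using max_weight_bounds[of x] by (auto intro!: ln_mono)
  moreover have "ln (1 / 2 :: real) = - ln 2" by (simp add: ln_div)
  moreover have "ln (2::real) \<le> 1" using ln_2_less_1 by simp
  ultimately show ?thesis by simp
qed

lemma bounded_kernel_delta:
  assumes "0 \<le> r" "r < 1"
  shows "bounded_kernel (delta_kernel r)"
proof -
  have "bounded_kernel (\<lambda>x y. 1 / 2 * log_kernel r x y + ln (max_weight x) / 2 + ln (max_weight y) / 2)"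
    using ln_max_weight_bound
    by (intro bounded_kernel_add bounded_kernel_mult bounded_kernel_const bounded_kernel_log assms
        bounded_kernel_left[of _ 1] bounded_kernel_right[of _ 1]) auto
  then show ?thesis by (simp add: delta_kernel_def[abs_def])
qed

lemma fs_kernel_commute: "fs_kernel x y = fs_kernel y x"
  by (simp add: fs_kernel_def mult.commute)

lemma log_kernel_mono:
  assumes "0 \<le> r" "r < 1" "fs_kernel x y < 1"
  shows "log_kernel r x y \<le> - ln (1 - fs_kernel x y)"
proof -
  have "r * fs_kernel x y \<le> 1 * fs_kernel x y" using assms fs_kernel_nonneg by (intro mult_right_mono) auto
  then show ?thesis unfolding log_kernel_def using assms by (auto intro!: ln_mono)
qed

lemma log_kernel_nonneg: "0 \<le> r \<Longrightarrow> r < 1 \<Longrightarrow> 0 \<le> log_kernel r x y"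
  using r_fs_bounds[of r x y] by (auto simp: log_kernel_def)

lemma delta_kernel_le: "0 \<le> r \<Longrightarrow> r < 1 \<Longrightarrow> ereal (delta_kernel r x y) \<le> neg_log_delta x y"
  using log_kernel_mono[of r x y] fs_kernel_le_1[of x y]
  by (cases "fs_kernel x y = 1") (auto simp: neg_log_delta_infinite neg_log_delta_eq delta_kernel_def)

text \<open>\<open>energy\<close> subtracts the integral of the negative part from that of the
  positive part. Splitting k in the same way bounds the first from below and the second from above;
  the latter bound is finite, so the difference in the extended reals is meaningful.\<close>

lemma energy_ge_mutual_energy:
  assumes M: "borel_prob M" and k: "bounded_kernel k" and le: "\<And>x y. ereal (k x y) \<le> neg_log_delta x y"
  shows "energy M \<ge> ereal (mutual_energy M M k)"
proof -
  interpret prob_space M using M by (simp add: borel_prob_def)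
  define p n where "p x y = max 0 (k x y)" and "n x y = max 0 (- k x y)" for x y
  have bp: "bounded_kernel p" "bounded_kernel n"
  proof -
    obtain B where B: "\<forall>x y. \<bar>k x y\<bar> \<le> B" and [measurable]: "(\<lambda>(x, y). k x y) \<in> borel_measurable (borel \<Otimes>\<^sub>M borel)"
      using k by (auto simp: bounded_kernel_def)
    have "0 \<le> B" using B abs_ge_zero order_trans by blast
    have "(\<lambda>z. max 0 ((\<lambda>(x, y). k x y) z)) \<in> borel_measurable (borel \<Otimes>\<^sub>M borel)"
      "(\<lambda>z. max 0 (- (\<lambda>(x, y). k x y) z)) \<in> borel_measurable (borel \<Otimes>\<^sub>M borel)" by measurable
    then show "bounded_kernel p" "bounded_kernel n"
      using B \<open>0 \<le> B\<close> by (auto intro!: bounded_kernelI[of _ B] simp: p_def n_def split_beta' abs_le_iff)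
  qed
  have nn: "(\<integral>\<^sup>+y. (\<integral>\<^sup>+x. ennreal (q x y) \<partial>M) \<partial>M) = ennreal (mutual_energy M M q)"
    if "bounded_kernel q" "\<And>x y. 0 \<le> q x y" for q
  proof -
    have "(\<integral>\<^sup>+x. ennreal (q x y) \<partial>M) = ennreal (\<integral>x. q x y \<partial>M)" for y
      using that M by (intro nn_integral_eq_integral bounded_kernel_integrable1) auto
    then show ?thesis unfolding mutual_energy_def using that M
      by (auto intro!: nn_integral_eq_integral bounded_kernel_integrable2 integral_nonneg)
  qed
  have "ennreal (mutual_energy M M p) \<le> (\<integral>\<^sup>+y. (\<integral>\<^sup>+x. e2ennreal (neg_log_delta x y) \<partial>M) \<partial>M)"
  proof (subst nn[symmetric, OF bp(1)])
    show "0 \<le> p x y" for x y by (simp add: p_def)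
    show "(\<integral>\<^sup>+y. (\<integral>\<^sup>+x. ennreal (p x y) \<partial>M) \<partial>M) \<le> (\<integral>\<^sup>+y. (\<integral>\<^sup>+x. e2ennreal (neg_log_delta x y) \<partial>M) \<partial>M)"
    proof (intro nn_integral_mono)
      fix x y
      have "ennreal (p x y) = e2ennreal (ereal (k x y))" by (simp add: p_def e2ennreal_ereal max_def ennreal_neg)
      also have "\<dots> \<le> e2ennreal (neg_log_delta x y)" using le by (rule e2ennreal_mono)
      finally show "ennreal (p x y) \<le> e2ennreal (neg_log_delta x y)" .
    qed
  qed
  moreover have "(\<integral>\<^sup>+y. (\<integral>\<^sup>+x. e2ennreal (- neg_log_delta x y) \<partial>M) \<partial>M) \<le> ennreal (mutual_energy M M n)"
  proof (subst nn[symmetric, OF bp(2)])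
    show "0 \<le> n x y" for x y by (simp add: n_def)
    show "(\<integral>\<^sup>+y. (\<integral>\<^sup>+x. e2ennreal (- neg_log_delta x y) \<partial>M) \<partial>M) \<le> (\<integral>\<^sup>+y. (\<integral>\<^sup>+x. ennreal (n x y) \<partial>M) \<partial>M)"
    proof (intro nn_integral_mono)
      fix x y
      have "e2ennreal (- neg_log_delta x y) \<le> e2ennreal (- ereal (k x y))"
        using le by (intro e2ennreal_mono) (simp only: ereal_minus_le_minus)
      also have "\<dots> = ennreal (n x y)" by (simp add: n_def e2ennreal_ereal max_def ennreal_neg)
      finally show "e2ennreal (- neg_log_delta x y) \<le> ennreal (n x y)" .
    qed
  qed
  ultimately have "energy M \<ge> enn2ereal (ennreal (mutual_energy M M p)) - enn2ereal (ennreal (mutual_energy M M n))"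
    unfolding energy_def by (intro ereal_minus_mono) (simp_all add: less_eq_ennreal.rep_eq)
  also have "enn2ereal (ennreal (mutual_energy M M p)) - enn2ereal (ennreal (mutual_energy M M n)) =
      ereal (mutual_energy M M p - mutual_energy M M n)"
  proof -
    have "0 \<le> mutual_energy M M p" "0 \<le> mutual_energy M M n"
      unfolding mutual_energy_def by (auto intro!: integral_nonneg simp: p_def n_def)
    then show ?thesis by (simp add: enn2ereal_ennreal)
  qed
  also have "mutual_energy M M p - mutual_energy M M n = mutual_energy M M (\<lambda>x y. p x y + (-1) * n x y)"
    using mutual_energy_add[OF M M bp(1) bounded_kernel_mult[OF bounded_kernel_const bp(2)], of "-1"]
      mutual_energy_cmult[OF M M, of "-1" n] by simp
  also have "(\<lambda>x y. p x y + (-1) * n x y) = k" by (auto simp: p_def n_def max_def intro!: ext)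
  finally show ?thesis .
qed

lemma mutual_energy_delta:
  assumes M: "borel_prob M" and N: "borel_prob N" and r: "0 \<le> r" "r < 1"
  shows "mutual_energy M N (delta_kernel r) = mutual_energy M N (log_kernel r) / 2
    + (\<integral>x. ln (max_weight x) / 2 \<partial>M) + (\<integral>x. ln (max_weight x) / 2 \<partial>N)"
proof -
  have b: "bounded_kernel (\<lambda>x y. 1 / 2 * log_kernel r x y)"
    "bounded_kernel (\<lambda>x y. ln (max_weight x) / 2)" "bounded_kernel (\<lambda>x y. ln (max_weight y) / 2)"
    using ln_max_weight_bound
    by (intro bounded_kernel_add bounded_kernel_mult bounded_kernel_const bounded_kernel_log r
        bounded_kernel_left[of _ 1] bounded_kernel_right[of _ 1]; simp)+
  have "delta_kernel r = (\<lambda>x y. (1 / 2 * log_kernel r x y + ln (max_weight x) / 2) + ln (max_weight y) / 2)"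
    by (auto simp: delta_kernel_def[abs_def])
  then show ?thesis
    using mutual_energy_add[OF M N bounded_kernel_add[OF b(1,2)] b(3)] mutual_energy_add[OF M N b(1,2)]
      mutual_energy_cmult[OF M N, of "1 / 2" "log_kernel r"]
      mutual_energy_left[OF M N, of "\<lambda>x. ln (max_weight x) / 2"]
      mutual_energy_right[OF M N, of "\<lambda>x. ln (max_weight x) / 2"] by simp
qed

lemma AE_fs_kernel_less:
  assumes "c \<in> strip T"
  shows "AE x in mu_R. fs_kernel (cp1_of_real x) c < 1"
proof (cases "c = cp1_infinity")
  case True
  have "fs_kernel (cp1_of_real x) c < 1" for x
  proof -
    have "1 - fs_kernel (cp1_of_real x) c > 0"
      unfolding True one_minus_fs_kernel_infinity by (intro divide_pos_pos add_pos_nonneg) auto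
    then show ?thesis by simp
  qed
  then show ?thesis by simp
next
  case False
  then obtain w where w: "c = cp1_of_complex w" using assms by (auto simp: strip_def)
  show ?thesis using AE_mu_R_neq[of "Re w"]
  proof eventually_elim
    case (elim x)
    then have "complex_of_real x - w \<noteq> 0" by (auto simp: complex_eq_iff)
    then have "1 - fs_kernel (cp1_of_real x) c > 0"
      unfolding w one_minus_fs_kernel_complex by (intro divide_pos_pos mult_pos_pos add_pos_nonneg) auto
    then show ?case by simp
  qed
qed

lemma delta_kernel_potential:
  assumes r: "0 \<le> r" "r < 1"
  shows "(\<integral>x. delta_kernel r x c \<partial>mu_P1) = (\<integral>x. log_kernel r (cp1_of_real x) c \<partial>mu_R) / 2
     + ln (max_weight c) / 2 + (\<integral>x. ln (max_weight x) / 2 \<partial>mu_P1)"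
    and "integrable mu_R (\<lambda>x. log_kernel r (cp1_of_real x) c)"
proof -
  have mu: "borel_prob mu_P1" by (rule borel_prob_mu_P1)
  interpret prob_space mu_P1 using mu by (simp add: borel_prob_def)
  have b: "bounded_kernel (log_kernel r)" "bounded_kernel (\<lambda>x y. ln (max_weight x) / 2)"
    using ln_max_weight_bound by (intro bounded_kernel_log r bounded_kernel_left[of _ 1]; simp)+
  have i1: "integrable mu_P1 (\<lambda>x. log_kernel r x c)" by (rule bounded_kernel_integrable1[OF b(1) mu])
  have i2: "integrable mu_P1 (\<lambda>x. ln (max_weight x) / 2)"
    using bounded_kernel_integrable1[OF b(2) mu] by simp
  have m: "(\<lambda>x. log_kernel r x c) \<in> borel_measurable borel"
    unfolding log_kernel_def by measurable
  have "(\<integral>x. delta_kernel r x c \<partial>mu_P1) =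
      (\<integral>x. log_kernel r x c / 2 + ln (max_weight c) / 2 + ln (max_weight x) / 2 \<partial>mu_P1)"
    by (simp add: delta_kernel_def add_ac)
  also have "\<dots> = (\<integral>x. log_kernel r x c / 2 + ln (max_weight c) / 2 \<partial>mu_P1) + (\<integral>x. ln (max_weight x) / 2 \<partial>mu_P1)"
    using i1 i2 by (intro Bochner_Integration.integral_add) auto
  also have "(\<integral>x. log_kernel r x c / 2 + ln (max_weight c) / 2 \<partial>mu_P1) =
      (\<integral>x. log_kernel r x c / 2 \<partial>mu_P1) + (\<integral>x. ln (max_weight c) / 2 \<partial>mu_P1)"
    using i1 by (intro Bochner_Integration.integral_add) auto
  finally show "(\<integral>x. delta_kernel r x c \<partial>mu_P1) = (\<integral>x. log_kernel r (cp1_of_real x) c \<partial>mu_R) / 2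
     + ln (max_weight c) / 2 + (\<integral>x. ln (max_weight x) / 2 \<partial>mu_P1)"
    using integral_mu_P1[OF m] by (simp add: prob_space)
  show "integrable mu_R (\<lambda>x. log_kernel r (cp1_of_real x) c)"
    using i1 m unfolding mu_P1_def by (subst (asm) integrable_distr_eq) auto
qed

lemma delta_kernel_potential_le:
  assumes r: "0 \<le> r" "r < 1" and T: "0 < T" and c: "c \<in> strip T"
  shows "(\<integral>x. delta_kernel r x c \<partial>mu_P1) \<le> potential c"
proof -
  have "(\<integral>x. log_kernel r (cp1_of_real x) c \<partial>mu_R) \<le> (\<integral>x. - ln (1 - fs_kernel (cp1_of_real x) c) \<partial>mu_R)"
  proof (rule integral_mono_AE)
    show "AE x in mu_R. log_kernel r (cp1_of_real x) c \<le> - ln (1 - fs_kernel (cp1_of_real x) c)"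
      using AE_fs_kernel_less[OF c] by eventually_elim (rule log_kernel_mono[OF r])
  qed (rule delta_kernel_potential[OF r] potential_strip[OF T c])+
  then show ?thesis unfolding delta_kernel_potential(1)[OF r] potential_def by simp
qed

text \<open>The truncated kernels are non-negative and lie below their limit, which is integrable at
  points of the strip and therefore serves as the dominating function.\<close>

lemma delta_kernel_potential_tendsto:
  assumes r: "\<And>n. 0 \<le> r n" "\<And>n. r n < 1" "r \<longlonglongrightarrow> 1" and T: "0 < T" and c: "c \<in> strip T"
  shows "(\<lambda>n. \<integral>x. delta_kernel (r n) x c \<partial>mu_P1) \<longlonglongrightarrow> potential c"
proof -
  have "(\<lambda>n. \<integral>x. log_kernel (r n) (cp1_of_real x) c \<partial>mu_R) \<longlonglongrightarrow>
      (\<integral>x. - ln (1 - fs_kernel (cp1_of_real x) c) \<partial>mu_R)"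
  proof (rule integral_dominated_convergence[where w = "\<lambda>x. - ln (1 - fs_kernel (cp1_of_real x) c)"])
    show "integrable mu_R (\<lambda>x. - ln (1 - fs_kernel (cp1_of_real x) c))" by (rule potential_strip[OF T c])
    then show "(\<lambda>x. - ln (1 - fs_kernel (cp1_of_real x) c)) \<in> borel_measurable mu_R" by auto
    show "(\<lambda>x. log_kernel (r n) (cp1_of_real x) c) \<in> borel_measurable mu_R" for n
      using delta_kernel_potential(2)[OF r(1,2)] by auto
    show "AE x in mu_R. (\<lambda>n. log_kernel (r n) (cp1_of_real x) c) \<longlonglongrightarrow> - ln (1 - fs_kernel (cp1_of_real x) c)"
      using AE_fs_kernel_less[OF c]
    proof eventually_elim
      case (elim x)
      have "(\<lambda>n. - ln (1 - r n * fs_kernel (cp1_of_real x) c)) \<longlonglongrightarrow> - ln (1 - 1 * fs_kernel (cp1_of_real x) c)"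
        using elim r(3) by (intro tendsto_intros) auto
      then show ?case by (simp add: log_kernel_def)
    qed
    show "AE x in mu_R. norm (log_kernel (r n) (cp1_of_real x) c) \<le> - ln (1 - fs_kernel (cp1_of_real x) c)" for n
      using AE_fs_kernel_less[OF c]
    proof eventually_elim
      case (elim x)
      then show ?case
        using log_kernel_mono[OF r(1,2), of "cp1_of_real x" c n] log_kernel_nonneg[OF r(1,2), of n "cp1_of_real x" c] by simp
    qed
  qed
  then show ?thesis
    unfolding delta_kernel_potential(1)[OF r(1,2)] potential_def by (intro tendsto_intros) auto
qed

lemma cp1_of_real_in_strip: "0 < T \<Longrightarrow> cp1_of_real x \<in> strip T"
  by (auto simp: strip_def)

text \<open>Non-negativity of \<open>energy_diff\<close> says that the truncated energy of
  \<open>nu\<close> is at least twice the integral of the truncated potential minus the truncated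
  energy of \<open>mu_P1\<close>. The last is at most \<open>VR\<close>, and the truncated
  potentials tend to a potential that is at least \<open>q\<close> on the strip.\<close>

lemma energy_strip_ge:
  assumes T: "0 < T" and nu: "nu \<in> borel_prob_on (strip T)"
  shows "energy nu \<ge> ereal (VR - 2 * ((1 + T) * ln (1 + T) - T * ln T))"
proof -
  define q where "q = VR - ((1 + T) * ln (1 + T) - T * ln T)"
  define r where "r n = 1 - 1 / real (n + 2)" for n
  have r: "0 \<le> r n" "r n < 1" for n by (auto simp: r_def divide_le_eq)
  have r_lim: "r \<longlonglongrightarrow> 1" unfolding r_def by real_asymp
  have N: "borel_prob nu" and AE: "AE c in nu. c \<in> strip T"
    using nu by (auto simp: borel_prob_on_def borel_prob_def)
  have M: "borel_prob mu_P1" by (rule borel_prob_mu_P1)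
  interpret N: prob_space nu using N by (simp add: borel_prob_def)
  interpret R: prob_space mu_R by (rule prob_space_mu_R)
  define p where "p n c = (\<integral>x. delta_kernel (r n) x c \<partial>mu_P1)" for n c
  note bk = bounded_kernel_delta[OF r]
  have p_meas: "p n \<in> borel_measurable borel" for n
    unfolding p_def by (rule bounded_kernel_inner_measurable[OF bk M])
  have p_meas' [measurable]: "p n \<in> borel_measurable nu" for n
    using p_meas N by (simp add: borel_prob_def cong: measurable_cong_sets)
  have p_int: "integrable nu (p n)" for n
    unfolding p_def by (rule bounded_kernel_integrable2[OF bk M N])
  have muRR: "mutual_energy mu_P1 mu_P1 (delta_kernel (r n)) \<le> VR" for n
  proof -
    have "mutual_energy mu_P1 mu_P1 (delta_kernel (r n)) = (\<integral>x. p n (cp1_of_real x) \<partial>mu_R)"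
      unfolding mutual_energy_def p_def[symmetric] by (rule integral_mu_P1[OF p_meas])
    also have "\<dots> \<le> (\<integral>x. VR \<partial>mu_R)"
    proof (rule integral_mono)
      have "integrable mu_P1 (p n)"
        unfolding p_def by (rule bounded_kernel_integrable2[OF bk M M])
      then show "integrable mu_R (\<lambda>x. p n (cp1_of_real x))"
        using p_meas unfolding mu_P1_def by (subst (asm) integrable_distr_eq) auto
      show "p n (cp1_of_real x) \<le> VR" for x
        using delta_kernel_potential_le[OF r T cp1_of_real_in_strip[OF T], of n x] potential_real(2)[of x]
        by (simp add: p_def)
    qed simp
    finally show ?thesis using R.prob_space by simp
  qed
  \<comment> \<open>Cutting off at \<open>q\<close> loses nothing in the limit and makes the
    functions bounded uniformly in n, so dominated convergence applies without any integrability of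
    the limit potential with respect to \<open>nu\<close>.\<close>
  have bound: "energy nu \<ge> ereal (2 * (\<integral>c. min (p n c) q \<partial>nu) - VR)" for n
  proof -
    have "0 \<le> energy_diff nu mu_P1 (log_kernel (r n))"
      by (rule energy_diff_log_kernel_nonneg[OF N M r])
    \<comment> \<open>The weights depend on one variable each, so for probability measures they
      cancel between the four terms; half of the logarithmic kernel remains.\<close>
    then have "0 \<le> energy_diff nu mu_P1 (delta_kernel (r n))"
      unfolding energy_diff_def mutual_energy_delta[OF N N r] mutual_energy_delta[OF N M r]
        mutual_energy_delta[OF M N r] mutual_energy_delta[OF M M r] by linarith
    moreover have "mutual_energy nu mu_P1 (delta_kernel (r n)) = mutual_energy mu_P1 nu (delta_kernel (r n))"
      by (rule mutual_energy_commute[OF N M bk])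
         (simp add: delta_kernel_def log_kernel_def fs_kernel_commute add_ac)
    moreover have "mutual_energy mu_P1 nu (delta_kernel (r n)) = (\<integral>c. p n c \<partial>nu)"
      by (simp add: mutual_energy_def p_def)
    moreover have "(\<integral>c. min (p n c) q \<partial>nu) \<le> (\<integral>c. p n c \<partial>nu)"
      using p_int by (intro integral_mono) auto
    ultimately have "2 * (\<integral>c. min (p n c) q \<partial>nu) - VR \<le> mutual_energy nu nu (delta_kernel (r n))"
      using muRR[of n] unfolding energy_diff_def by linarith
    also have "ereal \<dots> \<le> energy nu"
      by (rule energy_ge_mutual_energy[OF N bk delta_kernel_le[OF r]])
    finally show ?thesis by simp
  qed
  have "(\<lambda>n. \<integral>c. min (p n c) q \<partial>nu) \<longlonglongrightarrow> (\<integral>c. q \<partial>nu)"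
  proof (rule integral_dominated_convergence[where w = "\<lambda>_. \<bar>q\<bar> + 2"])
    show "AE c in nu. (\<lambda>n. min (p n c) q) \<longlonglongrightarrow> q"
      using AE
    proof eventually_elim
      case (elim c)
      have "(\<lambda>n. p n c) \<longlonglongrightarrow> potential c"
        unfolding p_def by (rule delta_kernel_potential_tendsto[OF r r_lim T elim])
      then have "(\<lambda>n. min (p n c) q) \<longlonglongrightarrow> min (potential c) q" by (intro tendsto_min tendsto_const)
      moreover have "q \<le> potential c" unfolding q_def by (rule potential_strip(2)[OF T elim])
      ultimately show ?case by (simp add: min_absorb2)
    qed
    show "AE c in nu. norm (min (p n c) q) \<le> \<bar>q\<bar> + 2" for n
    proof (rule always_eventually, rule allI)
      \<comment> \<open>A lower bound for the truncated potential: the logarithmic part is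
        non-negative, and each of the two weights contributes at least -1.\<close>
      fix c
      have "0 \<le> (\<integral>x. log_kernel (r n) (cp1_of_real x) c \<partial>mu_R)"
        using log_kernel_nonneg[OF r] by (intro Bochner_Integration.integral_nonneg) auto
      moreover have "- 1 \<le> ln (max_weight c) / 2" using ln_max_weight_bound[of c] by linarith
      moreover have "- 1 \<le> (\<integral>x. ln (max_weight x) / 2 \<partial>mu_P1)"
      proof -
        interpret M: prob_space mu_P1 using M by (simp add: borel_prob_def)
        have b: "bounded_kernel (\<lambda>x y. ln (max_weight x) / 2)"
          using ln_max_weight_bound by (intro bounded_kernel_left[of _ 1]) auto
        have "(\<integral>x. -1 \<partial>mu_P1) \<le> (\<integral>x. ln (max_weight x) / 2 \<partial>mu_P1)"
          using bounded_kernel_integrable1[OF b M] ln_max_weight_bound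
          by (intro integral_mono) (auto simp: abs_le_iff minus_le_iff)
        then show ?thesis using M.prob_space by simp
      qed
      ultimately have "- 2 \<le> p n c"
        unfolding p_def delta_kernel_potential(1)[OF r] by linarith
      then show "norm (min (p n c) q) \<le> \<bar>q\<bar> + 2" by (auto simp: min_def abs_le_iff)
    qed
  qed auto
  then have "(\<lambda>n. 2 * (\<integral>c. min (p n c) q \<partial>nu) - VR) \<longlonglongrightarrow> 2 * q - VR"
    by (intro tendsto_intros) (simp add: N.prob_space)
  then have "(\<lambda>n. ereal (2 * (\<integral>c. min (p n c) q \<partial>nu) - VR)) \<longlonglongrightarrow> ereal (2 * q - VR)"
    by simp
  then have "ereal (2 * q - VR) \<le> energy nu"
    by (rule LIMSEQ_le_const2) (use bound in blast)
  also have "2 * q - VR = VR - 2 * ((1 + T) * ln (1 + T) - T * ln T)" by (simp add: q_def)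
  finally show ?thesis .
qed

subsection \<open>Polynomial approximation with Chebyshev remainders\<close>

fun ipoly :: "int list \<Rightarrow> real \<Rightarrow> real" where
  "ipoly [] x = 0"
| "ipoly (c # cs) x = of_int c + x * ipoly cs x"

fun padd :: "int list \<Rightarrow> int list \<Rightarrow> int list" where
  "padd [] bs = bs"
| "padd as [] = as"
| "padd (a # as) (b # bs) = (a + b) # padd as bs"

definition psmul :: "int \<Rightarrow> int list \<Rightarrow> int list" where
  "psmul c as = map ((*) c) as"

fun pmul :: "int list \<Rightarrow> int list \<Rightarrow> int list" where
  "pmul [] bs = []"
| "pmul (a # as) bs = padd (psmul a bs) (0 # pmul as bs)"

fun asum :: "int list \<Rightarrow> int" where
  "asum [] = 0"
| "asum (a # as) = \<bar>a\<bar> + asum as"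

text \<open>Coefficients of the derivative of \<open>x\<^sup>k\<^sup>+\<^sup>1 p(x)\<close> divided by \<open>x\<^sup>k\<close>, and of the derivative of
  \<open>x\<^sup>2\<^sup>k\<^sup>+\<^sup>1 p(x\<^sup>2)\<close> divided by \<open>x\<^sup>2\<^sup>k\<close>, as a polynomial in \<open>x\<^sup>2\<close>.\<close>

fun pder :: "int \<Rightarrow> int list \<Rightarrow> int list" where
  "pder k [] = []"
| "pder k (c # cs) = (k + 1) * c # pder (k + 1) cs"

fun oddder :: "int \<Rightarrow> int list \<Rightarrow> int list" where
  "oddder k [] = []"
| "oddder k (c # cs) = (2 * k + 1) * c # oddder (k + 1) cs"

text \<open>The pair of shifted Chebyshev polynomials \<open>T\<^sub>n(2 x - 1)\<close> and \<open>T\<^sub>n\<^sub>+\<^sub>1(2 x - 1)\<close>.\<close>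

primrec cheb2 :: "nat \<Rightarrow> int list \<times> int list" where
  "cheb2 0 = ([1], [-1, 2])"
| "cheb2 (Suc n) = (case cheb2 n of (p, q) \<Rightarrow> (q, padd (pmul [-2, 4] q) (psmul (-1) p)))"

lemma ipoly_padd: "ipoly (padd as bs) x = ipoly as x + ipoly bs x"
  by (induction as bs rule: padd.induct) (auto simp: algebra_simps)

lemma ipoly_psmul: "ipoly (psmul c as) x = of_int c * ipoly as x"
  by (induction as) (auto simp: psmul_def algebra_simps)

lemma ipoly_pmul: "ipoly (pmul as bs) x = ipoly as x * ipoly bs x"
  by (induction as) (auto simp: ipoly_padd ipoly_psmul algebra_simps)

lemma abs_ipoly_le_asum:
  assumes "0 \<le> x" "x \<le> 1"
  shows "\<bar>ipoly cs x\<bar> \<le> of_int (asum cs)"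
proof (induction cs)
  case (Cons c cs)
  have "\<bar>x * ipoly cs x\<bar> \<le> 1 * of_int (asum cs)"
    unfolding abs_mult using Cons assms by (intro mult_mono) auto
  then show ?case by simp
qed simp

lemma has_real_derivative_ipoly:
  "((\<lambda>x. x ^ Suc k * ipoly cs x) has_real_derivative x ^ k * ipoly (pder (int k) cs) x) (at x)"
proof (induction cs arbitrary: k)
  case (Cons c cs)
  have "((\<lambda>x. of_int c * x ^ Suc k + x ^ Suc (Suc k) * ipoly cs x) has_real_derivative
      of_int c * (real (Suc k) * x ^ k) + x ^ Suc k * ipoly (pder (int (Suc k)) cs) x) (at x)"
    using DERIV_pow[of "Suc k" x] by (intro DERIV_add DERIV_cmult Cons) simp
  also have "(\<lambda>x. of_int c * x ^ Suc k + x ^ Suc (Suc k) * ipoly cs x) = (\<lambda>x. x ^ Suc k * ipoly (c # cs) x)"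
    by (auto simp: algebra_simps)
  also have "of_int c * (real (Suc k) * x ^ k) + x ^ Suc k * ipoly (pder (int (Suc k)) cs) x =
      x ^ k * ipoly (pder (int k) (c # cs)) x"
    by (simp add: algebra_simps)
  finally show ?case .
qed simp

lemma has_real_derivative_ipoly_sq:
  "((\<lambda>x. x ^ (2 * k + 1) * ipoly cs (x\<^sup>2)) has_real_derivative x ^ (2 * k) * ipoly (oddder (int k) cs) (x\<^sup>2)) (at x)"
proof (induction cs arbitrary: k)
  case (Cons c cs)
  have "((\<lambda>x. of_int c * x ^ (2 * k + 1) + x ^ (2 * Suc k + 1) * ipoly cs (x\<^sup>2)) has_real_derivative
      of_int c * (real (2 * k + 1) * x ^ (2 * k)) + x ^ (2 * Suc k) * ipoly (oddder (int (Suc k)) cs) (x\<^sup>2)) (at x)"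
    using DERIV_pow[of "2 * k + 1" x] by (intro DERIV_add DERIV_cmult Cons) simp
  also have "(\<lambda>x. of_int c * x ^ (2 * k + 1) + x ^ (2 * Suc k + 1) * ipoly cs (x\<^sup>2)) =
      (\<lambda>x. x ^ (2 * k + 1) * ipoly (c # cs) (x\<^sup>2))"
    by (auto simp: algebra_simps power2_eq_square)
  also have "of_int c * (real (2 * k + 1) * x ^ (2 * k)) + x ^ (2 * Suc k) * ipoly (oddder (int (Suc k)) cs) (x\<^sup>2) =
      x ^ (2 * k) * ipoly (oddder (int k) (c # cs)) (x\<^sup>2)"
    by (simp add: algebra_simps power2_eq_square)
  finally show ?case .
qed simp

lemma ipoly_cheb2:
  "ipoly (fst (cheb2 n)) ((1 + cos t) / 2) = cos (real n * t)"
  "ipoly (snd (cheb2 n)) ((1 + cos t) / 2) = cos (real (Suc n) * t)"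
proof (induction n)
  case (Suc n)
  obtain p q where pq: "cheb2 n = (p, q)" by (cases "cheb2 n")
  have "cos (real (Suc n) * t + t) + cos (real (Suc n) * t - t) = 2 * cos t * cos (real (Suc n) * t)"
    by (simp add: cos_add cos_diff)
  moreover have "real (Suc n) * t + t = real (Suc (Suc n)) * t" "real (Suc n) * t - t = real n * t"
    by (simp_all add: algebra_simps)
  ultimately have "cos (real (Suc (Suc n)) * t) = 2 * cos t * cos (real (Suc n) * t) - cos (real n * t)"
    by (simp only:)
  moreover have "ipoly [-2, 4] ((1 + cos t) / 2) = 2 * cos t" by (simp add: field_simps)
  ultimately show "ipoly (snd (cheb2 (Suc n))) ((1 + cos t) / 2) = cos (real (Suc (Suc n)) * t)"
    using Suc unfolding pq cheb2.simps by (simp only: ipoly_padd ipoly_psmul ipoly_pmul prod.case fst_conv snd_conv)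
  show "ipoly (fst (cheb2 (Suc n))) ((1 + cos t) / 2) = cos (real (Suc n) * t)"
    using Suc unfolding pq cheb2.simps by (simp only: prod.case fst_conv snd_conv)
qed (auto simp: field_simps)

lemma abs_cheb2_le_1:
  assumes "0 \<le> x" "x \<le> 1"
  shows "\<bar>ipoly (fst (cheb2 n)) x\<bar> \<le> 1" "\<bar>ipoly (snd (cheb2 n)) x\<bar> \<le> 1"
proof -
  define t where "t = arccos (2 * x - 1)"
  have "x = (1 + cos t) / 2" using assms by (simp add: t_def cos_arccos)
  then show "\<bar>ipoly (fst (cheb2 n)) x\<bar> \<le> 1" "\<bar>ipoly (snd (cheb2 n)) x\<bar> \<le> 1"
    by (simp_all only: ipoly_cheb2 abs_cos_le_one)
qed

text \<open>The sum of the absolute coefficients of \<open>10\<^sup>8 num - p den\<close> after subtraction of a combination of two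
  Chebyshev polynomials, everything scaled by \<open>10\<^sup>1\<^sup>2\<close>: the Chebyshev coefficients of the residual are
  small while its coefficients in the monomial basis are not.\<close>

definition cheb_remainder :: "int list \<Rightarrow> int list \<Rightarrow> int list \<Rightarrow> nat \<Rightarrow> int \<Rightarrow> int \<Rightarrow> int" where
  "cheb_remainder num den p n s t =
     asum (padd (psmul (10 ^ 12) (padd (psmul (10 ^ 8) num) (psmul (-1) (pmul p den))))
       (padd (psmul (- s) (snd (cheb2 n))) (psmul (- t) (fst (cheb2 n)))))"

text \<open>Since the denominator is at least 1, the error of the quotient is at most that of the
  polynomial residual. The scale 10^20 combines 10^8 for the coefficients of p with 10^12 for the
  Chebyshev coefficients s and t.\<close>

lemma rational_approx:
  assumes x: "0 \<le> x" "x \<le> 1" and den: "1 \<le> ipoly den x"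
    and le: "cheb_remainder num den p n s t + \<bar>s\<bar> + \<bar>t\<bar> \<le> e"
  shows "\<bar>ipoly num x / ipoly den x - ipoly p x / 100000000\<bar> \<le> of_int e / 10 ^ 20"
proof -
  define D where "D = 10 ^ 8 * ipoly num x - ipoly p x * ipoly den x"
  define u v where "u = ipoly (fst (cheb2 n)) x" and "v = ipoly (snd (cheb2 n)) x"
  have "\<bar>10 ^ 12 * D + (- of_int s * v + - of_int t * u)\<bar> \<le> of_int (cheb_remainder num den p n s t)"
    unfolding cheb_remainder_def
    by (rule order_trans[OF _ abs_ipoly_le_asum[OF x]])
       (simp add: ipoly_padd ipoly_psmul ipoly_pmul D_def u_def v_def)
  moreover have "\<bar>of_int s * v\<bar> \<le> \<bar>of_int s\<bar> * 1" "\<bar>of_int t * u\<bar> \<le> \<bar>of_int t\<bar> * 1"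
    unfolding abs_mult u_def v_def by (intro mult_left_mono abs_cheb2_le_1 x; simp)+
  moreover have "of_int (cheb_remainder num den p n s t) + \<bar>of_int s\<bar> + \<bar>of_int t\<bar> \<le> (of_int e :: real)"
    using le by linarith
  ultimately have "\<bar>10 ^ 12 * D\<bar> \<le> of_int e" by linarith
  then have D: "\<bar>D\<bar> \<le> of_int e / 10 ^ 12" by (simp add: abs_mult)
  have "ipoly num x / ipoly den x - ipoly p x / 100000000 = D / (10 ^ 8 * ipoly den x)"
    using den by (simp add: D_def field_simps)
  also have "\<bar>\<dots>\<bar> \<le> \<bar>D\<bar> / 10 ^ 8"
    using den divide_left_mono[of 1 "ipoly den x" "\<bar>D\<bar>"] by (simp add: abs_mult)
  also have "\<dots> \<le> (of_int e / 10 ^ 12) / 10 ^ 8" using D by (rule divide_right_mono) simp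
  finally show ?thesis by simp
qed

lemma abs_divide_le: "0 < d \<Longrightarrow> \<bar>a\<bar> \<le> c * d \<Longrightarrow> \<bar>a / d\<bar> \<le> c" for a c d :: real
  by (simp add: abs_divide pos_divide_le_eq)

lemma abs_diff_le_of_deriv:
  fixes h h' :: "real \<Rightarrow> real"
  assumes "0 \<le> x" "\<And>y. 0 \<le> y \<Longrightarrow> y \<le> x \<Longrightarrow> (h has_real_derivative h' y) (at y)"
    and "\<And>y. 0 \<le> y \<Longrightarrow> y \<le> x \<Longrightarrow> \<bar>h' y\<bar> \<le> e"
  shows "\<bar>h x - h 0\<bar> \<le> e * x"
  using field_differentiable_bound[of "{0..x}" h h' e x 0] assms
  by (auto intro: has_field_derivative_at_within)

text \<open>Coefficients scaled by \<open>10\<^sup>8\<close>, obtained from Lanczos' tau method: the residual \<open>num - p den\<close> is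
  required to be a combination of the two Chebyshev polynomials of highest degree.\<close>

definition "list_SC = [599922634, 712244436, -8262793065, 34631895993, -96480467758, 192828242015,
  -279952357839, 292408691511, -213799320209, 103730171158, -29969273458, 3899618441 :: int]"
definition "list_DC = [-400173658, 1482024131, -3707567214, 4087793010, 10073856542, -58393991333,
  138897242193, -201755821648, 189447059178, -112547790705, 38563748434, -5815693615 :: int]"
definition "list_SA = [24000159, 1117613, -491865, 60091 :: int]"
definition "list_DA = [-80001162, 11745922, -1089381, 29917 :: int]"

text \<open>The quotient is the derivative of the function \<open>SC\<close> introduced below.
  Approximating derivatives and integrating from 0 gives an error proportional to the argument,
  which the fold weight makes considerably smaller after integration than a constant error of the
  same size.\<close>

lemma list_SC_deriv:
  assumes "0 \<le> x" "x \<le> 1"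
  shows "\<bar>(6 + 50 * x) / (1 + 6 * x + 25 * x\<^sup>2) - ipoly (pder 0 list_SC) x / 100000000\<bar> \<le> 78 / 100000"
proof -
  \<comment> \<open>The residual has degree 11 + 2, so T_13 and T_12 are the two highest Chebyshev
    polynomials. The poles (-3 + 4 i) / 25 and (-3 - 4 i) / 25 have modulus 1 / 5, which forces this
    degree; for \<open>list_SA\<close> and \<open>list_DA\<close> they are at distance 5 from the
    origin and four coefficients suffice.\<close>
  have r: "cheb_remainder [6, 50] [1, 6, 25] (pder 0 list_SC) 12 (-34865305792159380) 42500700089828886
      + \<bar>-34865305792159380\<bar> + \<bar>42500700089828886\<bar> \<le> 78000000000000000"
    by code_simp
  have d: "1 \<le> ipoly [1, 6, 25] x" using assms by simp
  from rational_approx[OF assms d r] show ?thesis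
    by (simp add: algebra_simps power2_eq_square)
qed

lemma list_DC_deriv:
  assumes "0 \<le> x" "x \<le> 1"
  shows "\<bar>(- 4 + 20 * x) / (1 + 6 * x + 25 * x\<^sup>2) - ipoly (oddder 0 list_DC) x / 100000000\<bar> \<le> 374 / 100000"
proof -
  have r: "cheb_remainder [-4, 20] [1, 6, 25] (oddder 0 list_DC) 12 99659676210718836 273317417716351048
      + \<bar>99659676210718836\<bar> + \<bar>273317417716351048\<bar> \<le> 374000000000000000"
    by code_simp
  have d: "1 \<le> ipoly [1, 6, 25] x" using assms by simp
  from rational_approx[OF assms d r] show ?thesis
    by (simp add: algebra_simps power2_eq_square)
qed

lemma list_SA_deriv:
  assumes "0 \<le> x" "x \<le> 1"
  shows "\<bar>(6 + 2 * x) / (25 + 6 * x + x\<^sup>2) - ipoly (pder 0 list_SA) x / 100000000\<bar> \<le> 5 / 100000"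
proof -
  have r: "cheb_remainder [6, 2] [25, 6, 1] (pder 0 list_SA) 4 (-469463606324570) (-4433665026201863)
      + \<bar>-469463606324570\<bar> + \<bar>-4433665026201863\<bar> \<le> 5000000000000000"
    by code_simp
  have d: "1 \<le> ipoly [25, 6, 1] x" using assms by simp
  from rational_approx[OF assms d r] show ?thesis
    by (simp add: algebra_simps power2_eq_square)
qed

lemma list_DA_deriv:
  assumes "0 \<le> x" "x \<le> 1"
  shows "\<bar>(- 20 + 4 * x) / (25 + 6 * x + x\<^sup>2) - ipoly (oddder 0 list_DA) x / 100000000\<bar> \<le> 30 / 100000"
proof -
  have r: "cheb_remainder [-20, 4] [25, 6, 1] (oddder 0 list_DA) 4 (-409020125277427) 28647252945545414
      + \<bar>-409020125277427\<bar> + \<bar>28647252945545414\<bar> \<le> 30000000000000000"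
    by code_simp
  have d: "1 \<le> ipoly [25, 6, 1] x" using assms by simp
  from rational_approx[OF assms d r] show ?thesis
    by (simp add: algebra_simps power2_eq_square)
qed

subsection \<open>Folding the real line\<close>

lemma nn_integral_set_lborel:
  fixes h :: "real \<Rightarrow> real"
  assumes [measurable]: "h \<in> borel_measurable borel" "A \<in> sets borel" and nonneg: "\<And>x. x \<in> A \<Longrightarrow> 0 \<le> h x"
  shows "h absolutely_integrable_on A \<Longrightarrow> (\<integral>\<^sup>+x. ennreal (h x) * indicator A x \<partial>lborel) = ennreal (integral A h)"
    and "(\<integral>\<^sup>+x. ennreal (h x) * indicator A x \<partial>lborel) < \<infinity> \<Longrightarrow> h absolutely_integrable_on A"
proof -
  let ?f = "\<lambda>x. indicator A x * h x"
  have f0: "0 \<le> ?f x" for x using nonneg by (auto split: split_indicator)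
  have nn: "(\<integral>\<^sup>+x. ennreal (h x) * indicator A x \<partial>lborel) = (\<integral>\<^sup>+x. ennreal (?f x) \<partial>lborel)"
    by (intro nn_integral_cong) (auto split: split_indicator)
  have iff: "h absolutely_integrable_on A \<longleftrightarrow> integrable lborel ?f"
    unfolding set_integrable_def real_scaleR_def by (rule integrable_completion) measurable
  {
    assume h: "h absolutely_integrable_on A"
    have "integral A h = (\<integral>x. ?f x \<partial>lebesgue)"
      using set_lebesgue_integral_eq_integral(2)[OF h] by (simp add: set_lebesgue_integral_def)
    also have "\<dots> = (\<integral>x. ?f x \<partial>lborel)" by (rule integral_completion) measurable
    finally show "(\<integral>\<^sup>+x. ennreal (h x) * indicator A x \<partial>lborel) = ennreal (integral A h)"
      unfolding nn using h f0 by (subst nn_integral_eq_integral) (auto simp: iff)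
  next
    assume "(\<integral>\<^sup>+x. ennreal (h x) * indicator A x \<partial>lborel) < \<infinity>"
    then show "h absolutely_integrable_on A"
      unfolding iff nn using f0 by (intro integrableI_nonneg) auto
  }
qed

text \<open>Absolute integrability is equivalent on the two sides. When it fails, non-negativity
  makes both integrals infinite, so the equation holds without an integrability hypothesis.\<close>

lemma nn_integral_change_of_variables_real:
  fixes f g g' :: "real \<Rightarrow> real"
  assumes [measurable]: "f \<in> borel_measurable borel" "g \<in> borel_measurable borel" "g' \<in> borel_measurable borel"
      "S \<in> sets borel" "I \<in> sets borel"
    and I: "g ` S = I" and inj: "inj_on g S"
    and der: "\<And>x. x \<in> S \<Longrightarrow> (g has_real_derivative g' x) (at x)"
    and nonneg: "\<And>x. x \<in> I \<Longrightarrow> 0 \<le> f x"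
  shows "(\<integral>\<^sup>+x. ennreal (f x) * indicator I x \<partial>lborel) = (\<integral>\<^sup>+x. ennreal (\<bar>g' x\<bar> * f (g x)) * indicator S x \<partial>lborel)"
proof -
  have iff: "(\<lambda>x. \<bar>g' x\<bar> * f (g x)) absolutely_integrable_on S \<and> integral S (\<lambda>x. \<bar>g' x\<bar> * f (g x)) = b
     \<longleftrightarrow> f absolutely_integrable_on I \<and> integral I f = b" for b
    unfolding I[symmetric]
  proof (rule has_absolute_integral_change_of_variables_1')
    have "S \<in> sets lborel" by simp
    then show "S \<in> sets lebesgue" by (rule sets_completionI_sets)
    show "(g has_real_derivative g' x) (at x within S)" if "x \<in> S" for x
      using der[OF that] by (rule has_field_derivative_at_within)
  qed (rule inj)
  have nonneg': "0 \<le> \<bar>g' x\<bar> * f (g x)" if "x \<in> S" for x using nonneg I that by auto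
  note a = nn_integral_set_lborel[of f I, OF _ _ nonneg]
  note b = nn_integral_set_lborel[of "\<lambda>x. \<bar>g' x\<bar> * f (g x)" S, OF _ _ nonneg']
  show ?thesis
  proof (cases "f absolutely_integrable_on I")
    case True
    with iff[of "integral I f"] show ?thesis using a(1) b(1) by simp
  next
    case False
    then have "\<not> (\<lambda>x. \<bar>g' x\<bar> * f (g x)) absolutely_integrable_on S"
      using iff[of "integral S (\<lambda>x. \<bar>g' x\<bar> * f (g x))"] by simp
    then have "(\<integral>\<^sup>+x. ennreal (\<bar>g' x\<bar> * f (g x)) * indicator S x \<partial>lborel) = \<infinity>"
      using b(2) by (auto simp: less_top[symmetric])
    moreover have "(\<integral>\<^sup>+x. ennreal (f x) * indicator I x \<partial>lborel) = \<infinity>"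
      using False a(2) by (auto simp: less_top[symmetric])
    ultimately show ?thesis by (simp only:)
  qed
qed

text \<open>This is tanh (l / 2), and \<open>fold_weight\<close> is l / (2 sinh l). Every non-zero
  real number other than 1 and -1 is plus or minus tanh (l / 2) or its reciprocal for exactly one l
  > 0.\<close>

definition fold_map :: "real \<Rightarrow> real" where
  "fold_map l = (1 - exp (- l)) / (1 + exp (- l))"

definition fold_weight :: "real \<Rightarrow> real" where
  "fold_weight l = l * exp (- l) / (1 - (exp (- l))\<^sup>2)"

lemma fold_map_measurable [measurable]: "fold_map \<in> borel_measurable borel"
  and fold_weight_measurable [measurable]: "fold_weight \<in> borel_measurable borel"
  unfolding fold_map_def fold_weight_def by measurable

text \<open>At z = tanh (l / 2) and at its reciprocal, |(z + 1) / (z - 1)| equals e^l, so the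
  logarithm in the density is exactly l. Both branches give the same weight after multiplication by
  the Jacobian.\<close>

lemma mu_R_density_fold:
  assumes "0 < l"
  shows "2 * exp (- l) / (1 + exp (- l))\<^sup>2 * mu_R_density (fold_map l) = 2 / pi\<^sup>2 * fold_weight l"
    and "2 * exp (- l) / (1 - exp (- l))\<^sup>2 * mu_R_density (1 / fold_map l) = 2 / pi\<^sup>2 * fold_weight l"
proof -
  define v where "v = exp (- l)"
  have v: "0 < v" "v < 1" using assms by (auto simp: v_def)
  have l: "l = ln (1 / v)" by (simp add: v_def ln_div)
  have vv: "1 - v\<^sup>2 = (1 - v) * (1 + v)" by (simp add: power2_eq_square algebra_simps)
  have e1: "(1 - v) / (1 + v) + 1 = 2 / (1 + v)" "(1 - v) / (1 + v) - 1 = - (2 * v / (1 + v))"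
    "(1 + v) / (1 - v) + 1 = 2 / (1 - v)" "(1 + v) / (1 - v) - 1 = 2 * v / (1 - v)"
    using v by (auto simp: field_simps)
  have r1: "\<bar>((1 - v) / (1 + v) + 1) / ((1 - v) / (1 + v) - 1)\<bar> = 1 / v"
  proof -
    have "2 / w / - (2 * v / w) = - (1 / v)" if "w > 0" for w using that v by simp
    from this[of "1 + v"] show ?thesis unfolding e1 using v by simp
  qed
  have r2: "\<bar>((1 + v) / (1 - v) + 1) / ((1 + v) / (1 - v) - 1)\<bar> = 1 / v"
  proof -
    have "2 / w / (2 * v / w) = 1 / v" if "w > 0" for w using that v by simp
    from this[of "1 - v"] show ?thesis unfolding e1 using v by simp
  qed
  have d1: "mu_R_density ((1 - v) / (1 + v)) = 1 / (pi\<^sup>2 * ((1 - v) / (1 + v))) * l"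
    unfolding mu_R_density_def r1 l by simp
  have d2: "mu_R_density ((1 + v) / (1 - v)) = 1 / (pi\<^sup>2 * ((1 + v) / (1 - v))) * l"
    unfolding mu_R_density_def r2 l by simp
  have w: "fold_weight l = l * v / ((1 - v) * (1 + v))"
    by (simp add: fold_weight_def v_def[symmetric] vv)
  have m: "fold_map l = (1 - v) / (1 + v)" "1 / fold_map l = (1 + v) / (1 - v)"
    by (auto simp: fold_map_def v_def)
  show "2 * exp (- l) / (1 + exp (- l))\<^sup>2 * mu_R_density (fold_map l) = 2 / pi\<^sup>2 * fold_weight l"
    unfolding m v_def[symmetric] d1 w using v by (simp add: power2_eq_square) (simp only: mult_ac)
  show "2 * exp (- l) / (1 - exp (- l))\<^sup>2 * mu_R_density (1 / fold_map l) = 2 / pi\<^sup>2 * fold_weight l"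
    unfolding m(2) v_def[symmetric] d2 w using v by (simp add: power2_eq_square) (simp only: mult_ac)
qed

lemma fold_weight_nonneg: "0 < l \<Longrightarrow> 0 \<le> fold_weight l"
  unfolding fold_weight_def by (intro divide_nonneg_nonneg) (auto simp: power_le_one)

lemma mu_R_density_nonneg:
  assumes "0 < x" shows "0 \<le> mu_R_density x"
proof (cases "x = 1")
  case False
  have "1 \<le> \<bar>(x + 1) / (x - 1)\<bar>" using assms False by (simp add: abs_divide)
  then show ?thesis unfolding mu_R_density_def using assms by (intro mult_nonneg_nonneg ln_ge_zero) auto
qed (simp add: mu_R_density_def)

lemma inj_on_fold_map: "inj_on fold_map {0<..}"
proof (rule inj_onI)
  fix x y :: real assume eq: "fold_map x = fold_map y"
  have "1 + exp (- x) \<noteq> 0" "1 + exp (- y) \<noteq> 0"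
    using exp_gt_zero[of "- x"] exp_gt_zero[of "- y"] by linarith+
  then have "(1 - exp (- x)) * (1 + exp (- y)) = (1 - exp (- y)) * (1 + exp (- x))"
    using eq by (simp add: fold_map_def frac_eq_eq)
  then show "x = y" by (simp add: algebra_simps)
qed

lemma fold_map_image: "fold_map ` {0<..} = {0<..<1}"
proof (intro equalityI subsetI)
  fix y assume "y \<in> fold_map ` {0<..}"
  then obtain l where l: "l > 0" "y = fold_map l" by auto
  define v where "v = exp (- l)"
  have "0 < v" "v < 1" using l by (auto simp: v_def)
  then show "y \<in> {0<..<1}" unfolding l(2) fold_map_def v_def[symmetric] by auto
next
  fix y :: real assume y: "y \<in> {0<..<1}"
  define l where "l = ln ((1 + y) / (1 - y))"
  have "1 < (1 + y) / (1 - y)" using y by (auto simp: field_simps)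
  then have l: "l > 0" by (simp add: l_def)
  have e: "exp (- l) = (1 - y) / (1 + y)" using y by (simp add: l_def exp_minus)
  have "fold_map l = y" unfolding fold_map_def e using y by (simp add: field_simps)
  then show "y \<in> fold_map ` {0<..}" using l by auto
qed

lemma inverse_fold_map_image: "(\<lambda>l. 1 / fold_map l) ` {0<..} = {1<..}"
proof -
  have "(\<lambda>l. 1 / fold_map l) ` {0<..} = (\<lambda>y. 1 / y) ` {0<..<1}"
    by (simp flip: fold_map_image add: image_image)
  also have "\<dots> = {1<..}"
  proof (intro equalityI subsetI)
    fix y :: real assume "y \<in> {1<..}"
    then have "y = 1 / (1 / y)" "1 / y \<in> {0<..<1}" by auto
    then show "y \<in> (\<lambda>y. 1 / y) ` {0<..<1}" by blast
  qed auto
  finally show ?thesis .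
qed

lemma fold_map_deriv:
  assumes "0 < l"
  shows "(fold_map has_real_derivative 2 * exp (- l) / (1 + exp (- l))\<^sup>2) (at l)"
    and "((\<lambda>l. 1 / fold_map l) has_real_derivative - (2 * exp (- l) / (1 - exp (- l))\<^sup>2)) (at l)"
proof -
  have v: "0 < exp (- l)" "exp (- l) < 1" using assms by auto
  show "(fold_map has_real_derivative 2 * exp (- l) / (1 + exp (- l))\<^sup>2) (at l)"
  proof -
    have "1 + exp (- l) \<noteq> 0" using v by linarith
    then show ?thesis unfolding fold_map_def[abs_def]
      by (auto intro!: derivative_eq_intros simp: power2_eq_square field_simps)
  qed
  have "((\<lambda>l. (1 + exp (- l)) / (1 - exp (- l))) has_real_derivative - (2 * exp (- l) / (1 - exp (- l))\<^sup>2)) (at l)"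
    using v by (auto intro!: derivative_eq_intros simp: power2_eq_square field_simps)
  then show "((\<lambda>l. 1 / fold_map l) has_real_derivative - (2 * exp (- l) / (1 - exp (- l))\<^sup>2)) (at l)"
    by (simp add: fold_map_def)
qed

lemma nn_integral_mu_R_fold:
  fixes g :: "real \<Rightarrow> real"
  assumes [measurable]: "g \<in> borel_measurable borel" and g: "\<And>x. 0 \<le> g x"
  shows "(\<integral>\<^sup>+x. ennreal (g x) \<partial>mu_R) = (\<integral>\<^sup>+l. ennreal (2 / pi\<^sup>2 * fold_weight l *
     (g (fold_map l) + g (- fold_map l) + g (1 / fold_map l) + g (- (1 / fold_map l)))) * indicator {0<..} l \<partial>lborel)"
proof -
  define F where "F x = mu_R_density x * (g x + g (- x))" for x
  have [measurable]: "F \<in> borel_measurable borel" unfolding F_def by measurable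
  have F0: "0 \<le> F x" if "0 < x" for x
    unfolding F_def using g mu_R_density_nonneg[OF that] by (intro mult_nonneg_nonneg add_nonneg_nonneg)
  define H where "H x = ennreal (mu_R_density x) * ennreal (g x)" for x
  have [measurable]: "H \<in> borel_measurable borel" unfolding H_def by measurable
  have "(\<integral>\<^sup>+x. ennreal (g x) \<partial>mu_R) = (\<integral>\<^sup>+x. H x \<partial>lborel)"
    unfolding mu_R_eq H_def by (rule nn_integral_density) auto
  also have "\<dots> = (\<integral>\<^sup>+x. H x * indicator {0<..} x + H x * indicator {..<0} x \<partial>lborel)"
  proof (rule nn_integral_cong_AE)
    have "AE x::real in lborel. x \<noteq> 0" by (rule AE_lborel_singleton)
    then show "AE x in lborel. H x = H x * indicator {0<..} x + H x * indicator {..<0} x"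
      by eventually_elim (auto split: split_indicator)
  qed
  also have "\<dots> = (\<integral>\<^sup>+x. H x * indicator {0<..} x \<partial>lborel) + (\<integral>\<^sup>+x. H x * indicator {..<0} x \<partial>lborel)"
    by (rule nn_integral_add) auto
  also have "(\<integral>\<^sup>+x. H x * indicator {..<0} x \<partial>lborel) = (\<integral>\<^sup>+x. H (0 + -1 * x) * indicator {..<0} (0 + -1 * x) \<partial>lborel)"
    by (subst nn_integral_real_affine[where c = "-1" and t = 0]) auto
  also have "(\<integral>\<^sup>+x. H x * indicator {0<..} x \<partial>lborel) + (\<integral>\<^sup>+x. H (0 + -1 * x) * indicator {..<0} (0 + -1 * x) \<partial>lborel) =
     (\<integral>\<^sup>+x. H x * indicator {0<..} x + H (0 + -1 * x) * indicator {..<0} (0 + -1 * x) \<partial>lborel)"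
    by (rule nn_integral_add[symmetric]) auto
  also have "\<dots> = (\<integral>\<^sup>+x. ennreal (F x) * indicator {0<..<1} x + ennreal (F x) * indicator {1<..} x \<partial>lborel)"
  proof (rule nn_integral_cong_AE)
    have HF: "H x + H (- x) = ennreal (F x)" if "0 < x" for x
      using g mu_R_density_nonneg[OF that] unfolding H_def F_def mu_R_density_even
      by (simp add: distrib_left ennreal_plus ennreal_mult'')
    have "AE x::real in lborel. x \<noteq> 1" by (rule AE_lborel_singleton)
    then show "AE x in lborel. H x * indicator {0<..} x + H (0 + -1 * x) * indicator {..<0} (0 + -1 * x) =
        ennreal (F x) * indicator {0<..<1} x + ennreal (F x) * indicator {1<..} x"
      by eventually_elim (auto simp: HF split: split_indicator)
  qed
  also have "\<dots> = (\<integral>\<^sup>+x. ennreal (F x) * indicator {0<..<1} x \<partial>lborel) + (\<integral>\<^sup>+x. ennreal (F x) * indicator {1<..} x \<partial>lborel)"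
    by (rule nn_integral_add) auto
  also have "(\<integral>\<^sup>+x. ennreal (F x) * indicator {0<..<1} x \<partial>lborel) =
      (\<integral>\<^sup>+l. ennreal (\<bar>2 * exp (- l) / (1 + exp (- l))\<^sup>2\<bar> * F (fold_map l)) * indicator {0<..} l \<partial>lborel)"
    by (rule nn_integral_change_of_variables_real)
       (auto simp: fold_map_image inj_on_fold_map F0 intro!: fold_map_deriv)
  also have "(\<integral>\<^sup>+x. ennreal (F x) * indicator {1<..} x \<partial>lborel) =
      (\<integral>\<^sup>+l. ennreal (\<bar>- (2 * exp (- l) / (1 - exp (- l))\<^sup>2)\<bar> * F (1 / fold_map l)) * indicator {0<..} l \<partial>lborel)"
  proof (rule nn_integral_change_of_variables_real)
    show "inj_on (\<lambda>l. 1 / fold_map l) {0<..}"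
      using inj_on_fold_map by (auto simp: inj_on_def)
    show "(\<lambda>l. 1 / fold_map l) ` {0<..} = {1<..}" by (rule inverse_fold_map_image)
  qed (use F0 fold_map_deriv in auto)
  also have "(\<integral>\<^sup>+l. ennreal (\<bar>2 * exp (- l) / (1 + exp (- l))\<^sup>2\<bar> * F (fold_map l)) * indicator {0<..} l \<partial>lborel) +
      (\<integral>\<^sup>+l. ennreal (\<bar>- (2 * exp (- l) / (1 - exp (- l))\<^sup>2)\<bar> * F (1 / fold_map l)) * indicator {0<..} l \<partial>lborel) =
      (\<integral>\<^sup>+l. ennreal (\<bar>2 * exp (- l) / (1 + exp (- l))\<^sup>2\<bar> * F (fold_map l)) * indicator {0<..} l +
       ennreal (\<bar>- (2 * exp (- l) / (1 - exp (- l))\<^sup>2)\<bar> * F (1 / fold_map l)) * indicator {0<..} l \<partial>lborel)"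
    by (rule nn_integral_add[symmetric]) auto
  also have "\<dots> = (\<integral>\<^sup>+l. ennreal (2 / pi\<^sup>2 * fold_weight l *
     (g (fold_map l) + g (- fold_map l) + g (1 / fold_map l) + g (- (1 / fold_map l)))) * indicator {0<..} l \<partial>lborel)"
  proof (rule nn_integral_cong)
    fix l :: real
    show "ennreal (\<bar>2 * exp (- l) / (1 + exp (- l))\<^sup>2\<bar> * F (fold_map l)) * indicator {0<..} l +
       ennreal (\<bar>- (2 * exp (- l) / (1 - exp (- l))\<^sup>2)\<bar> * F (1 / fold_map l)) * indicator {0<..} l =
      ennreal (2 / pi\<^sup>2 * fold_weight l *
       (g (fold_map l) + g (- fold_map l) + g (1 / fold_map l) + g (- (1 / fold_map l)))) * indicator {0<..} l"
    proof (cases "0 < l")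
      case True
      define c where "c = 2 / pi\<^sup>2 * fold_weight l"
      have c: "c \<ge> 0" using fold_weight_nonneg[OF True] by (simp add: c_def)
      have a: "\<bar>2 * exp (- l) / (1 + exp (- l))\<^sup>2\<bar> = 2 * exp (- l) / (1 + exp (- l))\<^sup>2"
        "\<bar>- (2 * exp (- l) / (1 - exp (- l))\<^sup>2)\<bar> = 2 * exp (- l) / (1 - exp (- l))\<^sup>2" by auto
      have 1: "\<bar>2 * exp (- l) / (1 + exp (- l))\<^sup>2\<bar> * F (fold_map l) = c * (g (fold_map l) + g (- fold_map l))"
        unfolding a F_def mult.assoc[symmetric] mu_R_density_fold(1)[OF True] c_def ..
      have 2: "\<bar>- (2 * exp (- l) / (1 - exp (- l))\<^sup>2)\<bar> * F (1 / fold_map l) =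
          c * (g (1 / fold_map l) + g (- (1 / fold_map l)))"
        unfolding a F_def mult.assoc[symmetric] mu_R_density_fold(2)[OF True] c_def ..
      have "ennreal (c * (g (fold_map l) + g (- fold_map l))) + ennreal (c * (g (1 / fold_map l) + g (- (1 / fold_map l)))) =
         ennreal (c * (g (fold_map l) + g (- fold_map l) + g (1 / fold_map l) + g (- (1 / fold_map l))))"
        using c g by (subst ennreal_plus[symmetric]) (auto simp: algebra_simps)
      then show ?thesis using True unfolding 1 2 c_def[symmetric] by simp
    qed simp
  qed
  finally show ?thesis .
qed

text \<open>Dirichlet's lambda function, (1 - 2^(-m)) zeta(m) for m >= 2.\<close>

definition odd_zeta :: "nat \<Rightarrow> real" where
  "odd_zeta m = (\<Sum>j. 1 / real (2 * j + 1) ^ m)"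

lemma nn_integral_power_times_exp:
  fixes n :: real
  assumes n: "0 < n"
  shows "(\<integral>\<^sup>+l. ennreal (l ^ m * exp (- (n * l))) * indicator {0<..} l \<partial>lborel) = ennreal (fact m / n ^ Suc m)"
proof -
  let ?f = "\<lambda>x. ennreal (x ^ m * exp (- x)) * indicator {0..} x"
  let ?I = "\<integral>\<^sup>+l. ennreal (l ^ m * exp (- (n * l))) * indicator {0<..} l \<partial>lborel"
  have "ennreal (fact m) = (\<integral>\<^sup>+x. ?f x \<partial>lborel)"
    using nn_intergal_power_times_exp_Ici[of m] by simp
  also have "\<dots> = ennreal \<bar>n\<bar> * (\<integral>\<^sup>+x. ?f (0 + n * x) \<partial>lborel)"
    using n by (intro nn_integral_real_affine) auto
  also have "(\<integral>\<^sup>+x. ?f (0 + n * x) \<partial>lborel) =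
      (\<integral>\<^sup>+x. ennreal (n ^ m) * (ennreal (x ^ m * exp (- (n * x))) * indicator {0<..} x) \<partial>lborel)"
  proof (rule nn_integral_cong_AE)
    have "AE x::real in lborel. x \<noteq> 0" by (rule AE_lborel_singleton)
    then show "AE x in lborel. ?f (0 + n * x) = ennreal (n ^ m) * (ennreal (x ^ m * exp (- (n * x))) * indicator {0<..} x)"
    proof eventually_elim
      case (elim x)
      show ?case
      proof (cases "0 < x")
        case True
        have "ennreal ((n * x) ^ m * exp (- (n * x))) = ennreal (n ^ m) * ennreal (x ^ m * exp (- (n * x)))"
          using n by (subst ennreal_mult'[symmetric]) (auto simp: power_mult_distrib mult.assoc)
        then show ?thesis using True n by simp
      next
        case False
        then show ?thesis using elim n by (auto simp: zero_le_mult_iff split: split_indicator)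
      qed
    qed
  qed
  also have "\<dots> = ennreal (n ^ m) * ?I" by (rule nn_integral_cmult) auto
  also have "ennreal \<bar>n\<bar> * (ennreal (n ^ m) * ?I) = ennreal (n ^ Suc m) * ?I"
    using n by (simp add: ennreal_mult' mult.assoc)
  finally have eq: "ennreal (fact m) = ennreal (n ^ Suc m) * ?I" .
  have "?I = ennreal (1 / n ^ Suc m) * (ennreal (n ^ Suc m) * ?I)"
    using n by (simp add: mult.assoc[symmetric] ennreal_mult'[symmetric] del: power_Suc)
  also have "\<dots> = ennreal (1 / n ^ Suc m) * ennreal (fact m)" by (simp only: eq)
  also have "\<dots> = ennreal (1 / n ^ Suc m * fact m)"
    using n by (intro ennreal_mult'[symmetric]) auto
  finally show ?thesis by simp
qed

lemma summable_odd_zeta: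
  assumes "2 \<le> m" shows "summable (\<lambda>j. 1 / real (2 * j + 1) ^ m)"
proof (rule summable_comparison_test'[of "\<lambda>j. 1 / real (Suc j) ^ m" 0])
  have "summable (\<lambda>n. inverse (real n ^ m))" using assms by (rule inverse_power_summable)
  then have "summable (\<lambda>n. inverse (real (Suc n) ^ m))" by (subst summable_Suc_iff)
  then show "summable (\<lambda>j. 1 / real (Suc j) ^ m)" by (simp only: inverse_eq_divide)
  show "norm (1 / real (2 * j + 1) ^ m) \<le> 1 / real (Suc j) ^ m" for j
    by (simp add: divide_left_mono power_mono)
qed

text \<open>The moment of l^(m - 1) e^(-2 k l) against \<open>fold_weight\<close> for m >= 1: the
  index m counts the factor l contained in the weight.\<close>

definition fold_moment :: "nat \<Rightarrow> nat \<Rightarrow> real" where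
  "fold_moment m k = fact m * (odd_zeta (Suc m) - (\<Sum>j<k. 1 / real (2 * j + 1) ^ Suc m))"

text \<open>The geometric series for 1 / (1 - v^2) turns the weight into a sum of l v^(2 j + 1).
  Each term is a Gamma integral, and the factor v^(2 k) shifts the index by k.\<close>

lemma has_bochner_integral_fold_moment:
  "has_bochner_integral lborel (\<lambda>l. indicator {0<..} l * (fold_weight l * (l ^ m * ((exp (- l))\<^sup>2) ^ k)))
     (fold_moment (Suc m) k)"
proof (rule has_bochner_integral_nn_integral)
  have tail: "(\<lambda>j. fact (Suc m) * (1 / real (2 * (j + k) + 1) ^ Suc (Suc m))) sums fold_moment (Suc m) k"
  proof -
    have "(\<lambda>j. 1 / real (2 * j + 1) ^ Suc (Suc m)) sums odd_zeta (Suc (Suc m))"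
      unfolding odd_zeta_def by (intro summable_sums summable_odd_zeta) simp
    then have "(\<lambda>j. 1 / real (2 * (j + k) + 1) ^ Suc (Suc m)) sums
        (odd_zeta (Suc (Suc m)) - (\<Sum>j<k. 1 / real (2 * j + 1) ^ Suc (Suc m)))"
      by (subst sums_iff_shift) simp
    then show ?thesis unfolding fold_moment_def by (rule sums_mult)
  qed
  show "0 \<le> fold_moment (Suc m) k"
    using tail by (rule sums_le[OF _ sums_zero, rotated]) auto
  show "AE l in lborel. 0 \<le> indicator {0<..} l * (fold_weight l * (l ^ m * ((exp (- l))\<^sup>2) ^ k))"
    by (auto simp: fold_weight_nonneg split: split_indicator)
  have "(\<integral>\<^sup>+l. ennreal (indicator {0<..} l * (fold_weight l * (l ^ m * ((exp (- l))\<^sup>2) ^ k))) \<partial>lborel) =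
      (\<integral>\<^sup>+l. (\<Sum>j. ennreal (l ^ Suc m * exp (- (real (2 * (j + k) + 1) * l))) * indicator {0<..} l) \<partial>lborel)"
  proof (rule nn_integral_cong)
    fix l :: real
    show "ennreal (indicator {0<..} l * (fold_weight l * (l ^ m * ((exp (- l))\<^sup>2) ^ k))) =
        (\<Sum>j. ennreal (l ^ Suc m * exp (- (real (2 * (j + k) + 1) * l))) * indicator {0<..} l)"
    proof (cases "0 < l")
      case True
      define v where "v = exp (- l)"
      have v: "0 < v" "v < 1" using True by (auto simp: v_def)
      have v2: "\<bar>v\<^sup>2\<bar> < 1" using v by (simp add: power_less_one_iff)
      have e: "exp (- (real n * l)) = v ^ n" for n
        unfolding v_def by (simp add: exp_of_nat_mult[symmetric])
      have "(\<lambda>j. l ^ Suc m * v * (v\<^sup>2) ^ k * (v\<^sup>2) ^ j) sums (l ^ Suc m * v * (v\<^sup>2) ^ k * (1 / (1 - v\<^sup>2)))"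
        using v2 by (intro sums_mult geometric_sums) simp
      also have "(\<lambda>j. l ^ Suc m * v * (v\<^sup>2) ^ k * (v\<^sup>2) ^ j) = (\<lambda>j. l ^ Suc m * v ^ (2 * (j + k) + 1))"
      proof -
        have "(v\<^sup>2) ^ n = (v ^ n)\<^sup>2" for n by (simp add: mult.commute flip: power_mult)
        then show ?thesis by (simp add: power_add power_mult algebra_simps)
      qed
      also have "l ^ Suc m * v * (v\<^sup>2) ^ k * (1 / (1 - v\<^sup>2)) = fold_weight l * (l ^ m * (v\<^sup>2) ^ k)"
        by (simp add: fold_weight_def v_def)
      finally have s: "(\<lambda>j. l ^ Suc m * v ^ (2 * (j + k) + 1)) sums (fold_weight l * (l ^ m * (v\<^sup>2) ^ k))" .
      have "(\<Sum>j. ennreal (l ^ Suc m * v ^ (2 * (j + k) + 1))) = ennreal (fold_weight l * (l ^ m * (v\<^sup>2) ^ k))"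
        using s True v by (intro suminf_ennreal_eq) auto
      then show ?thesis using True unfolding e by (simp add: v_def)
    qed simp
  qed
  also have "\<dots> = (\<Sum>j. \<integral>\<^sup>+l. ennreal (l ^ Suc m * exp (- (real (2 * (j + k) + 1) * l))) * indicator {0<..} l \<partial>lborel)"
    by (rule nn_integral_suminf) measurable
  also have "\<dots> = (\<Sum>j. ennreal (fact (Suc m) * (1 / real (2 * (j + k) + 1) ^ Suc (Suc m))))"
    by (subst nn_integral_power_times_exp) simp_all
  also have "\<dots> = ennreal (fold_moment (Suc m) k)"
    by (rule suminf_ennreal_eq[OF _ tail]) simp
  finally show "(\<integral>\<^sup>+l. ennreal (indicator {0<..} l * (fold_weight l * (l ^ m * ((exp (- l))\<^sup>2) ^ k))) \<partial>lborel) =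
      ennreal (fold_moment (Suc m) k)" .
qed measurable

fun list_moment :: "(nat \<Rightarrow> real) \<Rightarrow> nat \<Rightarrow> int list \<Rightarrow> real" where
  "list_moment a k [] = 0"
| "list_moment a k (c # cs) = of_int c * a k + list_moment a (Suc k) cs"

lemma has_bochner_integral_list_moment:
  "has_bochner_integral lborel
     (\<lambda>l. indicator {0<..} l * (fold_weight l * (l ^ m * (((exp (- l))\<^sup>2) ^ k * ipoly cs ((exp (- l))\<^sup>2)))))
     (list_moment (fold_moment (Suc m)) k cs)"
proof (induction cs arbitrary: k)
  case Nil
  then show ?case by (simp add: has_bochner_integral_zero)
next
  case (Cons c cs)
  have "has_bochner_integral lborel
     (\<lambda>l. of_int c * (indicator {0<..} l * (fold_weight l * (l ^ m * ((exp (- l))\<^sup>2) ^ k)))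
       + indicator {0<..} l * (fold_weight l * (l ^ m * (((exp (- l))\<^sup>2) ^ Suc k * ipoly cs ((exp (- l))\<^sup>2)))))
     (of_int c * fold_moment (Suc m) k + list_moment (fold_moment (Suc m)) (Suc k) cs)"
    by (intro has_bochner_integral_add has_bochner_integral_mult_right has_bochner_integral_fold_moment Cons)
  also have "(\<lambda>l. of_int c * (indicator {0<..} l * (fold_weight l * (l ^ m * ((exp (- l))\<^sup>2) ^ k)))
       + indicator {0<..} l * (fold_weight l * (l ^ m * (((exp (- l))\<^sup>2) ^ Suc k * ipoly cs ((exp (- l))\<^sup>2))))) =
     (\<lambda>l. indicator {0<..} l * (fold_weight l * (l ^ m * (((exp (- l))\<^sup>2) ^ k * ipoly (c # cs) ((exp (- l))\<^sup>2)))))"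
    by (auto simp: algebra_simps)
  finally show ?case by simp
qed

text \<open>Splits the moment of a polynomial into its value at 1 times a transcendental constant
  and a rational remainder, which can be evaluated by integer arithmetic.\<close>

lemma list_moment_fold_moment:
  "list_moment (fold_moment m) k cs = fact m * (odd_zeta (Suc m) * ipoly cs 1
     - list_moment (\<lambda>k. \<Sum>j<k. 1 / real (2 * j + 1) ^ Suc m) k cs)"
  by (induction cs arbitrary: k) (simp_all add: fold_moment_def algebra_simps del: power_Suc)

lemma odd_zeta_2: "odd_zeta 2 = pi\<^sup>2 / 8"
proof -
  have z: "(\<lambda>n. 1 / real (Suc n) ^ 2) sums (pi\<^sup>2 / 6)"
    using inverse_squares_sums by simp
  have "(\<lambda>k. \<Sum>n = k * 2..<k * 2 + 2. 1 / real (Suc n) ^ 2) sums (pi\<^sup>2 / 6)"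
    by (rule sums_group[OF z]) simp
  moreover have "(\<Sum>n = k * 2..<k * 2 + 2. 1 / real (Suc n) ^ 2) =
      1 / real (2 * k + 1) ^ 2 + 1 / 4 * (1 / real (Suc k) ^ 2)" for k
  proof -
    have "{k * 2..<k * 2 + 2} = {2 * k, 2 * k + 1}" by auto
    then have "(\<Sum>n = k * 2..<k * 2 + 2. 1 / real (Suc n) ^ 2) =
       1 / real (Suc (2 * k)) ^ 2 + 1 / real (Suc (2 * k + 1)) ^ 2" by simp
    also have "real (Suc (2 * k + 1)) = 2 * real (Suc k)" by simp
    also have "(2 * real (Suc k)) ^ 2 = 4 * real (Suc k) ^ 2" by (subst power_mult_distrib) simp
    finally show ?thesis by simp
  qed
  ultimately have "(\<lambda>k. 1 / real (2 * k + 1) ^ 2 + 1 / 4 * (1 / real (Suc k) ^ 2)) sums (pi\<^sup>2 / 6)" by simp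
  from sums_diff[OF this sums_mult[OF z, of "1 / 4"]]
  have "(\<lambda>k. 1 / real (2 * k + 1) ^ 2) sums (pi\<^sup>2 / 8)" by simp
  then show ?thesis by (simp add: odd_zeta_def sums_iff)
qed

text \<open>All tails are compared with telescoping series, using 4 x (x + 1) <= (2 x + 1)^2. Only
  the slowly converging inverse squares need a refined lower bound.\<close>

lemma odd_zeta_bounds:
  fixes N :: nat
  assumes N: "0 < N"
  defines "S \<equiv> \<lambda>m. \<Sum>j<N. 1 / real (2 * j + 1) ^ m"
  shows "S 2 + 1 / (4 * (real N + 1 / (8 * real N))) \<le> odd_zeta 2" "odd_zeta 2 \<le> S 2 + 1 / (4 * real N)"
    and "S 3 \<le> odd_zeta 3" "odd_zeta 3 \<le> S 3 + 1 / (16 * (real N)\<^sup>2)"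
    and "S 4 \<le> odd_zeta 4" "odd_zeta 4 \<le> S 4 + 1 / (16 * (real N)\<^sup>2) / (2 * real N + 1)"
proof -
  have tail: "(\<lambda>j. 1 / real (2 * (j + N) + 1) ^ m) sums (odd_zeta m - S m)" if "2 \<le> m" for m
  proof -
    have "(\<lambda>j. 1 / real (2 * j + 1) ^ m) sums odd_zeta m"
      unfolding odd_zeta_def by (intro summable_sums summable_odd_zeta that)
    then show ?thesis unfolding S_def by (subst sums_iff_shift) simp
  qed
  have tele: "(\<lambda>j. f j - f (Suc j)) sums f 0" if "f \<longlonglongrightarrow> 0" for f :: "nat \<Rightarrow> real"
    using telescope_sums'[OF that] by simp
  show "S 3 \<le> odd_zeta 3" "S 4 \<le> odd_zeta 4"
    using sums_le[OF _ sums_zero tail[of 3]] sums_le[OF _ sums_zero tail[of 4]] by simp_all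
  \<comment> \<open>The shift must satisfy (2 x + 1)^2 <= 4 (x + c) (x + 1 + c), that is, 1 / 4 <= 2
    c x + c + c^2, for all x >= N. The choice 2 c N = 1 / 4 ensures this.\<close>
  define c where "c = 1 / (8 * real N)"
  have c: "c > 0" "2 * c * real N = 1 / 4" using N by (auto simp: c_def)
  have s1: "(\<lambda>j. 1 / (4 * (real (j + N) + c)) - 1 / (4 * (real (Suc j + N) + c))) sums (1 / (4 * (real (0 + N) + c)))"
    by (rule tele[of "\<lambda>j. 1 / (4 * (real (j + N) + c))"]) real_asymp
  have "1 / (4 * (real (0 + N) + c)) \<le> odd_zeta 2 - S 2"
  proof (rule sums_le[OF _ s1 tail])
    fix j
    define x where "x = real (j + N)"
    have x: "x \<ge> real N" "x > 0" using N by (auto simp: x_def)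
    have "1 / (4 * a) - 1 / (4 * (a + 1)) = 1 / (4 * (a * (a + 1)))" if "a > 0" for a :: real
      using that by (simp add: field_simps)
    from this[of "x + c"] have "1 / (4 * (x + c)) - 1 / (4 * (x + 1 + c)) = 1 / (4 * ((x + c) * (x + 1 + c)))"
      using x c by (simp add: add_ac)
    also have "\<dots> \<le> 1 / (2 * x + 1) ^ 2"
    proof (rule divide_left_mono)
      have "2 * c * real N \<le> 2 * c * x" using x c by (intro mult_left_mono) auto
      then have "1 / 4 \<le> 2 * c * x + c + c\<^sup>2" using c by (smt (verit) zero_le_power2)
      then show "(2 * x + 1) ^ 2 \<le> 4 * ((x + c) * (x + 1 + c))"
        by (simp add: power2_eq_square algebra_simps)
    qed (use x c in auto)
    finally show "1 / (4 * (real (j + N) + c)) - 1 / (4 * (real (Suc j + N) + c)) \<le> 1 / real (2 * (j + N) + 1) ^ 2"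
      by (simp add: x_def algebra_simps)
  qed simp
  then show "S 2 + 1 / (4 * (real N + 1 / (8 * real N))) \<le> odd_zeta 2" by (simp add: c_def)
  have s2: "(\<lambda>j. 1 / (4 * real (j + N)) - 1 / (4 * real (Suc j + N))) sums (1 / (4 * real (0 + N)))"
    by (rule tele[of "\<lambda>j. 1 / (4 * real (j + N))"]) real_asymp
  have "odd_zeta 2 - S 2 \<le> 1 / (4 * real (0 + N))"
  proof (rule sums_le[OF _ tail s2])
    fix j
    define x where "x = real (j + N)"
    have x: "x > 0" using N by (auto simp: x_def)
    have "1 / (2 * x + 1) ^ 2 \<le> 1 / (4 * (x * (x + 1)))"
    proof (rule divide_left_mono)
      show "4 * (x * (x + 1)) \<le> (2 * x + 1)\<^sup>2" by (simp add: power2_eq_square algebra_simps)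
      show "0 < (2 * x + 1)\<^sup>2 * (4 * (x * (x + 1)))"
        using x by (intro mult_pos_pos zero_less_power) auto
    qed simp
    also have "\<dots> = 1 / (4 * x) - 1 / (4 * (x + 1))" using x by (simp add: field_simps)
    finally show "1 / real (2 * (j + N) + 1) ^ 2 \<le> 1 / (4 * real (j + N)) - 1 / (4 * real (Suc j + N))"
      by (simp add: x_def algebra_simps)
  qed simp
  then show "odd_zeta 2 \<le> S 2 + 1 / (4 * real N)" by simp
  have s3: "(\<lambda>j. 1 / (16 * (real (j + N))\<^sup>2) - 1 / (16 * (real (Suc j + N))\<^sup>2)) sums (1 / (16 * (real (0 + N))\<^sup>2))"
    by (rule tele[of "\<lambda>j. 1 / (16 * (real (j + N))\<^sup>2)"]) real_asymp
  have t3: "1 / real (2 * (j + N) + 1) ^ 3 \<le> 1 / (16 * (real (j + N))\<^sup>2) - 1 / (16 * (real (Suc j + N))\<^sup>2)" for j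
  proof -
    define x where "x = real (j + N)"
    have x: "x > 0" using N by (auto simp: x_def)
    have "16 * (x * (x + 1))\<^sup>2 \<le> ((2 * x + 1)\<^sup>2)\<^sup>2"
    proof -
      have "(4 * (x * (x + 1)))\<^sup>2 \<le> ((2 * x + 1)\<^sup>2)\<^sup>2"
        using x by (intro power_mono) (auto simp: power2_eq_square algebra_simps)
      then show ?thesis by (simp add: power_mult_distrib)
    qed
    then have "1 / (2 * x + 1) ^ 3 \<le> (2 * x + 1) / (16 * (x * (x + 1))\<^sup>2)"
      using x by (subst frac_le_eq) (auto simp: divide_le_0_iff power3_eq_cube power2_eq_square mult_ac)
    also have "\<dots> = 1 / (16 * x\<^sup>2) - 1 / (16 * (x + 1)\<^sup>2)"
    proof -
      have "1 / (16 * a) - 1 / (16 * b) = (b - a) / (16 * (a * b))" if "a > 0" "b > 0" for a b :: real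
        using that by (simp add: field_simps)
      from this[of "x\<^sup>2" "(x + 1)\<^sup>2"] x
      have "1 / (16 * x\<^sup>2) - 1 / (16 * (x + 1)\<^sup>2) = ((x + 1)\<^sup>2 - x\<^sup>2) / (16 * (x\<^sup>2 * (x + 1)\<^sup>2))" by simp
      moreover have "(x + 1)\<^sup>2 - x\<^sup>2 = 2 * x + 1" by (simp add: power2_eq_square algebra_simps)
      ultimately show ?thesis by (simp only: power_mult_distrib)
    qed
    finally show ?thesis by (simp add: x_def algebra_simps)
  qed
  have "odd_zeta 3 - S 3 \<le> 1 / (16 * (real (0 + N))\<^sup>2)"
    by (rule sums_le[OF t3 tail s3]) simp
  then show "odd_zeta 3 \<le> S 3 + 1 / (16 * (real N)\<^sup>2)" by simp
  have "odd_zeta 4 - S 4 \<le> 1 / (16 * (real (0 + N))\<^sup>2) / (2 * real N + 1)"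
  proof (rule sums_le[OF _ tail sums_divide[OF s3]])
    fix j
    have "1 / real (2 * (j + N) + 1) ^ 4 = 1 / real (2 * (j + N) + 1) ^ 3 / real (2 * (j + N) + 1)"
      by (simp add: eval_nat_numeral)
    also have "\<dots> \<le> 1 / real (2 * (j + N) + 1) ^ 3 / (2 * real N + 1)"
      by (intro divide_left_mono) auto
    also have "\<dots> \<le> (1 / (16 * (real (j + N))\<^sup>2) - 1 / (16 * (real (Suc j + N))\<^sup>2)) / (2 * real N + 1)"
      by (intro divide_right_mono t3) auto
    finally show "1 / real (2 * (j + N) + 1) ^ 4 \<le>
       (1 / (16 * (real (j + N))\<^sup>2) - 1 / (16 * (real (Suc j + N))\<^sup>2)) / (2 * real N + 1)" .
  qed simp
  then show "odd_zeta 4 \<le> S 4 + 1 / (16 * (real N)\<^sup>2) / (2 * real N + 1)" by simp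
qed

subsection \<open>The values of the constants\<close>

lemma ln_2_bounds: "69314717 / 100000000 \<le> ln (2::real)" "ln (2::real) \<le> 69314720 / 100000000"
  using ln_approx_bounds[of 2 8] by (simp_all add: eval_nat_numeral)

lemma ln_5_4_bounds: "22314355 / 100000000 \<le> ln (5 / 4::real)" "ln (5 / 4::real) \<le> 22314356 / 100000000"
  using ln_approx_bounds[of "5 / 4" 5] by (simp_all add: eval_nat_numeral)

text \<open>With \<open>v = e\<^sup>-\<^sup>l\<close>, the four values of \<open>ln (1 + 1 / (1 - z)\<^sup>2)\<close> at the points of a fibre of the
  folding are \<open>(SA \<plusminus> DA) / 2\<close> and \<open>(SC \<plusminus> DC) / 2 + 2 l\<close>.\<close>

definition SA :: "real \<Rightarrow> real" where "SA q = ln ((25 + 6 * q + q\<^sup>2) / 16)"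
definition SC :: "real \<Rightarrow> real" where "SC q = ln ((1 + 6 * q + 25 * q\<^sup>2) / 16)"
definition DA :: "real \<Rightarrow> real" where "DA v = ln ((5 - 2 * v + v\<^sup>2) / (5 + 2 * v + v\<^sup>2))"
definition DC :: "real \<Rightarrow> real" where "DC v = ln ((1 - 2 * v + 5 * v\<^sup>2) / (1 + 2 * v + 5 * v\<^sup>2))"

lemma quadratics_pos:
  "0 < 5 - 2 * v + v\<^sup>2" "0 < 5 + 2 * v + v\<^sup>2" "0 < 1 - 2 * v + 5 * v\<^sup>2" "0 < 1 + 2 * v + 5 * v\<^sup>2" for v :: real
proof -
  have e: "5 - 2 * v + v\<^sup>2 = (v - 1)\<^sup>2 + 4" "5 + 2 * v + v\<^sup>2 = (v + 1)\<^sup>2 + 4"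
    "1 - 2 * v + 5 * v\<^sup>2 = (v - 1)\<^sup>2 + (2 * v)\<^sup>2" "1 + 2 * v + 5 * v\<^sup>2 = (v + 1)\<^sup>2 + (2 * v)\<^sup>2"
    by (simp_all add: power2_eq_square algebra_simps)
  show "0 < 5 - 2 * v + v\<^sup>2" "0 < 5 + 2 * v + v\<^sup>2"
    unfolding e by (intro add_nonneg_pos zero_le_power2; simp)+
  show "0 < 1 - 2 * v + 5 * v\<^sup>2" "0 < 1 + 2 * v + 5 * v\<^sup>2"
    unfolding e by (cases "v = 0"; auto intro!: add_nonneg_pos)+
qed

definition log_quotient :: "real \<Rightarrow> real" where "log_quotient z = ln (1 + 1 / (1 - z)\<^sup>2)"

text \<open>Changing v to -v exchanges the two quadratics in each pair: \<open>SA\<close> and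
  \<open>SC\<close> come from their even products, \<open>DA\<close> and \<open>DC\<close> from
  their odd quotients. Sums and sums of squares over a fibre therefore involve only even functions
  of v, as the moments require. The term 2 l is -ln (v^2), from the zero of 1 - z at v = 0.\<close>

lemma log_quotient_fold:
  fixes l :: real
  assumes "0 < l"
  defines "v \<equiv> exp (- l)"
  shows "log_quotient (fold_map l) = (SC (v\<^sup>2) - DC v) / 2 + 2 * l"
    and "log_quotient (- fold_map l) = (SA (v\<^sup>2) - DA v) / 2"
    and "log_quotient (1 / fold_map l) = (SC (v\<^sup>2) + DC v) / 2 + 2 * l"
    and "log_quotient (- (1 / fold_map l)) = (SA (v\<^sup>2) + DA v) / 2"
proof -
  have v: "0 < v" "v < 1" using assms by auto
  have l: "l = - ln v" by (simp add: v_def)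
  note pos = quadratics_pos[of v]
  have SA: "SA (v\<^sup>2) = ln ((5 - 2 * v + v\<^sup>2) / 4) + ln ((5 + 2 * v + v\<^sup>2) / 4)"
    using pos by (subst ln_mult_pos[symmetric]) (auto simp: SA_def power2_eq_square algebra_simps)
  have SC: "SC (v\<^sup>2) = ln ((1 - 2 * v + 5 * v\<^sup>2) / 4) + ln ((1 + 2 * v + 5 * v\<^sup>2) / 4)"
    using pos by (subst ln_mult_pos[symmetric]) (auto simp: SC_def power2_eq_square algebra_simps)
  have q4: "a / 4 / (b / 4) = a / b" for a b :: real by simp
  have DA: "DA v = ln ((5 - 2 * v + v\<^sup>2) / 4) - ln ((5 + 2 * v + v\<^sup>2) / 4)"
    using ln_divide_pos[of "(5 - 2 * v + v\<^sup>2) / 4" "(5 + 2 * v + v\<^sup>2) / 4"] pos unfolding q4 DA_def by simp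
  have DC: "DC v = ln ((1 - 2 * v + 5 * v\<^sup>2) / 4) - ln ((1 + 2 * v + 5 * v\<^sup>2) / 4)"
    using ln_divide_pos[of "(1 - 2 * v + 5 * v\<^sup>2) / 4" "(1 + 2 * v + 5 * v\<^sup>2) / 4"] pos unfolding q4 DC_def by simp
  have m: "fold_map l = (1 - v) / (1 + v)" "1 / fold_map l = (1 + v) / (1 - v)"
    by (auto simp: fold_map_def v_def)
  have d: "1 - (1 - v) / (1 + v) = 2 * v / (1 + v)" "1 - - ((1 - v) / (1 + v)) = 2 / (1 + v)"
    "1 - (1 + v) / (1 - v) = - (2 * v / (1 - v))" "1 - - ((1 + v) / (1 - v)) = 2 / (1 - v)"
    using v by (auto simp: field_simps)
  have e1: "1 + 1 / (2 * v / (1 + v))\<^sup>2 = (1 + 2 * v + 5 * v\<^sup>2) / 4 / v\<^sup>2"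
    using v by (simp add: power_divide field_simps power2_eq_square)
  have e2: "1 + 1 / (2 / (1 + v))\<^sup>2 = (5 + 2 * v + v\<^sup>2) / 4"
    using v by (simp add: power_divide field_simps power2_eq_square)
  have e3: "1 + 1 / (- (2 * v / (1 - v)))\<^sup>2 = (1 - 2 * v + 5 * v\<^sup>2) / 4 / v\<^sup>2"
    using v by (simp add: power_divide field_simps power2_eq_square)
  have e4: "1 + 1 / (2 / (1 - v))\<^sup>2 = (5 - 2 * v + v\<^sup>2) / 4"
    using v by (simp add: power_divide field_simps power2_eq_square)
  have lnv: "ln (x / v\<^sup>2) = ln x + 2 * l" if "x > 0" for x
    using that v by (simp add: ln_div l ln_realpow)
  show "log_quotient (fold_map l) = (SC (v\<^sup>2) - DC v) / 2 + 2 * l"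
    unfolding log_quotient_def m(1) d e1 lnv[of "(1 + 2 * v + 5 * v\<^sup>2) / 4", OF divide_pos_pos[OF pos(4) zero_less_numeral]] SC DC by simp
  show "log_quotient (- fold_map l) = (SA (v\<^sup>2) - DA v) / 2"
    unfolding log_quotient_def m(1) d e2 using SA DA by simp
  show "log_quotient (1 / fold_map l) = (SC (v\<^sup>2) + DC v) / 2 + 2 * l"
    unfolding log_quotient_def m(2) d e3 lnv[of "(1 - 2 * v + 5 * v\<^sup>2) / 4", OF divide_pos_pos[OF pos(3) zero_less_numeral]] SC DC by simp
  show "log_quotient (- (1 / fold_map l)) = (SA (v\<^sup>2) + DA v) / 2"
    unfolding log_quotient_def m(2) d e4 using SA DA by simp
qed

text \<open>The constant terms are the rounded values of 10^8 times \<open>SA 0\<close> = 2 ln (5 /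
  4) and \<open>SC 0\<close> = -4 ln 2.\<close>

definition "poly_SA = 44628710 # list_SA"
definition "poly_SC = - 277258872 # list_SC"

lemma SA_approx:
  assumes q: "0 \<le> q" "q \<le> 1"
  shows "\<bar>SA q - ipoly poly_SA q / 100000000\<bar> \<le> 1 / 10000000 + 5 / 100000 * q"
proof -
  define h where "h q = SA q - q * ipoly list_SA q / 100000000" for q
  have "\<bar>h q - h 0\<bar> \<le> 5 / 100000 * q"
  proof (rule abs_diff_le_of_deriv[OF q(1)])
    fix y assume y: "0 \<le> y" "y \<le> q"
    then have p: "25 + 6 * y + y\<^sup>2 > 0" by (simp add: add_pos_nonneg)
    have "(SA has_real_derivative (6 + 2 * y) / (25 + 6 * y + y\<^sup>2)) (at y)"
      unfolding SA_def using p by (auto intro!: derivative_eq_intros simp: field_simps)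
    moreover have "((\<lambda>q. q * ipoly list_SA q / 100000000) has_real_derivative ipoly (pder 0 list_SA) y / 100000000) (at y)"
      using DERIV_cdivide[OF has_real_derivative_ipoly[of 0 list_SA y], of "100000000"] by simp
    ultimately show "(h has_real_derivative (6 + 2 * y) / (25 + 6 * y + y\<^sup>2) - ipoly (pder 0 list_SA) y / 100000000) (at y)"
      unfolding h_def by (rule DERIV_diff)
    show "\<bar>(6 + 2 * y) / (25 + 6 * y + y\<^sup>2) - ipoly (pder 0 list_SA) y / 100000000\<bar> \<le> 5 / 100000"
      using y q by (intro list_SA_deriv) auto
  qed
  moreover have "h 0 = 2 * ln (5 / 4)"
    using ln_realpow[of "5 / 4" 2] by (simp add: h_def SA_def power2_eq_square)
  moreover have "SA q - ipoly poly_SA q / 100000000 = h q - 44628710 / 100000000"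
    by (simp add: h_def poly_SA_def add_divide_distrib)
  ultimately show ?thesis using ln_5_4_bounds by linarith
qed

lemma SC_approx:
  assumes q: "0 \<le> q" "q \<le> 1"
  shows "\<bar>SC q - ipoly poly_SC q / 100000000\<bar> \<le> 1 / 10000000 + 78 / 100000 * q"
proof -
  define h where "h q = SC q - q * ipoly list_SC q / 100000000" for q
  have "\<bar>h q - h 0\<bar> \<le> 78 / 100000 * q"
  proof (rule abs_diff_le_of_deriv[OF q(1)])
    fix y assume y: "0 \<le> y" "y \<le> q"
    then have p: "1 + 6 * y + 25 * y\<^sup>2 > 0" by (simp add: add_pos_nonneg)
    have "(SC has_real_derivative (6 + 50 * y) / (1 + 6 * y + 25 * y\<^sup>2)) (at y)"
      unfolding SC_def using p by (auto intro!: derivative_eq_intros simp: field_simps)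
    moreover have "((\<lambda>q. q * ipoly list_SC q / 100000000) has_real_derivative ipoly (pder 0 list_SC) y / 100000000) (at y)"
      using DERIV_cdivide[OF has_real_derivative_ipoly[of 0 list_SC y], of "100000000"] by simp
    ultimately show "(h has_real_derivative (6 + 50 * y) / (1 + 6 * y + 25 * y\<^sup>2) - ipoly (pder 0 list_SC) y / 100000000) (at y)"
      unfolding h_def by (rule DERIV_diff)
    show "\<bar>(6 + 50 * y) / (1 + 6 * y + 25 * y\<^sup>2) - ipoly (pder 0 list_SC) y / 100000000\<bar> \<le> 78 / 100000"
      using y q by (intro list_SC_deriv) auto
  qed
  moreover have "h 0 = - (4 * ln 2)"
    using ln_realpow[of 2 4] ln_inverse[of 16] by (simp add: h_def SC_def inverse_eq_divide)
  moreover have "SC q - ipoly poly_SC q / 100000000 = h q + 277258872 / 100000000"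
    by (simp add: h_def poly_SC_def add_divide_distrib diff_divide_distrib)
  ultimately show ?thesis using ln_2_bounds by linarith
qed

lemma DA_approx:
  assumes v: "0 \<le> v" "v \<le> 1"
  shows "\<bar>DA v - v * ipoly list_DA (v\<^sup>2) / 100000000\<bar> \<le> 30 / 100000 * v" and "\<bar>DA v\<bar> \<le> v"
proof -
  have der: "(DA has_real_derivative (- 20 + 4 * y\<^sup>2) / (25 + 6 * y\<^sup>2 + (y\<^sup>2)\<^sup>2)) (at y)" for y
  proof -
    note pos = quadratics_pos[of y]
    have "DA = (\<lambda>v. ln (5 - 2 * v + v\<^sup>2) - ln (5 + 2 * v + v\<^sup>2))"
      using quadratics_pos by (auto simp: DA_def ln_divide_pos)
    moreover have "((\<lambda>v. ln (5 - 2 * v + v\<^sup>2) - ln (5 + 2 * v + v\<^sup>2)) has_real_derivative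
        (2 * y - 2) / (5 - 2 * y + y\<^sup>2) - (2 + 2 * y) / (5 + 2 * y + y\<^sup>2)) (at y)"
      using pos by (auto intro!: derivative_eq_intros simp: diff_divide_distrib add_divide_distrib)
    moreover have "(2 * y - 2) / (5 - 2 * y + y\<^sup>2) - (2 + 2 * y) / (5 + 2 * y + y\<^sup>2) =
        ((2 * y - 2) * (5 + 2 * y + y\<^sup>2) - (2 + 2 * y) * (5 - 2 * y + y\<^sup>2)) / ((5 - 2 * y + y\<^sup>2) * (5 + 2 * y + y\<^sup>2))"
      using pos by (subst diff_frac_eq) auto
    moreover have "(2 * y - 2) * (5 + 2 * y + y\<^sup>2) - (2 + 2 * y) * (5 - 2 * y + y\<^sup>2) = - 20 + 4 * y\<^sup>2"
      "(5 - 2 * y + y\<^sup>2) * (5 + 2 * y + y\<^sup>2) = 25 + 6 * y\<^sup>2 + (y\<^sup>2)\<^sup>2"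
      by (simp_all add: power2_eq_square algebra_simps)
    ultimately show ?thesis by simp
  qed
  have DA0: "DA 0 = 0" by (simp add: DA_def)
  have "\<bar>DA v - DA 0\<bar> \<le> 1 * v"
  proof (rule abs_diff_le_of_deriv[OF v(1) der])
    fix y assume y: "0 \<le> y" "y \<le> v"
    have "y\<^sup>2 \<le> 1" using y v by (simp add: power_le_one)
    moreover have "25 + 6 * y\<^sup>2 + (y\<^sup>2)\<^sup>2 > 0" by (simp add: add_pos_nonneg)
    moreover have "0 \<le> y\<^sup>2" "0 \<le> (y\<^sup>2)\<^sup>2" by auto
    moreover have "\<bar>- 20 + 4 * a\<bar> \<le> 1 * (25 + 6 * a + b)" if "0 \<le> a" "a \<le> 1" "0 \<le> b" for a b :: real
      using that by (simp add: abs_le_iff)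
    ultimately show "\<bar>(- 20 + 4 * y\<^sup>2) / (25 + 6 * y\<^sup>2 + (y\<^sup>2)\<^sup>2)\<bar> \<le> 1"
      by (intro abs_divide_le)
  qed
  then show "\<bar>DA v\<bar> \<le> v" by (simp add: DA0)
  define h where "h v = DA v - v * ipoly list_DA (v\<^sup>2) / 100000000" for v
  have "\<bar>h v - h 0\<bar> \<le> 30 / 100000 * v"
  proof (rule abs_diff_le_of_deriv[OF v(1)])
    fix y assume y: "0 \<le> y" "y \<le> v"
    have "((\<lambda>v. v * ipoly list_DA (v\<^sup>2) / 100000000) has_real_derivative ipoly (oddder 0 list_DA) (y\<^sup>2) / 100000000) (at y)"
      using DERIV_cdivide[OF has_real_derivative_ipoly_sq[of 0 list_DA y], of "100000000"] by simp
    from DERIV_diff[OF der this]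
    show "(h has_real_derivative (- 20 + 4 * y\<^sup>2) / (25 + 6 * y\<^sup>2 + (y\<^sup>2)\<^sup>2) - ipoly (oddder 0 list_DA) (y\<^sup>2) / 100000000) (at y)"
      unfolding h_def .
    show "\<bar>(- 20 + 4 * y\<^sup>2) / (25 + 6 * y\<^sup>2 + (y\<^sup>2)\<^sup>2) - ipoly (oddder 0 list_DA) (y\<^sup>2) / 100000000\<bar> \<le> 30 / 100000"
      using y v by (intro list_DA_deriv) (auto simp: power_le_one)
  qed
  then show "\<bar>DA v - v * ipoly list_DA (v\<^sup>2) / 100000000\<bar> \<le> 30 / 100000 * v"
    by (simp add: h_def DA0)
qed

lemma DC_approx:
  assumes v: "0 \<le> v" "v \<le> 1"
  shows "\<bar>DC v - v * ipoly list_DC (v\<^sup>2) / 100000000\<bar> \<le> 374 / 100000 * v" and "\<bar>DC v\<bar> \<le> 4 * v"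
proof -
  have der: "(DC has_real_derivative (- 4 + 20 * y\<^sup>2) / (1 + 6 * y\<^sup>2 + 25 * (y\<^sup>2)\<^sup>2)) (at y)" for y
  proof -
    note pos = quadratics_pos[of y]
    have "DC = (\<lambda>v. ln (1 - 2 * v + 5 * v\<^sup>2) - ln (1 + 2 * v + 5 * v\<^sup>2))"
      using quadratics_pos by (auto simp: DC_def ln_divide_pos)
    moreover have "((\<lambda>v. ln (1 - 2 * v + 5 * v\<^sup>2) - ln (1 + 2 * v + 5 * v\<^sup>2)) has_real_derivative
        (10 * y - 2) / (1 - 2 * y + 5 * y\<^sup>2) - (2 + 10 * y) / (1 + 2 * y + 5 * y\<^sup>2)) (at y)"
      using pos by (auto intro!: derivative_eq_intros simp: diff_divide_distrib add_divide_distrib)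
    moreover have "(10 * y - 2) / (1 - 2 * y + 5 * y\<^sup>2) - (2 + 10 * y) / (1 + 2 * y + 5 * y\<^sup>2) =
        ((10 * y - 2) * (1 + 2 * y + 5 * y\<^sup>2) - (2 + 10 * y) * (1 - 2 * y + 5 * y\<^sup>2)) / ((1 - 2 * y + 5 * y\<^sup>2) * (1 + 2 * y + 5 * y\<^sup>2))"
      using pos by (subst diff_frac_eq) auto
    moreover have "(10 * y - 2) * (1 + 2 * y + 5 * y\<^sup>2) - (2 + 10 * y) * (1 - 2 * y + 5 * y\<^sup>2) = - 4 + 20 * y\<^sup>2"
      "(1 - 2 * y + 5 * y\<^sup>2) * (1 + 2 * y + 5 * y\<^sup>2) = 1 + 6 * y\<^sup>2 + 25 * (y\<^sup>2)\<^sup>2"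
      by (simp_all add: power2_eq_square algebra_simps)
    ultimately show ?thesis by simp
  qed
  have DC0: "DC 0 = 0" by (simp add: DC_def)
  have "\<bar>DC v - DC 0\<bar> \<le> 4 * v"
  proof (rule abs_diff_le_of_deriv[OF v(1) der])
    fix y :: real
    have "1 + 6 * y\<^sup>2 + 25 * (y\<^sup>2)\<^sup>2 > 0" by (simp add: add_pos_nonneg)
    moreover have "0 \<le> y\<^sup>2" "0 \<le> (y\<^sup>2)\<^sup>2" by auto
    moreover have "\<bar>- 4 + 20 * a\<bar> \<le> 4 * (1 + 6 * a + 25 * b)" if "0 \<le> a" "0 \<le> b" for a b :: real
      using that by (simp add: abs_le_iff)
    ultimately show "\<bar>(- 4 + 20 * y\<^sup>2) / (1 + 6 * y\<^sup>2 + 25 * (y\<^sup>2)\<^sup>2)\<bar> \<le> 4"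
      by (intro abs_divide_le)
  qed
  then show "\<bar>DC v\<bar> \<le> 4 * v" by (simp add: DC0)
  define h where "h v = DC v - v * ipoly list_DC (v\<^sup>2) / 100000000" for v
  have "\<bar>h v - h 0\<bar> \<le> 374 / 100000 * v"
  proof (rule abs_diff_le_of_deriv[OF v(1)])
    fix y assume y: "0 \<le> y" "y \<le> v"
    have "((\<lambda>v. v * ipoly list_DC (v\<^sup>2) / 100000000) has_real_derivative ipoly (oddder 0 list_DC) (y\<^sup>2) / 100000000) (at y)"
      using DERIV_cdivide[OF has_real_derivative_ipoly_sq[of 0 list_DC y], of "100000000"] by simp
    from DERIV_diff[OF der this]
    show "(h has_real_derivative (- 4 + 20 * y\<^sup>2) / (1 + 6 * y\<^sup>2 + 25 * (y\<^sup>2)\<^sup>2) - ipoly (oddder 0 list_DC) (y\<^sup>2) / 100000000) (at y)"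
      unfolding h_def .
    show "\<bar>(- 4 + 20 * y\<^sup>2) / (1 + 6 * y\<^sup>2 + 25 * (y\<^sup>2)\<^sup>2) - ipoly (oddder 0 list_DC) (y\<^sup>2) / 100000000\<bar> \<le> 374 / 100000"
      using y v by (intro list_DC_deriv) (auto simp: power_le_one)
  qed
  then show "\<bar>DC v - v * ipoly list_DC (v\<^sup>2) / 100000000\<bar> \<le> 374 / 100000 * v"
    by (simp add: h_def DC0)
qed

section \<open>Evaluation of moments and odd zeta sums by integer division\<close>

fun isum :: "int list \<Rightarrow> int" where
  "isum [] = 0"
| "isum (c # cs) = c + isum cs"

text \<open>Summation by parts turns \<open>\<Sum>\<^sub>k c\<^sub>k \<Sum>\<^sub>j\<^sub><\<^sub>k 1 / (2 j + 1)\<^sup>m\<close> into a sum of quotients of integers, whose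
  integer parts after scaling by \<open>10\<^sup>9\<close> can be computed exactly.\<close>

fun tail_moment :: "nat \<Rightarrow> nat \<Rightarrow> int list \<Rightarrow> real" where
  "tail_moment m j [] = 0"
| "tail_moment m j (c # cs) = of_int (isum cs) / real (2 * j + 1) ^ m + tail_moment m (Suc j) cs"

fun floor_moment :: "nat \<Rightarrow> int \<Rightarrow> int list \<Rightarrow> int" where
  "floor_moment m j [] = 0"
| "floor_moment m j (c # cs) = (isum cs * 1000000000) div (2 * j + 1) ^ m + floor_moment m (j + 1) cs"

lemma ipoly_1_eq_isum: "ipoly cs 1 = of_int (isum cs)"
  by (induction cs) simp_all

lemma list_moment_eq_tail_moment:
  "list_moment (\<lambda>k. \<Sum>j<k. 1 / real (2 * j + 1) ^ m) k cs =
     of_int (isum cs) * (\<Sum>j<k. 1 / real (2 * j + 1) ^ m) + tail_moment m k cs"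
  by (induction cs arbitrary: k) (simp_all add: algebra_simps)

lemma list_moment_eval:
  "list_moment (fold_moment m) 0 cs = fact m * (odd_zeta (Suc m) * of_int (isum cs) - tail_moment (Suc m) 0 cs)"
  using list_moment_eq_tail_moment[of "Suc m" 0 cs] unfolding list_moment_fold_moment ipoly_1_eq_isum by simp

lemma div_bounds:
  fixes a b :: int
  assumes "0 < b"
  shows "of_int (a div b) \<le> (of_int a / of_int b :: real)" "of_int a / of_int b \<le> (of_int (a div b) + 1 :: real)"
  using assms floor_divide_of_int_eq[of a b, where ?'a = real]
    of_int_floor_le[of "of_int a / of_int b :: real"] real_of_int_floor_add_one_ge[of "of_int a / of_int b :: real"]
  by simp_all

lemma floor_moment_bounds:
  "of_int (floor_moment m (int j) cs) \<le> 1000000000 * tail_moment m j cs \<and>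
   1000000000 * tail_moment m j cs \<le> of_int (floor_moment m (int j) cs) + real (length cs)"
proof (induction cs arbitrary: j)
  case (Cons c cs j)
  have b: "0 < (2 * int j + 1) ^ m" by simp
  have e: "of_int (isum cs * 1000000000) / of_int ((2 * int j + 1) ^ m) =
      1000000000 * (of_int (isum cs) / real (2 * j + 1) ^ m)" by (simp add: add.commute mult.commute)
  note d = div_bounds[OF b, of "isum cs * 1000000000", unfolded e]
  have i: "int (Suc j) = int j + 1" by simp
  note IH = Cons[of "Suc j", unfolded i, THEN conjunct1] Cons[of "Suc j", unfolded i, THEN conjunct2]
  have len: "real (length (c # cs)) = real (length cs) + 1" by simp
  show ?case
    unfolding floor_moment.simps tail_moment.simps distrib_left of_int_add len
    by (intro conjI) (use d IH in linarith)+
qed simp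

text \<open>Approximates the sum of the squares of \<open>SA\<close>, \<open>SC\<close>,
  \<open>DA\<close> and \<open>DC\<close>, scaled by 10^16, as a polynomial in v^2. The leading 0 is
  the factor v^2 left by squaring the odd functions.\<close>

definition poly_P :: "int list" where
  "poly_P = padd (padd (pmul poly_SA poly_SA) (pmul poly_SC poly_SC))
     (0 # padd (pmul list_DA list_DA) (pmul list_DC list_DC))"

lemma tail_moment_SA: "\<bar>tail_moment 2 0 poly_SA / 100000000 - 2474616 / 10000000\<bar> \<le> 1 / 10000000"
proof -
  have "floor_moment 2 (int 0) poly_SA = 24746157720272108" "length poly_SA = 5" by code_simp+
  then show ?thesis using floor_moment_bounds[of 2 0 poly_SA] by (simp add: abs_le_iff)
qed

lemma tail_moment_SC: "\<bar>tail_moment 2 0 poly_SC / 100000000 - 31770825 / 10000000\<bar> \<le> 1 / 10000000"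
proof -
  have "floor_moment 2 (int 0) poly_SC = 317708254867525324" "length poly_SC = 13" by code_simp+
  then show ?thesis using floor_moment_bounds[of 2 0 poly_SC] by (simp add: abs_le_iff)
qed

lemma tail_moment_SC_3: "\<bar>tail_moment 3 0 poly_SC / 100000000 - 33631869 / 10000000\<bar> \<le> 1 / 10000000"
proof -
  have "floor_moment 3 (int 0) poly_SC = 336318691500722609" "length poly_SC = 13" by code_simp+
  then show ?thesis using floor_moment_bounds[of 3 0 poly_SC] by (simp add: abs_le_iff)
qed

lemma tail_moment_P: "\<bar>tail_moment 2 0 poly_P / 10000000000000000 + 43206032 / 10000000\<bar> \<le> 1 / 10000000"
proof -
  have "floor_moment 2 (int 0) poly_P = -43206032153137833906480915" "length poly_P = 25" by code_simp+
  then show ?thesis using floor_moment_bounds[of 2 0 poly_P] by (simp add: abs_le_iff)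
qed

lemma isum_values: "isum poly_SA = 69314708" "isum poly_SC = 69314987" "isum poly_P = 19218149915192274"
  by code_simp+

fun floor_odd_zeta :: "nat \<Rightarrow> int \<Rightarrow> nat \<Rightarrow> int" where
  "floor_odd_zeta m j 0 = 0"
| "floor_odd_zeta m j (Suc n) = 1000000000 div (2 * j + 1) ^ m + floor_odd_zeta m (j + 1) n"

lemma floor_odd_zeta_bounds:
  "of_int (floor_odd_zeta m (int k) n) \<le> 1000000000 * (\<Sum>j = k..<k + n. 1 / real (2 * j + 1) ^ m) \<and>
   1000000000 * (\<Sum>j = k..<k + n. 1 / real (2 * j + 1) ^ m) \<le> of_int (floor_odd_zeta m (int k) n) + real n"
proof (induction n arbitrary: k)
  case (Suc n k)
  have b: "0 < (2 * int k + 1) ^ m" by simp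
  have e: "of_int 1000000000 / of_int ((2 * int k + 1) ^ m) = 1000000000 * (1 / real (2 * k + 1) ^ m)"
    by (simp add: add.commute)
  note d = div_bounds[OF b, of 1000000000, unfolded e]
  have s: "(\<Sum>j = k..<k + Suc n. 1 / real (2 * j + 1) ^ m) =
      1 / real (2 * k + 1) ^ m + (\<Sum>j = Suc k..<Suc k + n. 1 / real (2 * j + 1) ^ m)"
    by (subst sum.atLeast_Suc_lessThan) simp_all
  have i: "int (Suc k) = int k + 1" by simp
  note IH = Suc[of "Suc k", unfolded i, THEN conjunct1] Suc[of "Suc k", unfolded i, THEN conjunct2]
  have n: "real (Suc n) = real n + 1" by simp
  show ?case
    unfolding s n floor_odd_zeta.simps distrib_left of_int_add
    by (intro conjI) (use d IH in linarith)+
qed simp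

lemma odd_zeta_numeric:
  "12337003 / 10000000 \<le> odd_zeta 2" "odd_zeta 2 \<le> 12337010 / 10000000"
  "10517606 / 10000000 \<le> odd_zeta 3" "odd_zeta 3 \<le> 10517999 / 10000000"
  "10146776 / 10000000 \<le> odd_zeta 4" "odd_zeta 4 \<le> 10146783 / 10000000"
proof -
  \<comment> \<open>Forty terms leave a gap of about 4 * 10^(-5) for the cubes and less than 10^(-6)
    for the second and fourth powers.\<close>
  have f: "floor_odd_zeta 2 (int 0) 40 = 1227450857" "floor_odd_zeta 3 (int 0) 40 = 1051760716"
    "floor_odd_zeta 4 (int 0) 40 = 1014677688" by code_simp+
  have s: "(\<Sum>j = 0..<0 + 40. 1 / real (2 * j + 1) ^ m) = (\<Sum>j<40. 1 / real (2 * j + 1) ^ m)" for m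
    by (simp add: atLeast0LessThan)
  note b = floor_odd_zeta_bounds[where k = 0 and n = 40, unfolded s]
  define S where "S m = (\<Sum>j<40. 1 / real (2 * j + 1) ^ m)" for m
  have S: "1227450857 \<le> 1000000000 * S 2" "1000000000 * S 2 \<le> 1227450857 + 40"
    "1051760716 \<le> 1000000000 * S 3" "1000000000 * S 3 \<le> 1051760716 + 40"
    "1014677688 \<le> 1000000000 * S 4" "1000000000 * S 4 \<le> 1014677688 + 40"
    using b[of 2] b[of 3] b[of 4] unfolding f S_def by simp_all
  have "S 2 + 1 / (4 * (40 + 1 / (8 * 40))) \<le> odd_zeta 2" "odd_zeta 2 \<le> S 2 + 1 / (4 * 40)"
    "S 3 \<le> odd_zeta 3" "odd_zeta 3 \<le> S 3 + 1 / (16 * 40\<^sup>2)"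
    "S 4 \<le> odd_zeta 4" "odd_zeta 4 \<le> S 4 + 1 / (16 * 40\<^sup>2) / (2 * 40 + 1)"
    using odd_zeta_bounds[of 40] unfolding S_def by simp_all
  with S show "12337003 / 10000000 \<le> odd_zeta 2" "odd_zeta 2 \<le> 12337010 / 10000000"
    "10517606 / 10000000 \<le> odd_zeta 3" "odd_zeta 3 \<le> 10517999 / 10000000"
    "10146776 / 10000000 \<le> odd_zeta 4" "odd_zeta 4 \<le> 10146783 / 10000000"
    by simp_all
qed

section \<open>Approximation of the two folded integrals\<close>

definition fold_density :: "real \<Rightarrow> real" where
  "fold_density l = indicator {0<..} l * fold_weight l"

lemma fold_density_measurable [measurable]: "fold_density \<in> borel_measurable borel"
  unfolding fold_density_def by measurable

lemma fold_density_nonneg: "0 \<le> fold_density l"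
  using fold_weight_nonneg[of l] by (auto simp: fold_density_def split: split_indicator)

lemma has_bochner_integral_fold_ipoly:
  "has_bochner_integral lborel (\<lambda>l. fold_density l * (l ^ m * ipoly cs ((exp (- l))\<^sup>2)))
     (list_moment (fold_moment (Suc m)) 0 cs)"
  using has_bochner_integral_list_moment[of m 0 cs] by (simp add: fold_density_def mult.assoc)

text \<open>Integrability of f comes with the estimate, from that of the approximation and of the
  error bound; the logarithms need no separate domination.\<close>

lemma integral_approx:
  assumes [measurable]: "f \<in> borel_measurable borel"
    and fg: "\<And>l. 0 < l \<Longrightarrow> \<bar>f l - g l\<bar> \<le> e l"
    and g: "has_bochner_integral lborel (\<lambda>l. fold_density l * g l) a"
    and e: "has_bochner_integral lborel (\<lambda>l. fold_density l * e l) b"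
  shows "integrable lborel (\<lambda>l. fold_density l * f l)" "\<bar>(\<integral>l. fold_density l * f l \<partial>lborel) - a\<bar> \<le> b"
proof -
  have le: "\<bar>fold_density l * f l - fold_density l * g l\<bar> \<le> fold_density l * e l" for l
  proof (cases "0 < l")
    case True
    then show ?thesis using fg[OF True] fold_density_nonneg[of l]
      by (simp add: abs_mult mult_left_mono flip: right_diff_distrib)
  qed (simp add: fold_density_def)
  have gm: "(\<lambda>l. fold_density l * g l) \<in> borel_measurable lborel" using g by (auto simp: has_bochner_integral_iff)
  have d: "integrable lborel (\<lambda>l. fold_density l * f l - fold_density l * g l)"
  proof (rule Bochner_Integration.integrable_bound)
    show "integrable lborel (\<lambda>l. fold_density l * e l)" using e by (auto simp: has_bochner_integral_iff)
    show "(\<lambda>l. fold_density l * f l - fold_density l * g l) \<in> borel_measurable lborel"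
      using gm by measurable
    show "AE l in lborel. norm (fold_density l * f l - fold_density l * g l) \<le> norm (fold_density l * e l)"
      using order_trans[OF le abs_ge_self] by simp
  qed
  then have "integrable lborel (\<lambda>l. (fold_density l * f l - fold_density l * g l) + fold_density l * g l)"
    using g by (intro Bochner_Integration.integrable_add) (auto simp: has_bochner_integral_iff)
  then show i: "integrable lborel (\<lambda>l. fold_density l * f l)" by simp
  have "\<bar>\<integral>l. (fold_density l * f l - fold_density l * g l) \<partial>lborel\<bar> \<le> (\<integral>l. fold_density l * e l \<partial>lborel)"
    using e le d by (intro order_trans[OF integral_abs_bound] integral_mono)
      (auto simp: has_bochner_integral_iff)
  also have "(\<integral>l. (fold_density l * f l - fold_density l * g l) \<partial>lborel) = (\<integral>l. fold_density l * f l \<partial>lborel) - a"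
    using i g by (subst Bochner_Integration.integral_diff) (auto simp: has_bochner_integral_iff)
  finally show "\<bar>(\<integral>l. fold_density l * f l \<partial>lborel) - a\<bar> \<le> b"
    using e by (simp add: has_bochner_integral_iff)
qed

lemma SA_SC_bounds:
  assumes "0 \<le> q" "q \<le> 1"
  shows "\<bar>SA q\<bar> \<le> 1" "\<bar>SC q\<bar> \<le> 3"
proof -
  have q2: "0 \<le> q\<^sup>2" "q\<^sup>2 \<le> 1" using assms by (auto simp: power_le_one)
  have p: "0 < 25 + 6 * q + q\<^sup>2" "0 < 1 + 6 * q + 25 * q\<^sup>2" using assms q2 by linarith+
  have "0 \<le> SA q" unfolding SA_def using assms q2 by (intro ln_ge_zero) simp
  moreover have "SA q \<le> ln 2" unfolding SA_def using assms q2 p by (intro ln_mono) auto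
  ultimately show "\<bar>SA q\<bar> \<le> 1" using ln_2_bounds by linarith
  have "ln (1 / 16) \<le> SC q" unfolding SC_def using assms q2 by (intro ln_mono) auto
  moreover have "ln (1 / 16 :: real) = - (4 * ln 2)"
    using ln_realpow[of 2 4] ln_inverse[of 16] by (simp add: inverse_eq_divide)
  moreover have "SC q \<le> ln 2" unfolding SC_def using assms q2 p by (intro ln_mono) auto
  ultimately show "\<bar>SC q\<bar> \<le> 3" using ln_2_bounds by linarith
qed

lemma abs_diff_squares_le:
  fixes x y e c :: real
  assumes "\<bar>x - y\<bar> \<le> e" "2 * \<bar>x\<bar> + e \<le> c"
  shows "\<bar>x\<^sup>2 - y\<^sup>2\<bar> \<le> c * e"
proof -
  have "\<bar>x + y\<bar> \<le> c" using assms by linarith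
  then have "\<bar>x + y\<bar> * \<bar>x - y\<bar> \<le> c * e" using assms by (intro mult_mono) auto
  moreover have "x\<^sup>2 - y\<^sup>2 = (x + y) * (x - y)" by (simp add: power2_eq_square algebra_simps)
  ultimately show ?thesis by (simp add: abs_mult)
qed

definition fold_sum :: "real \<Rightarrow> real" where
  "fold_sum l = SA ((exp (- l))\<^sup>2) + SC ((exp (- l))\<^sup>2) + 4 * l"

definition fold_square_sum :: "real \<Rightarrow> real" where
  "fold_square_sum l = ((SA ((exp (- l))\<^sup>2))\<^sup>2 + (SC ((exp (- l))\<^sup>2))\<^sup>2 + (DA (exp (- l)))\<^sup>2 + (DC (exp (- l)))\<^sup>2) / 2
     + 4 * (l * SC ((exp (- l))\<^sup>2)) + 8 * l\<^sup>2"

lemma fold_sum_measurable [measurable]: "fold_sum \<in> borel_measurable borel"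
  and fold_square_sum_measurable [measurable]: "fold_square_sum \<in> borel_measurable borel"
  unfolding fold_sum_def fold_square_sum_def SA_def SC_def DA_def DC_def by measurable

lemma fold_sum_eq:
  assumes "0 < l"
  shows "log_quotient (fold_map l) + log_quotient (- fold_map l)
       + log_quotient (1 / fold_map l) + log_quotient (- (1 / fold_map l)) = fold_sum l"
    and "(log_quotient (fold_map l))\<^sup>2 + (log_quotient (- fold_map l))\<^sup>2
       + (log_quotient (1 / fold_map l))\<^sup>2 + (log_quotient (- (1 / fold_map l)))\<^sup>2 = fold_square_sum l"
  unfolding log_quotient_fold[OF assms] fold_sum_def fold_square_sum_def
  by (simp_all add: power2_eq_square field_simps)

lemma nn_integral_log_quotient:
  "(\<integral>\<^sup>+x. ennreal (log_quotient x) \<partial>mu_R) = (\<integral>\<^sup>+l. ennreal (2 / pi\<^sup>2 * (fold_density l * fold_sum l)) \<partial>lborel)"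
  "(\<integral>\<^sup>+x. ennreal ((log_quotient x)\<^sup>2) \<partial>mu_R) = (\<integral>\<^sup>+l. ennreal (2 / pi\<^sup>2 * (fold_density l * fold_square_sum l)) \<partial>lborel)"
proof -
  have m [measurable]: "log_quotient \<in> borel_measurable borel" unfolding log_quotient_def by measurable
  have nn: "0 \<le> log_quotient x" for x by (simp add: log_quotient_def)
  show "(\<integral>\<^sup>+x. ennreal (log_quotient x) \<partial>mu_R) = (\<integral>\<^sup>+l. ennreal (2 / pi\<^sup>2 * (fold_density l * fold_sum l)) \<partial>lborel)"
    unfolding nn_integral_mu_R_fold[OF m nn]
  proof (rule nn_integral_cong)
    fix l :: real
    show "ennreal (2 / pi\<^sup>2 * fold_weight l * (log_quotient (fold_map l) + log_quotient (- fold_map l)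
        + log_quotient (1 / fold_map l) + log_quotient (- (1 / fold_map l)))) * indicator {0<..} l =
        ennreal (2 / pi\<^sup>2 * (fold_density l * fold_sum l))"
      by (cases "0 < l") (simp_all only: fold_sum_eq fold_density_def, simp_all add: mult.assoc)
  qed
  have m2: "(\<lambda>x. (log_quotient x)\<^sup>2) \<in> borel_measurable borel" by measurable
  show "(\<integral>\<^sup>+x. ennreal ((log_quotient x)\<^sup>2) \<partial>mu_R) = (\<integral>\<^sup>+l. ennreal (2 / pi\<^sup>2 * (fold_density l * fold_square_sum l)) \<partial>lborel)"
    unfolding nn_integral_mu_R_fold[OF m2 zero_le_power2]
  proof (rule nn_integral_cong)
    fix l :: real
    show "ennreal (2 / pi\<^sup>2 * fold_weight l * ((log_quotient (fold_map l))\<^sup>2 + (log_quotient (- fold_map l))\<^sup>2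
        + (log_quotient (1 / fold_map l))\<^sup>2 + (log_quotient (- (1 / fold_map l)))\<^sup>2)) * indicator {0<..} l =
        ennreal (2 / pi\<^sup>2 * (fold_density l * fold_square_sum l))"
      by (cases "0 < l") (simp_all only: fold_sum_eq fold_density_def, simp_all add: mult.assoc)
  qed
qed

lemma fold_sum_integral:
  "integrable lborel (\<lambda>l. fold_density l * fold_sum l)"
  "\<bar>(\<integral>l. fold_density l * fold_sum l \<partial>lborel)
     - (list_moment (fold_moment 1) 0 poly_SA / 100000000 + list_moment (fold_moment 1) 0 poly_SC / 100000000 + 4 * fold_moment 2 0)\<bar>
     \<le> 2 / 10000000 * fold_moment 1 0 + 83 / 100000 * fold_moment 1 1"
proof -
  let ?g = "\<lambda>l. ipoly poly_SA ((exp (- l))\<^sup>2) / 100000000 + ipoly poly_SC ((exp (- l))\<^sup>2) / 100000000 + 4 * l"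
  let ?e = "\<lambda>l. 2 / 10000000 + 83 / 100000 * (exp (- l))\<^sup>2 :: real"
  have fm: "has_bochner_integral lborel (\<lambda>l. fold_density l * (l ^ m * ((exp (- l))\<^sup>2) ^ k)) (fold_moment (Suc m) k)" for m k
    using has_bochner_integral_fold_moment[of m k] by (simp add: fold_density_def mult.assoc)
  have le: "\<bar>fold_sum l - ?g l\<bar> \<le> ?e l" if "0 < l" for l
  proof -
    have q: "0 \<le> (exp (- l))\<^sup>2" "(exp (- l))\<^sup>2 \<le> 1" using that by (auto simp: power_le_one)
    show ?thesis using SA_approx[OF q] SC_approx[OF q] unfolding fold_sum_def by linarith
  qed
  have g: "has_bochner_integral lborel (\<lambda>l. fold_density l * ?g l)
      (list_moment (fold_moment 1) 0 poly_SA / 100000000 + list_moment (fold_moment 1) 0 poly_SC / 100000000 + 4 * fold_moment 2 0)"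
  proof -
    have "has_bochner_integral lborel (\<lambda>l. fold_density l * (l ^ 0 * ipoly poly_SA ((exp (- l))\<^sup>2)) / 100000000
       + fold_density l * (l ^ 0 * ipoly poly_SC ((exp (- l))\<^sup>2)) / 100000000 + 4 * (fold_density l * (l ^ 1 * ((exp (- l))\<^sup>2) ^ 0)))
       (list_moment (fold_moment (Suc 0)) 0 poly_SA / 100000000 + list_moment (fold_moment (Suc 0)) 0 poly_SC / 100000000 + 4 * fold_moment (Suc 1) 0)"
      by (intro has_bochner_integral_add has_bochner_integral_divide_zero has_bochner_integral_mult_right
          has_bochner_integral_fold_ipoly fm)
    then show ?thesis by (simp add: algebra_simps numeral_2_eq_2)
  qed
  have e: "has_bochner_integral lborel (\<lambda>l. fold_density l * ?e l) (2 / 10000000 * fold_moment 1 0 + 83 / 100000 * fold_moment 1 1)"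
  proof -
    have "has_bochner_integral lborel (\<lambda>l. 2 / 10000000 * (fold_density l * (l ^ 0 * ((exp (- l))\<^sup>2) ^ 0))
       + 83 / 100000 * (fold_density l * (l ^ 0 * ((exp (- l))\<^sup>2) ^ 1)))
       (2 / 10000000 * fold_moment (Suc 0) 0 + 83 / 100000 * fold_moment (Suc 0) 1)"
      by (intro has_bochner_integral_add has_bochner_integral_mult_right fm)
    then show ?thesis by (simp add: algebra_simps)
  qed
  show "integrable lborel (\<lambda>l. fold_density l * fold_sum l)"
    "\<bar>(\<integral>l. fold_density l * fold_sum l \<partial>lborel)
     - (list_moment (fold_moment 1) 0 poly_SA / 100000000 + list_moment (fold_moment 1) 0 poly_SC / 100000000 + 4 * fold_moment 2 0)\<bar>
     \<le> 2 / 10000000 * fold_moment 1 0 + 83 / 100000 * fold_moment 1 1"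
    using integral_approx[OF fold_sum_measurable le g e] by auto
qed

text \<open>The factors 3, 7, 3 v and 9 v below bound 2 |x| + e for x = \<open>SA\<close>,
  \<open>SC\<close>, \<open>DA\<close>, \<open>DC\<close>, using |x| <= 1, 3, v, 4 v. The
  coefficient 0.020085 is half of the total (15 + 546 + 90 + 3366) / 100000.\<close>

lemma fold_square_sum_approx:
  fixes l :: real
  assumes "0 < l"
  defines "v \<equiv> exp (- l)"
  shows "\<bar>fold_square_sum l - (ipoly poly_P (v\<^sup>2) / 20000000000000000 + 4 * (l * (ipoly poly_SC (v\<^sup>2) / 100000000)) + 8 * l\<^sup>2)\<bar>
     \<le> 1 / 1000000 + 20085 / 1000000 * v\<^sup>2 + 4 * (l * (1 / 10000000 + 78 / 100000 * v\<^sup>2))"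
proof -
  have v: "0 \<le> v" "v \<le> 1" using assms by auto
  have q: "0 \<le> v\<^sup>2" "v\<^sup>2 \<le> 1" using v by (auto simp: power_le_one)
  define sa sc da dc where "sa = ipoly poly_SA (v\<^sup>2) / 100000000" and "sc = ipoly poly_SC (v\<^sup>2) / 100000000"
    and "da = v * ipoly list_DA (v\<^sup>2) / 100000000" and "dc = v * ipoly list_DC (v\<^sup>2) / 100000000"
  have P: "ipoly poly_P (v\<^sup>2) / 20000000000000000 = (sa\<^sup>2 + sc\<^sup>2 + da\<^sup>2 + dc\<^sup>2) / 2"
    unfolding poly_P_def sa_def sc_def da_def dc_def
    by (simp add: ipoly_padd ipoly_pmul power2_eq_square field_simps)
  have 1: "\<bar>(SA (v\<^sup>2))\<^sup>2 - sa\<^sup>2\<bar> \<le> 3 * (1 / 10000000 + 5 / 100000 * v\<^sup>2)"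
    unfolding sa_def using SA_approx[OF q] SA_SC_bounds(1)[OF q] q by (intro abs_diff_squares_le) linarith+
  have 2: "\<bar>(SC (v\<^sup>2))\<^sup>2 - sc\<^sup>2\<bar> \<le> 7 * (1 / 10000000 + 78 / 100000 * v\<^sup>2)"
    unfolding sc_def using SC_approx[OF q] SA_SC_bounds(2)[OF q] q by (intro abs_diff_squares_le) linarith+
  have "\<bar>(DA v)\<^sup>2 - da\<^sup>2\<bar> \<le> (3 * v) * (30 / 100000 * v)"
    unfolding da_def using DA_approx[OF v] v by (intro abs_diff_squares_le) linarith+
  then have 3: "\<bar>(DA v)\<^sup>2 - da\<^sup>2\<bar> \<le> 90 / 100000 * v\<^sup>2" by (simp add: power2_eq_square)
  have "\<bar>(DC v)\<^sup>2 - dc\<^sup>2\<bar> \<le> (9 * v) * (374 / 100000 * v)"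
    unfolding dc_def using DC_approx[OF v] v by (intro abs_diff_squares_le) linarith+
  then have 4: "\<bar>(DC v)\<^sup>2 - dc\<^sup>2\<bar> \<le> 3366 / 100000 * v\<^sup>2" by (simp add: power2_eq_square)
  have "l * \<bar>SC (v\<^sup>2) - sc\<bar> \<le> l * (1 / 10000000 + 78 / 100000 * v\<^sup>2)"
    using SC_approx[OF q] assms(1) unfolding sc_def by (intro mult_left_mono) auto
  moreover have "\<bar>l * SC (v\<^sup>2) - l * sc\<bar> = l * \<bar>SC (v\<^sup>2) - sc\<bar>"
    using assms(1) by (simp add: abs_mult flip: right_diff_distrib)
  ultimately have 5: "\<bar>l * SC (v\<^sup>2) - l * sc\<bar> \<le> l * (1 / 10000000 + 78 / 100000 * v\<^sup>2)" by simp
  have comb: "\<bar>((A + B + C + D) / 2 + 4 * E + F) - ((A' + B' + C' + D') / 2 + 4 * E' + F)\<bar> \<le> (a + b + c + d) / 2 + 4 * e"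
    if "\<bar>A - A'\<bar> \<le> a" "\<bar>B - B'\<bar> \<le> b" "\<bar>C - C'\<bar> \<le> c" "\<bar>D - D'\<bar> \<le> d" "\<bar>E - E'\<bar> \<le> e"
    for A B C D E F A' B' C' D' E' a b c d e :: real
    using that[THEN abs_le_D1] that[THEN abs_le_D2] unfolding add_divide_distrib by (intro abs_leI) linarith+
  show ?thesis
    unfolding fold_square_sum_def P v_def[symmetric] sc_def[symmetric]
  proof (rule order_trans[OF comb[OF 1 2 3 4 5]], rule add_right_mono)
    show "(3 * (1 / 10000000 + 5 / 100000 * v\<^sup>2) + 7 * (1 / 10000000 + 78 / 100000 * v\<^sup>2)
        + 90 / 100000 * v\<^sup>2 + 3366 / 100000 * v\<^sup>2) / 2 \<le> 1 / 1000000 + 20085 / 1000000 * v\<^sup>2"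
      using q by simp
  qed
qed

lemma fold_square_sum_integral:
  "integrable lborel (\<lambda>l. fold_density l * fold_square_sum l)"
  "\<bar>(\<integral>l. fold_density l * fold_square_sum l \<partial>lborel)
     - (list_moment (fold_moment 1) 0 poly_P / 20000000000000000 + 4 * (list_moment (fold_moment 2) 0 poly_SC / 100000000) + 8 * fold_moment 3 0)\<bar>
     \<le> 1 / 1000000 * fold_moment 1 0 + 20085 / 1000000 * fold_moment 1 1
       + (4 / 10000000 * fold_moment 2 0 + 312 / 100000 * fold_moment 2 1)"
proof -
  let ?g = "\<lambda>l. ipoly poly_P ((exp (- l))\<^sup>2) / 20000000000000000 + 4 * (l * (ipoly poly_SC ((exp (- l))\<^sup>2) / 100000000)) + 8 * l\<^sup>2"
  let ?e = "\<lambda>l. 1 / 1000000 + 20085 / 1000000 * (exp (- l))\<^sup>2 + 4 * (l * (1 / 10000000 + 78 / 100000 * (exp (- l))\<^sup>2)) :: real"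
  have fm: "has_bochner_integral lborel (\<lambda>l. fold_density l * (l ^ m * ((exp (- l))\<^sup>2) ^ k)) (fold_moment (Suc m) k)" for m k
    using has_bochner_integral_fold_moment[of m k] by (simp add: fold_density_def mult.assoc)
  have g: "has_bochner_integral lborel (\<lambda>l. fold_density l * ?g l)
     (list_moment (fold_moment 1) 0 poly_P / 20000000000000000 + 4 * (list_moment (fold_moment 2) 0 poly_SC / 100000000) + 8 * fold_moment 3 0)"
  proof -
    have "has_bochner_integral lborel (\<lambda>l. fold_density l * (l ^ 0 * ipoly poly_P ((exp (- l))\<^sup>2)) / 20000000000000000
       + 4 * (fold_density l * (l ^ 1 * ipoly poly_SC ((exp (- l))\<^sup>2)) / 100000000) + 8 * (fold_density l * (l ^ 2 * ((exp (- l))\<^sup>2) ^ 0)))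
       (list_moment (fold_moment (Suc 0)) 0 poly_P / 20000000000000000 + 4 * (list_moment (fold_moment (Suc 1)) 0 poly_SC / 100000000)
         + 8 * fold_moment (Suc 2) 0)"
      by (intro has_bochner_integral_add has_bochner_integral_divide_zero has_bochner_integral_mult_right
          has_bochner_integral_fold_ipoly fm)
    then show ?thesis by (simp add: algebra_simps numeral_2_eq_2 numeral_3_eq_3)
  qed
  have e: "has_bochner_integral lborel (\<lambda>l. fold_density l * ?e l) (1 / 1000000 * fold_moment 1 0 + 20085 / 1000000 * fold_moment 1 1
       + (4 / 10000000 * fold_moment 2 0 + 312 / 100000 * fold_moment 2 1))"
  proof -
    have "has_bochner_integral lborel (\<lambda>l. 1 / 1000000 * (fold_density l * (l ^ 0 * ((exp (- l))\<^sup>2) ^ 0))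
       + 20085 / 1000000 * (fold_density l * (l ^ 0 * ((exp (- l))\<^sup>2) ^ 1))
       + (4 / 10000000 * (fold_density l * (l ^ 1 * ((exp (- l))\<^sup>2) ^ 0)) + 312 / 100000 * (fold_density l * (l ^ 1 * ((exp (- l))\<^sup>2) ^ 1))))
       (1 / 1000000 * fold_moment (Suc 0) 0 + 20085 / 1000000 * fold_moment (Suc 0) 1
       + (4 / 10000000 * fold_moment (Suc 1) 0 + 312 / 100000 * fold_moment (Suc 1) 1))"
      by (intro has_bochner_integral_add has_bochner_integral_mult_right fm)
    then show ?thesis by (simp add: algebra_simps numeral_2_eq_2)
  qed
  show "integrable lborel (\<lambda>l. fold_density l * fold_square_sum l)"
    "\<bar>(\<integral>l. fold_density l * fold_square_sum l \<partial>lborel)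
     - (list_moment (fold_moment 1) 0 poly_P / 20000000000000000 + 4 * (list_moment (fold_moment 2) 0 poly_SC / 100000000) + 8 * fold_moment 3 0)\<bar>
     \<le> 1 / 1000000 * fold_moment 1 0 + 20085 / 1000000 * fold_moment 1 1
       + (4 / 10000000 * fold_moment 2 0 + 312 / 100000 * fold_moment 2 1)"
    using integral_approx[OF fold_square_sum_measurable fold_square_sum_approx g e] by auto
qed

lemma fold_moment_values:
  "fold_moment 1 0 = odd_zeta 2" "fold_moment 1 1 = odd_zeta 2 - 1"
  "fold_moment 2 0 = 2 * odd_zeta 3" "fold_moment 2 1 = 2 * (odd_zeta 3 - 1)" "fold_moment 3 0 = 6 * odd_zeta 4"
  by (simp_all add: fold_moment_def eval_nat_numeral)

text \<open>The factor 2 / pi^2 is rewritten as 1 / (4 \<open>odd_zeta 2\<close>), so the final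
  estimates are linear in the odd zeta values and the tail moments.\<close>

lemma integral_mu_R_eq_fold:
  assumes nn: "(\<integral>\<^sup>+x. ennreal (f x) \<partial>mu_R) = (\<integral>\<^sup>+l. ennreal (2 / pi\<^sup>2 * (fold_density l * F l)) \<partial>lborel)"
    and [measurable]: "f \<in> borel_measurable borel" and f: "\<And>x. 0 \<le> f x"
    and F: "integrable lborel (\<lambda>l. fold_density l * F l)" "\<And>l. 0 < l \<Longrightarrow> 0 \<le> F l"
  shows "(\<integral>x. f x \<partial>mu_R) = (\<integral>l. fold_density l * F l \<partial>lborel) / (4 * odd_zeta 2)"
proof -
  have nn0: "0 \<le> fold_density l * F l" for l
    using F(2)[of l] fold_density_nonneg[of l] by (cases "0 < l") (auto simp: fold_density_def)
  have "(\<integral>x. f x \<partial>mu_R) = enn2real (\<integral>\<^sup>+x. ennreal (f x) \<partial>mu_R)"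
    using f by (intro integral_eq_nn_integral) auto
  also have "\<dots> = enn2real (ennreal (\<integral>l. 2 / pi\<^sup>2 * (fold_density l * F l) \<partial>lborel))"
    unfolding nn using F(1) nn0 by (subst nn_integral_eq_integral) auto
  also have "\<dots> = (\<integral>l. 2 / pi\<^sup>2 * (fold_density l * F l) \<partial>lborel)"
    using nn0 by (intro enn2real_ennreal Bochner_Integration.integral_nonneg) auto
  finally show ?thesis by (simp add: odd_zeta_2)
qed

lemma c1_eq: "c1 = (\<integral>l. fold_density l * fold_sum l \<partial>lborel) / (8 * odd_zeta 2)"
proof -
  have nn: "0 \<le> log_quotient x" for x by (simp add: log_quotient_def)
  have pos: "0 \<le> fold_sum l" if "0 < l" for l
    unfolding fold_sum_eq(1)[OF that, symmetric] by (intro add_nonneg_nonneg nn)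
  have "c1 = 1 / 2 * (\<integral>x. log_quotient x \<partial>mu_R)"
    unfolding c1_def L1_norm_def using nn by (simp add: log_quotient_def)
  also have "(\<integral>x. log_quotient x \<partial>mu_R) = (\<integral>l. fold_density l * fold_sum l \<partial>lborel) / (4 * odd_zeta 2)"
    by (rule integral_mu_R_eq_fold[OF nn_integral_log_quotient(1) _ nn fold_sum_integral(1) pos])
       (simp add: log_quotient_def)
  finally show ?thesis by simp
qed

lemma c2_eq: "c2 = sqrt ((\<integral>l. fold_density l * fold_square_sum l \<partial>lborel) / (4 * odd_zeta 2))"
proof -
  have pos: "0 \<le> fold_square_sum l" if "0 < l" for l
    unfolding fold_sum_eq(2)[OF that, symmetric] by (intro add_nonneg_nonneg zero_le_power2)
  have "c2 = sqrt (\<integral>x. (log_quotient x)\<^sup>2 \<partial>mu_R)"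
    unfolding c2_def L2_norm_def by (simp add: log_quotient_def)
  also have "(\<integral>x. (log_quotient x)\<^sup>2 \<partial>mu_R) = (\<integral>l. fold_density l * fold_square_sum l \<partial>lborel) / (4 * odd_zeta 2)"
    by (rule integral_mu_R_eq_fold[OF nn_integral_log_quotient(2) _ _ fold_square_sum_integral(1) pos])
       (simp_all add: log_quotient_def)
  finally show ?thesis .
qed

lemma c1_bounds: "678 / 1000 \<le> c1" "c1 < 679 / 1000"
proof -
  define I where "I = (\<integral>l. fold_density l * fold_sum l \<partial>lborel)"
  have fact1: "fact 1 = (1::real)" by simp
  have I: "\<bar>I - ((odd_zeta 2 * 69314708 - tail_moment 2 0 poly_SA) / 100000000
       + (odd_zeta 2 * 69314987 - tail_moment 2 0 poly_SC) / 100000000 + 8 * odd_zeta 3)\<bar>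
     \<le> 2 / 10000000 * odd_zeta 2 + 83 / 100000 * (odd_zeta 2 - 1)"
    using fold_sum_integral(2) unfolding list_moment_eval isum_values fold_moment_values I_def
    by (simp add: numeral_2_eq_2)
  have pos: "8 * odd_zeta 2 > 0" using odd_zeta_numeric by linarith
  have "678 / 1000 * (8 * odd_zeta 2) \<le> I"
    using I[THEN abs_le_D1] I[THEN abs_le_D2] tail_moment_SA[THEN abs_le_D1] tail_moment_SA[THEN abs_le_D2]
      tail_moment_SC[THEN abs_le_D1] tail_moment_SC[THEN abs_le_D2] odd_zeta_numeric unfolding diff_divide_distrib by argo
  moreover have "I < 679 / 1000 * (8 * odd_zeta 2)"
    using I[THEN abs_le_D1] I[THEN abs_le_D2] tail_moment_SA[THEN abs_le_D1] tail_moment_SA[THEN abs_le_D2]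
      tail_moment_SC[THEN abs_le_D1] tail_moment_SC[THEN abs_le_D2] odd_zeta_numeric unfolding diff_divide_distrib by argo
  ultimately show "678 / 1000 \<le> c1" "c1 < 679 / 1000"
    unfolding c1_eq I_def[symmetric] using pos by (simp_all add: pos_le_divide_eq pos_divide_less_eq)
qed

lemma c2_bounds: "2505 / 1000 \<le> c2" "c2 < 2506 / 1000"
proof -
  define I where "I = (\<integral>l. fold_density l * fold_square_sum l \<partial>lborel)"
  have I: "\<bar>I - ((odd_zeta 2 * 19218149915192274 - tail_moment 2 0 poly_P) / 20000000000000000
       + 4 * (2 * (odd_zeta 3 * 69314987 - tail_moment 3 0 poly_SC) / 100000000) + 48 * odd_zeta 4)\<bar>
     \<le> 1 / 1000000 * odd_zeta 2 + 20085 / 1000000 * (odd_zeta 2 - 1)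
       + (4 / 10000000 * (2 * odd_zeta 3) + 312 / 100000 * (2 * (odd_zeta 3 - 1)))"
    using fold_square_sum_integral(2) unfolding list_moment_eval isum_values fold_moment_values I_def
    by (simp add: numeral_2_eq_2 numeral_3_eq_3)
  have pos: "4 * odd_zeta 2 > 0" using odd_zeta_numeric by linarith
  \<comment> \<open>The numbers 6.275025 and, below, 6.280036 are the exact squares of 2.505 and
    2.506.\<close>
  have "6275025 / 1000000 * (4 * odd_zeta 2) \<le> I"
    using I[THEN abs_le_D1] I[THEN abs_le_D2] tail_moment_P[THEN abs_le_D1] tail_moment_P[THEN abs_le_D2]
      tail_moment_SC_3[THEN abs_le_D1] tail_moment_SC_3[THEN abs_le_D2] odd_zeta_numeric unfolding diff_divide_distrib right_diff_distrib by linarith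
  then have "(2505 / 1000)\<^sup>2 \<le> I / (4 * odd_zeta 2)"
    using pos by (simp add: pos_le_divide_eq power2_eq_square)
  then show "2505 / 1000 \<le> c2"
    unfolding c2_eq I_def[symmetric] by (rule real_le_rsqrt)
  have "I < 6280036 / 1000000 * (4 * odd_zeta 2)"
    using I[THEN abs_le_D1] I[THEN abs_le_D2] tail_moment_P[THEN abs_le_D1] tail_moment_P[THEN abs_le_D2]
      tail_moment_SC_3[THEN abs_le_D1] tail_moment_SC_3[THEN abs_le_D2] odd_zeta_numeric unfolding diff_divide_distrib right_diff_distrib by linarith
  then have "I / (4 * odd_zeta 2) < (2506 / 1000)\<^sup>2"
    using pos by (simp add: pos_divide_less_eq power2_eq_square)
  then show "c2 < 2506 / 1000"
    unfolding c2_eq I_def[symmetric] by (rule real_less_lsqrt[rotated]) simp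
qed

subsection \<open>The Robin constant of the strip\<close>

theorem theorem7:
  fixes \<epsilon> :: real
  assumes "0 < \<epsilon>" and "\<epsilon> < 1"
  shows "robin_constant (strip \<epsilon>) \<ge>
           ereal (7 * zeta3 / (2 * pi\<^sup>2) - c1 * \<epsilon> - c2 * \<epsilon> powr (1 / 8))
       \<and> (\<forall>\<mu> \<in> borel_prob_on (strip \<epsilon>).
            energy \<mu> \<ge> ereal (7 * zeta3 / (2 * pi\<^sup>2) - c1 * \<epsilon> - c2 * \<epsilon> powr (1 / 8)))
       \<and> 0.678 \<le> c1 \<and> c1 < 0.679
       \<and> 2.505 \<le> c2 \<and> c2 < 2.506"
proof -
  have c: "0.678 \<le> c1" "c1 < 0.679" "2.505 \<le> c2" "c2 < 2.506"
    using c1_bounds c2_bounds by simp_all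
  have "0.678 * \<epsilon> + 2.505 * \<epsilon> powr (1 / 8) \<le> c1 * \<epsilon> + c2 * \<epsilon> powr (1 / 8)"
    using c assms by (intro add_mono mult_right_mono) auto
  with strip_bound[OF assms]
  have le: "7 * zeta3 / (2 * pi\<^sup>2) - c1 * \<epsilon> - c2 * \<epsilon> powr (1 / 8) \<le>
      7 * zeta3 / (2 * pi\<^sup>2) - 2 * ((1 + \<epsilon>) * ln (1 + \<epsilon>) - \<epsilon> * ln \<epsilon>)" by linarith
  have energy: "ereal (7 * zeta3 / (2 * pi\<^sup>2) - c1 * \<epsilon> - c2 * \<epsilon> powr (1 / 8)) \<le> energy \<mu>"
    if "\<mu> \<in> borel_prob_on (strip \<epsilon>)" for \<mu>
    by (rule order_trans[OF _ energy_strip_ge[OF assms(1) that]]) (simp only: ereal_less_eq le)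
  then have "robin_constant (strip \<epsilon>) \<ge> ereal (7 * zeta3 / (2 * pi\<^sup>2) - c1 * \<epsilon> - c2 * \<epsilon> powr (1 / 8))"
    unfolding robin_constant_def by (rule INF_greatest)
  then show ?thesis by (intro conjI ballI c energy)
qed

end
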